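(* Let $X$ be an infinite-dimensional (real or complex) reflexive Banach space, and let $T\in\mathcal{B}(X)$. If either $\sigma(T)\subseteq\mathbb{R}$, or $\sigma(T)\cap\mathbb{R}$ has infinite cardinality, then $T$ admits an almost-invariant halfspace of defect $\leq 1$.
   Context: $\mathcal{B}(X)$ is the algebra of bounded linear operators on $X$. If $X$ is complex, $\sigma(T)$ is the usual spectrum. If $X$ is real, its complexification is $X_\mathbb{C}=X\oplus iX$ with the usual complex vector space structure and a standard complete norm equivalent to $\|x\|+\|y\|$; $T_\mathbb{C}\in\mathcal{B}(X_\mathbb{C})$ is $T_\mathbb{C}(x\oplus iy)=Tx\oplus iTy$, and $\sigma(T):=\sigma(T_\mathbb{C})$. In the real case $\sigma(T)\cap\mathbb{R}$ equals the real spectrum $\sigma_\mathbb{R}(T)=\{\lambda\in\mathbb{R}:\lambda-T\text{ is not invertible in }\mathcal{B}(X)\}$. A halfspace of $X$ is a norm-closed subspace $Y$ with $\dim(Y)=\dim(X/Y)=\infty$. An almost-invariant halfspace under $T$ of defect $\leq d$ is a halfspace $Y$ of $X$ such that $TY\subseteq Y+E$ for some subspace $E$ of $X$ with $\dim(E)\leq d$. *)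

theory Defs
  imports "HOL-Analysis.Analysis"
begin

section \<open>Complex normed and Banach spaces\<close>

text \<open>The norm and the real scalar multiplication of a complex space are those of the library
  classes; only the multiplication by complex scalars is added.\<close>

class scaleC =
  fixes scaleC :: "complex \<Rightarrow> 'a \<Rightarrow> 'a"  (infixr "*\<^sub>C" 75)

class complex_vector = scaleC + ab_group_add +
  assumes scaleC_add_right: "a *\<^sub>C (x + y) = a *\<^sub>C x + a *\<^sub>C y"
    and scaleC_add_left: "(a + b) *\<^sub>C x = a *\<^sub>C x + b *\<^sub>C x"
    and scaleC_scaleC: "a *\<^sub>C (b *\<^sub>C x) = (a * b) *\<^sub>C x"
    and scaleC_one: "1 *\<^sub>C x = x"

global_interpretation complex_vector: vector_space "scaleC :: complex \<Rightarrow> 'a \<Rightarrow> 'a::complex_vector"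
  by unfold_locales (simp_all add: scaleC_add_right scaleC_add_left scaleC_scaleC scaleC_one)

class complex_normed_vector = complex_vector + real_normed_vector +
  assumes scaleR_scaleC: "r *\<^sub>R x = complex_of_real r *\<^sub>C x"
    and norm_scaleC: "norm (a *\<^sub>C x) = cmod a * norm x"

class complex_banach = complex_normed_vector + banach

instantiation complex :: complex_banach
begin

definition scaleC_complex :: "complex \<Rightarrow> complex \<Rightarrow> complex"
  where "scaleC_complex a x = a * x"

instance
  by standard (simp_all add: scaleC_complex_def algebra_simps scaleR_conv_of_real norm_mult)

end

section \<open>Bounded complex-linear operators\<close>

definition bounded_clinear :: "('a::complex_normed_vector \<Rightarrow> 'b::complex_normed_vector) \<Rightarrow> bool"
  where "bounded_clinear f \<longleftrightarrow> bounded_linear f \<and> (\<forall>c x. f (c *\<^sub>C x) = c *\<^sub>C f x)"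

lemma bounded_clinear_scaleC:
  assumes "bounded_clinear f"
  shows "bounded_clinear (\<lambda>x. c *\<^sub>C f x)"
  unfolding bounded_clinear_def
proof (intro conjI allI)
  have f: "bounded_linear f" and fC: "\<And>c x. f (c *\<^sub>C x) = c *\<^sub>C f x"
    using assms by (auto simp: bounded_clinear_def)
  show "bounded_linear (\<lambda>x. c *\<^sub>C f x)"
  proof (rule bounded_linear_intro[where K = "cmod c * onorm f"])
    show "norm (c *\<^sub>C f x) \<le> norm x * (cmod c * onorm f)" for x
      using mult_left_mono[OF onorm[OF f, of x], of "cmod c"]
      by (simp add: norm_scaleC mult_ac)
  qed (simp_all add: linear_simps[OF f] scaleC_add_right scaleR_scaleC scaleC_scaleC fC mult.commute)
  show "c *\<^sub>C f (d *\<^sub>C x) = d *\<^sub>C c *\<^sub>C f x" for d x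
    by (simp add: fC scaleC_scaleC mult.commute)
qed

typedef (overloaded) ('a, 'b) cblinfun ("(_ \<Rightarrow>\<^sub>C\<^sub>L /_)" [22, 21] 21) =
  "{f :: 'a::complex_normed_vector \<Rightarrow> 'b::complex_normed_vector. bounded_clinear f}"
  morphisms cblinfun_apply CBlinfun
  by (rule exI[of _ "\<lambda>x. 0"]) (simp add: bounded_clinear_def)

setup_lifting type_definition_cblinfun

instantiation cblinfun :: (complex_normed_vector, complex_normed_vector) complex_normed_vector
begin

lift_definition norm_cblinfun :: "'a \<Rightarrow>\<^sub>C\<^sub>L 'b \<Rightarrow> real" is onorm .

lift_definition zero_cblinfun :: "'a \<Rightarrow>\<^sub>C\<^sub>L 'b" is "\<lambda>x. 0"
  by (simp add: bounded_clinear_def)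

lift_definition plus_cblinfun :: "'a \<Rightarrow>\<^sub>C\<^sub>L 'b \<Rightarrow> 'a \<Rightarrow>\<^sub>C\<^sub>L 'b \<Rightarrow> 'a \<Rightarrow>\<^sub>C\<^sub>L 'b" is "\<lambda>f g x. f x + g x"
  by (simp add: bounded_clinear_def bounded_linear_add scaleC_add_right)

lift_definition minus_cblinfun :: "'a \<Rightarrow>\<^sub>C\<^sub>L 'b \<Rightarrow> 'a \<Rightarrow>\<^sub>C\<^sub>L 'b \<Rightarrow> 'a \<Rightarrow>\<^sub>C\<^sub>L 'b" is "\<lambda>f g x. f x - g x"
  by (simp add: bounded_clinear_def bounded_linear_sub complex_vector.scale_right_diff_distrib)

lift_definition uminus_cblinfun :: "'a \<Rightarrow>\<^sub>C\<^sub>L 'b \<Rightarrow> 'a \<Rightarrow>\<^sub>C\<^sub>L 'b" is "\<lambda>f x. - f x"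
  by (simp add: bounded_clinear_def bounded_linear_minus)

lift_definition scaleC_cblinfun :: "complex \<Rightarrow> 'a \<Rightarrow>\<^sub>C\<^sub>L 'b \<Rightarrow> 'a \<Rightarrow>\<^sub>C\<^sub>L 'b" is "\<lambda>c f x. c *\<^sub>C f x"
  by (rule bounded_clinear_scaleC)

definition scaleR_cblinfun :: "real \<Rightarrow> 'a \<Rightarrow>\<^sub>C\<^sub>L 'b \<Rightarrow> 'a \<Rightarrow>\<^sub>C\<^sub>L 'b"
  where "scaleR_cblinfun r f = complex_of_real r *\<^sub>C f"

definition dist_cblinfun :: "'a \<Rightarrow>\<^sub>C\<^sub>L 'b \<Rightarrow> 'a \<Rightarrow>\<^sub>C\<^sub>L 'b \<Rightarrow> real"
  where "dist_cblinfun f g = norm (f - g)"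

definition sgn_cblinfun :: "'a \<Rightarrow>\<^sub>C\<^sub>L 'b \<Rightarrow> 'a \<Rightarrow>\<^sub>C\<^sub>L 'b"
  where "sgn_cblinfun f = inverse (norm f) *\<^sub>R f"

definition uniformity_cblinfun :: "(('a \<Rightarrow>\<^sub>C\<^sub>L 'b) \<times> ('a \<Rightarrow>\<^sub>C\<^sub>L 'b)) filter"
  where "uniformity_cblinfun = (INF e\<in>{0<..}. principal {(f, g). dist f g < e})"

definition open_cblinfun :: "('a \<Rightarrow>\<^sub>C\<^sub>L 'b) set \<Rightarrow> bool"
  where "open_cblinfun S \<longleftrightarrow> (\<forall>f\<in>S. \<forall>\<^sub>F (f', g) in uniformity. f' = f \<longrightarrow> g \<in> S)"

instance
proof
  fix f g h :: "'a \<Rightarrow>\<^sub>C\<^sub>L 'b" and a b :: complex and r s :: real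
  show "f + g + h = f + (g + h)" "f + g = g + f" "0 + f = f" "- f + f = 0" "f - g = f + - g"
    by (transfer, simp add: add_ac)+
  show C1: "a *\<^sub>C (f + g) = a *\<^sub>C f + a *\<^sub>C g" for a and f g :: "'a \<Rightarrow>\<^sub>C\<^sub>L 'b"
    by transfer (simp add: scaleC_add_right)
  show C2: "(a + b) *\<^sub>C f = a *\<^sub>C f + b *\<^sub>C f" for a b and f :: "'a \<Rightarrow>\<^sub>C\<^sub>L 'b"
    by transfer (simp add: scaleC_add_left)
  show C3: "a *\<^sub>C b *\<^sub>C f = (a * b) *\<^sub>C f" for a b and f :: "'a \<Rightarrow>\<^sub>C\<^sub>L 'b"
    by transfer (simp add: scaleC_scaleC)
  show C4: "1 *\<^sub>C f = f" for f :: "'a \<Rightarrow>\<^sub>C\<^sub>L 'b"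
    by transfer (simp add: scaleC_one)
  show "r *\<^sub>R (f + g) = r *\<^sub>R f + r *\<^sub>R g" "(r + s) *\<^sub>R f = r *\<^sub>R f + s *\<^sub>R f"
    "r *\<^sub>R s *\<^sub>R f = (r * s) *\<^sub>R f" "1 *\<^sub>R f = f"
    by (simp_all add: scaleR_cblinfun_def C1 C2 C3 C4)
  show "r *\<^sub>R f = complex_of_real r *\<^sub>C f"
    by (simp add: scaleR_cblinfun_def)
  show NC: "norm (a *\<^sub>C f) = cmod a * norm f" for a and f :: "'a \<Rightarrow>\<^sub>C\<^sub>L 'b"
  proof transfer
    fix a and f :: "'a \<Rightarrow> 'b" assume "bounded_clinear f"
    then have "onorm (\<lambda>x. cmod a *\<^sub>R f x) = \<bar>cmod a\<bar> * onorm f"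
      by (intro onorm_scaleR) (simp add: bounded_clinear_def)
    then show "onorm (\<lambda>x. a *\<^sub>C f x) = cmod a * onorm f"
      by (simp add: onorm_def norm_scaleC)
  qed
  show "norm (r *\<^sub>R f) = \<bar>r\<bar> * norm f"
    by (simp add: scaleR_cblinfun_def NC)
  show "norm (f + g) \<le> norm f + norm g"
    by transfer (simp add: bounded_clinear_def onorm_triangle)
  show "(norm f = 0) = (f = 0)"
    by transfer (auto simp: bounded_clinear_def onorm_eq_0)
qed (simp_all add: dist_cblinfun_def sgn_cblinfun_def uniformity_cblinfun_def open_cblinfun_def)

end

lift_definition id_cblinfun :: "'a::complex_normed_vector \<Rightarrow>\<^sub>C\<^sub>L 'a" is "\<lambda>x. x"
  by (simp add: bounded_clinear_def)

lift_definition cblinfun_compose ::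
  "'b::complex_normed_vector \<Rightarrow>\<^sub>C\<^sub>L 'c::complex_normed_vector \<Rightarrow>
   'a::complex_normed_vector \<Rightarrow>\<^sub>C\<^sub>L 'b \<Rightarrow> 'a \<Rightarrow>\<^sub>C\<^sub>L 'c" (infixl "o\<^sub>C\<^sub>L" 55)
  is "\<lambda>f g x. f (g x)"
  by (simp add: bounded_clinear_def bounded_linear_compose)

text \<open>Spectrum relative to the algebra of bounded operators, so the inverse is required to be
  bounded even when the space is not complete.\<close>

definition op_spectrum :: "('a::complex_normed_vector \<Rightarrow>\<^sub>C\<^sub>L 'a) \<Rightarrow> complex set"
  where "op_spectrum T =
    {z. \<not> (\<exists>S. S o\<^sub>C\<^sub>L (z *\<^sub>C id_cblinfun - T) = id_cblinfun \<and>
              (z *\<^sub>C id_cblinfun - T) o\<^sub>C\<^sub>L S = id_cblinfun)}"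

section \<open>Complexification of a real space\<close>

text \<open>\<open>Complexification x y\<close> stands for $x \oplus iy$.\<close>

datatype 'a complexification = Complexification (re_part: 'a) (im_part: 'a)

text \<open>The plain product norm is not homogeneous for complex scalars. We use the Taylor norm
  $\|z\| = \sup_t \|\mathrm{Re}(e^{-it} z)\|$ instead.\<close>

instantiation complexification :: (real_normed_vector) complex_normed_vector
begin

definition zero_complexification :: "'a complexification"
  where "0 = Complexification 0 0"

definition plus_complexification ::
  "'a complexification \<Rightarrow> 'a complexification \<Rightarrow> 'a complexification"
  where "z + w = Complexification (re_part z + re_part w) (im_part z + im_part w)"

definition minus_complexification ::
  "'a complexification \<Rightarrow> 'a complexification \<Rightarrow> 'a complexification"
  where "z - w = Complexification (re_part z - re_part w) (im_part z - im_part w)"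

definition uminus_complexification :: "'a complexification \<Rightarrow> 'a complexification"
  where "- z = Complexification (- re_part z) (- im_part z)"

definition scaleC_complexification :: "complex \<Rightarrow> 'a complexification \<Rightarrow> 'a complexification"
  where "c *\<^sub>C z = Complexification (Re c *\<^sub>R re_part z - Im c *\<^sub>R im_part z)
                                (Re c *\<^sub>R im_part z + Im c *\<^sub>R re_part z)"

definition scaleR_complexification :: "real \<Rightarrow> 'a complexification \<Rightarrow> 'a complexification"
  where "r *\<^sub>R z = Complexification (r *\<^sub>R re_part z) (r *\<^sub>R im_part z)"

definition norm_complexification :: "'a complexification \<Rightarrow> real"
  where "norm z = (SUP t. norm (cos t *\<^sub>R re_part z + sin t *\<^sub>R im_part z))"

definition dist_complexification :: "'a complexification \<Rightarrow> 'a complexification \<Rightarrow> real"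
  where "dist_complexification z w = norm (z - w)"

definition sgn_complexification :: "'a complexification \<Rightarrow> 'a complexification"
  where "sgn_complexification z = inverse (norm z) *\<^sub>R z"

definition uniformity_complexification :: "('a complexification \<times> 'a complexification) filter"
  where "uniformity_complexification = (INF e\<in>{0<..}. principal {(z, w). dist z w < e})"

definition open_complexification :: "'a complexification set \<Rightarrow> bool"
  where "open_complexification S \<longleftrightarrow> (\<forall>z\<in>S. \<forall>\<^sub>F (z', w) in uniformity. z' = z \<longrightarrow> w \<in> S)"

lemmas complexification_defs =
  zero_complexification_def plus_complexification_def minus_complexification_def
  uminus_complexification_def scaleC_complexification_def scaleR_complexification_def

lemma norm_rotate_le_sum:
  fixes x y :: "'a::real_normed_vector"
  shows "norm (cos t *\<^sub>R x + sin t *\<^sub>R y) \<le> norm x + norm y"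
proof -
  have "norm (cos t *\<^sub>R x + sin t *\<^sub>R y) \<le> \<bar>cos t\<bar> * norm x + \<bar>sin t\<bar> * norm y"
    using norm_triangle_ineq[of "cos t *\<^sub>R x" "sin t *\<^sub>R y"] by simp
  also have "\<dots> \<le> 1 * norm x + 1 * norm y"
    by (intro add_mono mult_right_mono abs_cos_le_one abs_sin_le_one) auto
  finally show ?thesis by simp
qed

lemma norm_rotate_le: "norm (cos t *\<^sub>R re_part z + sin t *\<^sub>R im_part z) \<le> norm (z :: 'a complexification)"
  unfolding norm_complexification_def
  by (rule cSUP_upper) (auto intro!: bdd_aboveI2 norm_rotate_le_sum)

lemma norm_complexification_leI:
  fixes z :: "'a complexification"
  assumes "\<And>t. norm (cos t *\<^sub>R re_part z + sin t *\<^sub>R im_part z) \<le> K"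
  shows "norm z \<le> K"
  unfolding norm_complexification_def by (rule cSUP_least) (auto simp: assms)

lemma norm_re_part_le: "norm (re_part z) \<le> norm (z :: 'a complexification)"
  using norm_rotate_le[of 0 z] by simp

lemma norm_im_part_le: "norm (im_part z) \<le> norm (z :: 'a complexification)"
  using norm_rotate_le[of "pi / 2" z] by simp

lemma norm_complexification_le: "norm (z :: 'a complexification) \<le> norm (re_part z) + norm (im_part z)"
  by (intro norm_complexification_leI norm_rotate_le_sum)

lemma norm_scaleC_complexification_le:
  "norm (c *\<^sub>C z) \<le> cmod c * norm (z :: 'a complexification)"
proof (rule norm_complexification_leI)
  fix t
  define a where "a = Arg c"
  have c: "Re c = cmod c * cos a" "Im c = cmod c * sin a"
    unfolding a_def using rcis_cmod_Arg[of c] by (metis Re_rcis, metis Im_rcis)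
  have "cos t *\<^sub>R re_part (c *\<^sub>C z) + sin t *\<^sub>R im_part (c *\<^sub>C z)
      = cmod c *\<^sub>R (cos (t - a) *\<^sub>R re_part z + sin (t - a) *\<^sub>R im_part z)"
    by (simp add: complexification_defs c cos_diff sin_diff algebra_simps)
  then show "norm (cos t *\<^sub>R re_part (c *\<^sub>C z) + sin t *\<^sub>R im_part (c *\<^sub>C z)) \<le> cmod c * norm z"
    by (simp add: norm_rotate_le mult_left_mono)
qed

instance
proof
  fix x y z :: "'a complexification" and a b :: complex and r s :: real
  show "x + y + z = x + (y + z)" "x + y = y + x" "0 + x = x" "- x + x = 0" "x - y = x + - y"
    by (simp_all add: complexification_defs add_ac)
  show "a *\<^sub>C (x + y) = a *\<^sub>C x + a *\<^sub>C y" "(a + b) *\<^sub>C x = a *\<^sub>C x + b *\<^sub>C x"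
    by (simp_all add: complexification_defs algebra_simps)
  show C3: "a *\<^sub>C b *\<^sub>C x = (a * b) *\<^sub>C x" for a b and x :: "'a complexification"
    by (simp add: complexification_defs algebra_simps)
  show C4: "1 *\<^sub>C x = x" for x :: "'a complexification"
    by (simp add: complexification_defs)
  show "r *\<^sub>R (x + y) = r *\<^sub>R x + r *\<^sub>R y" "(r + s) *\<^sub>R x = r *\<^sub>R x + s *\<^sub>R x"
    "r *\<^sub>R s *\<^sub>R x = (r * s) *\<^sub>R x" "1 *\<^sub>R x = x"
    by (simp_all add: complexification_defs algebra_simps)
  show RC: "r *\<^sub>R x = complex_of_real r *\<^sub>C x" for r and x :: "'a complexification"
    by (simp add: complexification_defs)
  show NC: "norm (a *\<^sub>C x) = cmod a * norm x" for a and x :: "'a complexification"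
  proof (rule antisym)
    show "norm (a *\<^sub>C x) \<le> cmod a * norm x"
      by (rule norm_scaleC_complexification_le)
    show "cmod a * norm x \<le> norm (a *\<^sub>C x)"
    proof (cases "a = 0")
      case True
      then show ?thesis
        using order_trans[OF norm_ge_zero norm_re_part_le, of "a *\<^sub>C x"] by simp
    next
      case False
      have "norm x = norm (inverse a *\<^sub>C a *\<^sub>C x)"
        using False by (simp add: C3 C4)
      also have "\<dots> \<le> norm (a *\<^sub>C x) / cmod a"
        using norm_scaleC_complexification_le[of "inverse a" "a *\<^sub>C x"]
        by (simp add: norm_inverse divide_inverse mult.commute)
      finally show ?thesis
        using False by (simp add: field_simps)
    qed
  qed
  show "norm (r *\<^sub>R x) = \<bar>r\<bar> * norm x"
    by (simp add: RC NC)
  show "norm (x + y) \<le> norm x + norm y"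
  proof (rule norm_complexification_leI)
    fix t
    have "norm (cos t *\<^sub>R re_part (x + y) + sin t *\<^sub>R im_part (x + y))
        = norm ((cos t *\<^sub>R re_part x + sin t *\<^sub>R im_part x)
              + (cos t *\<^sub>R re_part y + sin t *\<^sub>R im_part y))"
      by (simp add: complexification_defs algebra_simps)
    also have "\<dots> \<le> norm x + norm y"
      by (intro order_trans[OF norm_triangle_ineq] add_mono norm_rotate_le)
    finally show "norm (cos t *\<^sub>R re_part (x + y) + sin t *\<^sub>R im_part (x + y)) \<le> norm x + norm y" .
  qed
  show "(norm x = 0) = (x = 0)"
  proof
    assume "norm x = 0"
    then show "x = 0"
      using norm_re_part_le[of x] norm_im_part_le[of x]
      by (cases x) (simp add: complexification_defs)
  next
    assume "x = 0"
    then show "norm x = 0"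
      by (simp add: norm_complexification_def complexification_defs)
  qed
qed (simp_all add: dist_complexification_def sgn_complexification_def
      uniformity_complexification_def open_complexification_def)

end

instance complexification :: (banach) complex_banach
proof
  fix X :: "nat \<Rightarrow> 'a complexification"
  assume X: "Cauchy X"
  have part: "Cauchy (\<lambda>n. p (X n))"
    if p: "\<And>z w. norm (p z - p w) \<le> norm (z - w)" for p :: "'a complexification \<Rightarrow> 'a"
  proof (rule CauchyI)
    fix e :: real assume "0 < e"
    then obtain M where "\<forall>m\<ge>M. \<forall>n\<ge>M. norm (X m - X n) < e"
      using CauchyD[OF X] by blast
    then show "\<exists>M. \<forall>m\<ge>M. \<forall>n\<ge>M. norm (p (X m) - p (X n)) < e"
      using p by (meson le_less_trans)
  qed
  have "Cauchy (\<lambda>n. re_part (X n))"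
  proof (rule part)
    show "norm (re_part z - re_part w) \<le> norm (z - w)" for z w :: "'a complexification"
      using norm_re_part_le[of "z - w"] by (simp add: complexification_defs)
  qed
  then obtain a where a: "(\<lambda>n. re_part (X n)) \<longlonglongrightarrow> a"
    using Cauchy_convergent convergent_def by blast
  have "Cauchy (\<lambda>n. im_part (X n))"
  proof (rule part)
    show "norm (im_part z - im_part w) \<le> norm (z - w)" for z w :: "'a complexification"
      using norm_im_part_le[of "z - w"] by (simp add: complexification_defs)
  qed
  then obtain b where b: "(\<lambda>n. im_part (X n)) \<longlonglongrightarrow> b"
    using Cauchy_convergent convergent_def by blast
  have "(\<lambda>n. norm (re_part (X n) - a) + norm (im_part (X n) - b)) \<longlonglongrightarrow> 0 + 0"
    using a b by (intro tendsto_add) (simp_all add: tendsto_norm_zero LIM_zero)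
  then have lim: "(\<lambda>n. norm (re_part (X n) - a) + norm (im_part (X n) - b)) \<longlonglongrightarrow> 0"
    by simp
  have "(\<lambda>n. X n - Complexification a b) \<longlonglongrightarrow> 0"
  proof (rule Lim_null_comparison[OF always_eventually lim], rule allI)
    show "norm (X n - Complexification a b) \<le> norm (re_part (X n) - a) + norm (im_part (X n) - b)" for n
      using norm_complexification_le[of "X n - Complexification a b"]
      by (simp add: complexification_defs)
  qed
  then show "convergent X"
    unfolding convergent_def by (auto dest: LIM_zero_cancel)
qed

lift_definition complexify ::
  "('a::real_normed_vector \<Rightarrow>\<^sub>L 'a) \<Rightarrow> 'a complexification \<Rightarrow>\<^sub>C\<^sub>L 'a complexification"
  is "\<lambda>T z. Complexification (blinfun_apply T (re_part z)) (blinfun_apply T (im_part z))"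
proof -
  fix T :: "'a \<Rightarrow>\<^sub>L 'a"
  let ?F = "\<lambda>z. Complexification (T (re_part z)) (T (im_part z))"
  have "bounded_linear ?F"
  proof (rule bounded_linear_intro[where K = "2 * norm T"])
    fix z :: "'a complexification"
    have "norm (?F z) \<le> norm (T (re_part z)) + norm (T (im_part z))"
      using norm_complexification_le[of "?F z"] by simp
    also have "\<dots> \<le> norm T * norm z + norm T * norm z"
      by (intro add_mono order_trans[OF norm_blinfun] mult_left_mono
          norm_re_part_le norm_im_part_le norm_ge_zero)
    finally show "norm (?F z) \<le> norm z * (2 * norm T)"
      by (simp add: algebra_simps)
  qed (simp_all add: complexification_defs blinfun.bilinear_simps)
  then show "bounded_clinear ?F"
    by (simp add: bounded_clinear_def complexification_defs blinfun.bilinear_simps)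
qed

section \<open>Reflexivity\<close>

definition bidual_embedding :: "'a::real_normed_vector \<Rightarrow> ('a \<Rightarrow>\<^sub>L real) \<Rightarrow>\<^sub>L real"
  where "bidual_embedding x = Blinfun (\<lambda>f. blinfun_apply f x)"

lemma bidual_embedding_apply: "blinfun_apply (bidual_embedding x) f = blinfun_apply f x"
  unfolding bidual_embedding_def
  by (rule bounded_linear_Blinfun_apply[THEN fun_cong]) (rule blinfun.bounded_linear_left)

definition reflexive_space :: "'a::real_normed_vector itself \<Rightarrow> bool"
  where "reflexive_space _ \<longleftrightarrow> surj (bidual_embedding :: 'a \<Rightarrow> _)"

lift_definition cbidual_embedding ::
  "'a::complex_normed_vector \<Rightarrow> ('a \<Rightarrow>\<^sub>C\<^sub>L complex) \<Rightarrow>\<^sub>C\<^sub>L complex"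
  is "\<lambda>x f. cblinfun_apply f x"
proof -
  fix x :: 'a
  have "bounded_linear (\<lambda>f :: 'a \<Rightarrow>\<^sub>C\<^sub>L complex. cblinfun_apply f x)"
  proof (rule bounded_linear_intro[where K = "norm x"])
    show "norm (cblinfun_apply f x) \<le> norm f * norm x" for f :: "'a \<Rightarrow>\<^sub>C\<^sub>L complex"
      by transfer (simp add: bounded_clinear_def onorm)
  qed (simp_all add: plus_cblinfun.rep_eq scaleR_cblinfun_def scaleC_cblinfun.rep_eq scaleR_scaleC)
  then show "bounded_clinear (\<lambda>f :: 'a \<Rightarrow>\<^sub>C\<^sub>L complex. cblinfun_apply f x)"
    by (simp add: bounded_clinear_def scaleC_cblinfun.rep_eq)
qed

definition creflexive_space :: "'a::complex_normed_vector itself \<Rightarrow> bool"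
  where "creflexive_space _ \<longleftrightarrow> surj (cbidual_embedding :: 'a \<Rightarrow> _)"

section \<open>Almost-invariant halfspaces\<close>

text \<open>These notions take the scalar multiplication as a parameter, to serve real and complex
  spaces alike. As the library's dimension is a natural number (0 for the whole of an
  infinite-dimensional space), finiteness of the dimension is expressed through finite
  spanning sets.\<close>

definition finite_dim :: "('k::field \<Rightarrow> 'a::ab_group_add \<Rightarrow> 'a) \<Rightarrow> 'a set \<Rightarrow> bool"
  where "finite_dim sc V \<longleftrightarrow> (\<exists>B. finite B \<and> module.span sc B = V)"

text \<open>The cosets of the elements of \<open>B\<close> span the quotient of the space by \<open>Y\<close>, for some finite \<open>B\<close>.\<close>

definition finite_codim :: "('k::field \<Rightarrow> 'a::ab_group_add \<Rightarrow> 'a) \<Rightarrow> 'a set \<Rightarrow> bool"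
  where "finite_codim sc Y \<longleftrightarrow>
    (\<exists>B. finite B \<and> (\<forall>x. \<exists>u\<in>module.span sc B. x - u \<in> Y))"

definition halfspace :: "('k::field \<Rightarrow> 'a::real_normed_vector \<Rightarrow> 'a) \<Rightarrow> 'a set \<Rightarrow> bool"
  where "halfspace sc Y \<longleftrightarrow>
    module.subspace sc Y \<and> closed Y \<and> \<not> finite_dim sc Y \<and> \<not> finite_codim sc Y"

definition almost_invariant_halfspace ::
  "('k::field \<Rightarrow> 'a::real_normed_vector \<Rightarrow> 'a) \<Rightarrow> ('a \<Rightarrow> 'a) \<Rightarrow> nat \<Rightarrow> 'a set \<Rightarrow> bool"
  where "almost_invariant_halfspace sc T d Y \<longleftrightarrow>
    halfspace sc Y \<and>
    (\<exists>E. module.subspace sc E \<and> finite_dim sc E \<and> vector_space.dim sc E \<le> d \<and>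
         T ` Y \<subseteq> {y + e |y e. y \<in> Y \<and> e \<in> E})"

end

theory Submission
  imports Defs "HOL-Complex_Analysis.Residue_Theorem"
begin

text \<open>
Let \<open>A = T - t\<close> for a real spectral value \<open>t\<close> that is a limit of real regular values, and write \<open>\<tau> n\<close>
for the differences, so that \<open>\<tau> n \<longlonglongrightarrow> 0\<close> and all \<open>A - \<tau> n\<close> are invertible. A halfspace that is
almost invariant under \<open>A\<close> is almost invariant under \<open>T\<close>, and one can be constructed unless \<open>t\<close> is an
isolated point of the spectrum whose spectral subspace is finite-dimensional
(\<open>defect_one_or_finite_riesz_part\<close>). There are four cases.

 \<^item> If \<open>ker A\<close> is infinite-dimensional, it contains a halfspace, and \<open>A\<close> vanishes there
   (\<open>defect_one_infinite_kernel\<close>).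

 \<^item> If \<open>ker A\<close> is finite-dimensional but \<open>ker (A ^^ p)\<close> grows forever, there is an infinite chain
   \<open>A (e 0) = 0\<close>, \<open>A (e (Suc k)) = e k\<close>. If \<open>S\<close> denotes the formal shift \<open>e k \<mapsto> e (Suc k)\<close> and the \<open>\<mu> j\<close> are
   chosen among the \<open>\<tau> n\<close> and decrease fast enough, the infinite product \<open>\<Prod>j. 1 - \<mu> j S\<close> can be applied to
   the chain. The resulting vectors \<open>z m\<close> again satisfy \<open>A (z (Suc m)) = z m\<close>, so their closed span
   is invariant up to the single vector \<open>A (z 0)\<close>, and the resolvents at the zeros of the
   product provide infinitely many functionals that vanish on it
   (\<open>defect_one_infinite_chain\<close>).

 \<^item> If \<open>A\<close> is injective, it is not surjective; take \<open>e\<close> outside its range and \<open>h n = (A - \<tau> n)\<^sup>-\<^sup>1 e\<close>. Any closed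
   span of some of the \<open>h n\<close> is invariant up to \<open>e\<close>. By reflexivity the \<open>h n\<close> are unbounded and, once
   normalised, weakly null; hence a biorthogonal sequence can be selected from them, and every
   second term of it spans a halfspace (\<open>defect_one_injective\<close>).

 \<^item> If \<open>ker (A ^^ p)\<close> is finite-dimensional and stable, the operator induced on the
   quotient by it is injective. Either it is invertible, which is the exceptional alternative, or the
   previous case applies to it.

If the spectrum has infinitely many real points, they have an accumulation point that is also a limit of real
regular values, and the exceptional alternative is impossible there. If it has finitely many, then by
hypothesis these are the whole spectrum. If the exceptional alternative held at each of them, the resolvent
would have only poles, and Liouville's theorem, applied to the resolvent multiplied by a suitable polynomial \<open>q\<close>, would give
\<open>q(T) = 0\<close> (\<open>shifted_product_eq_0\<close>). Since the kernels of the factors of \<open>q(T)\<close> are finite-dimensional, so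
would be the whole space.

Only real shifts of \<open>T\<close> occur in the constructions. So they are carried out over an
arbitrary scalar field, and complex analysis enters only in the last step, where a
real operator is replaced by its complexification.
\<close>

section \<open>The Hahn-Banach theorem\<close>

definition sublinear :: "('a::real_vector \<Rightarrow> real) \<Rightarrow> bool"
  where "sublinear p \<longleftrightarrow> (\<forall>x y. p (x + y) \<le> p x + p y) \<and> (\<forall>c x. 0 \<le> c \<longrightarrow> p (c *\<^sub>R x) = c * p x)"

lemma sublinear_add: "sublinear p \<Longrightarrow> p (x + y) \<le> p x + p y"
  and sublinear_scaleR: "sublinear p \<Longrightarrow> 0 \<le> c \<Longrightarrow> p (c *\<^sub>R x) = c * p x"
  by (auto simp: sublinear_def)

lemma sublinear_zero: "sublinear p \<Longrightarrow> p 0 = 0"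
  using sublinear_scaleR[of p 0 0] by simp

lemma sublinear_minus: "sublinear p \<Longrightarrow> - p (- x) \<le> p x"
  using sublinear_add[of p x "- x"] sublinear_zero[of p] by simp

lemma sublinearI:
  assumes add: "\<And>x y. p (x + y) \<le> p x + p y" and zero: "p 0 = 0"
    and scale: "\<And>c x. 0 < c \<Longrightarrow> p (c *\<^sub>R x) \<le> c * p x"
  shows "sublinear p"
  unfolding sublinear_def
proof (intro conjI allI impI add)
  fix c x assume "(0::real) \<le> c"
  show "p (c *\<^sub>R x) = c * p x"
  proof (cases "c = 0")
    case False
    then have c: "0 < c" using \<open>0 \<le> c\<close> by simp
    have "p x \<le> inverse c * p (c *\<^sub>R x)"
      using scale[of "inverse c" "c *\<^sub>R x"] c by simp
    then have "c * p x \<le> p (c *\<^sub>R x)"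
      using c by (simp add: field_simps)
    then show ?thesis using scale[OF c, of x] by simp
  qed (simp add: zero)
qed

text \<open>The functional \<open>tilt p y\<close> lies below \<open>p\<close> and is at most \<open>- p y\<close> at \<open>- y\<close>, which makes it linear on the line
through \<open>y\<close>.\<close>

definition tilt :: "('a::real_vector \<Rightarrow> real) \<Rightarrow> 'a \<Rightarrow> 'a \<Rightarrow> real"
  where "tilt p y x = (INF t\<in>{0..}. p (x + t *\<^sub>R y) - t * p y)"

lemma tilt_bdd:
  assumes "sublinear p" shows "bdd_below ((\<lambda>t. p (x + t *\<^sub>R y) - t * p y) ` {0..})"
proof (rule bdd_belowI2)
  fix t :: real assume "t \<in> {0..}"
  then show "- p (- x) \<le> p (x + t *\<^sub>R y) - t * p y"
    using sublinear_add[OF assms, of "x + t *\<^sub>R y" "- x"] sublinear_scaleR[OF assms, of t y]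
    by simp
qed

lemma tilt_le:
  assumes "sublinear p" "0 \<le> t" shows "tilt p y x \<le> p (x + t *\<^sub>R y) - t * p y"
  unfolding tilt_def using assms by (intro cINF_lower tilt_bdd) auto

lemma le_tilt:
  assumes "\<And>t. 0 \<le> t \<Longrightarrow> c \<le> p (x + t *\<^sub>R y) - t * p y" shows "c \<le> tilt p y x"
  unfolding tilt_def using assms by (intro cINF_greatest) auto

lemma sublinear_tilt:
  assumes p: "sublinear p" shows "sublinear (tilt p y)"
proof (rule sublinearI)
  fix a b
  have *: "tilt p y (a + b) - (p (b + t *\<^sub>R y) - t * p y) \<le> p (a + s *\<^sub>R y) - s * p y"
    if "0 \<le> s" "0 \<le> t" for s t
    using tilt_le[OF p, of "s + t" y "a + b"] sublinear_add[OF p, of "a + s *\<^sub>R y" "b + t *\<^sub>R y"] that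
    by (simp add: algebra_simps)
  have "tilt p y (a + b) - tilt p y a \<le> p (b + t *\<^sub>R y) - t * p y" if "0 \<le> t" for t
    using le_tilt[of "tilt p y (a + b) - (p (b + t *\<^sub>R y) - t * p y)", OF *] that by simp
  then show "tilt p y (a + b) \<le> tilt p y a + tilt p y b"
    using le_tilt[of "tilt p y (a + b) - tilt p y a" p b y] by simp
next
  have "0 \<le> tilt p y 0"
    by (rule le_tilt) (simp add: sublinear_scaleR[OF p])
  then show "tilt p y 0 = 0"
    using tilt_le[OF p, of 0 y 0] sublinear_zero[OF p] by simp
next
  fix c :: real and x assume c: "0 < c"
  have "tilt p y (c *\<^sub>R x) / c \<le> p (x + t *\<^sub>R y) - t * p y" if "0 \<le> t" for t
  proof -
    have "tilt p y (c *\<^sub>R x) \<le> p (c *\<^sub>R (x + t *\<^sub>R y)) - c * t * p y"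
      using tilt_le[OF p, of "c * t" y "c *\<^sub>R x"] c that by (simp add: algebra_simps)
    then show ?thesis
      using c sublinear_scaleR[OF p, of c "x + t *\<^sub>R y"] by (simp add: field_simps)
  qed
  then have "tilt p y (c *\<^sub>R x) / c \<le> tilt p y x" by (rule le_tilt)
  then show "tilt p y (c *\<^sub>R x) \<le> c * tilt p y x" using c by (simp add: field_simps)
qed

lemma sublinear_Inf_chain:
  fixes C :: "('a::real_vector \<Rightarrow> real) set"
  assumes C: "C \<noteq> {}" "\<And>p. p \<in> C \<Longrightarrow> sublinear p" "\<And>p. p \<in> C \<Longrightarrow> p \<le> p0"
    and chain: "\<And>p q. p \<in> C \<Longrightarrow> q \<in> C \<Longrightarrow> p \<le> q \<or> q \<le> p"
  shows "sublinear (\<lambda>x. INF p\<in>C. p x)" "\<And>p x. p \<in> C \<Longrightarrow> (INF p\<in>C. p x) \<le> p x"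
proof -
  have "- p0 (- x) \<le> p x" if "p \<in> C" for p x
    using sublinear_minus[OF C(2)[OF that], of x] C(3)[OF that] le_funD[of p p0 "- x"] by simp
  then have bdd: "bdd_below ((\<lambda>p. p x) ` C)" for x by (auto intro!: bdd_belowI2)
  show low: "(INF p\<in>C. p x) \<le> p x" if "p \<in> C" for p x
    by (rule cINF_lower[OF bdd that])
  have great: "c \<le> (INF p\<in>C. p x)" if "\<And>p. p \<in> C \<Longrightarrow> c \<le> p x" for c x
    by (rule cINF_greatest[OF C(1) that])
  show "sublinear (\<lambda>x. INF p\<in>C. p x)"
  proof (rule sublinearI)
    fix x y
    have *: "(INF p\<in>C. p (x + y)) - q y \<le> p x" if "p \<in> C" "q \<in> C" for p q
    proof -
      have "\<exists>r\<in>C. r \<le> p \<and> r \<le> q" using chain[OF that] that by auto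
      then obtain r where r: "r \<in> C" "r \<le> p" "r \<le> q" by blast
      then show ?thesis
        using low[OF r(1), of "x + y"] sublinear_add[OF C(2)[OF r(1)], of x y]
          le_funD[OF r(2), of x] le_funD[OF r(3), of y] by simp
    qed
    have "(INF p\<in>C. p (x + y)) - (INF p\<in>C. p x) \<le> q y" if "q \<in> C" for q
    proof -
      have "(INF p\<in>C. p (x + y)) - q y \<le> (INF p\<in>C. p x)" by (rule great) (rule *[OF _ that])
      then show ?thesis by simp
    qed
    then have "(INF p\<in>C. p (x + y)) - (INF p\<in>C. p x) \<le> (INF p\<in>C. p y)"
      by (rule great)
    then show "(INF p\<in>C. p (x + y)) \<le> (INF p\<in>C. p x) + (INF p\<in>C. p y)" by simp
  next
    have "(\<lambda>p. p 0) ` C = (\<lambda>p. 0) ` C" using sublinear_zero[OF C(2)] by (intro image_cong) auto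
    then show "(INF p\<in>C. p 0) = 0" using C(1) by simp
  next
    fix c :: real and x assume c: "0 < c"
    have "(INF p\<in>C. p (c *\<^sub>R x)) / c \<le> p x" if "p \<in> C" for p
      using low[OF that, of "c *\<^sub>R x"] sublinear_scaleR[OF C(2)[OF that], of c x] c
      by (simp add: field_simps)
    then have "(INF p\<in>C. p (c *\<^sub>R x)) / c \<le> (INF p\<in>C. p x)" by (rule great)
    then show "(INF p\<in>C. p (c *\<^sub>R x)) \<le> c * (INF p\<in>C. p x)" using c by (simp add: field_simps)
  qed
qed

text \<open>A minimal sublinear functional is linear, since it coincides with all its tilts; Zorn's lemma
  provides a minimal one below the tilt of \<open>p\<close> in direction \<open>u\<close>, and the tilt forces the value at \<open>u\<close>.\<close>

lemma sublinear_dominates_linear: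
  fixes p :: "'a::real_vector \<Rightarrow> real"
  assumes p: "sublinear p"
  shows "\<exists>f. linear f \<and> (\<forall>x. f x \<le> p x) \<and> f u = p u"
proof -
  define A where "A = {q. sublinear q \<and> q \<le> tilt p u}"
  let ?P = "\<lambda>q r :: 'a \<Rightarrow> real. r \<le> q"
  have po: "partial_order_on A (relation_of ?P A)"
    by (rule partial_order_on_relation_ofI) auto
  have "\<exists>m\<in>A. \<forall>q\<in>A. q \<le> m \<longrightarrow> q = m"
  proof (rule predicate_Zorn[OF po])
    fix C assume C: "C \<in> Chains (relation_of ?P A)"
    then have CA: "C \<subseteq> A" and chain: "\<And>q r. q \<in> C \<Longrightarrow> r \<in> C \<Longrightarrow> q \<le> r \<or> r \<le> q"
      by (auto simp: Chains_def relation_of_def)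
    show "\<exists>r\<in>A. \<forall>q\<in>C. r \<le> q"
    proof (cases "C = {}")
      case True
      then show ?thesis using sublinear_tilt[OF p] by (auto simp: A_def)
    next
      case False
      have sub: "sublinear q" "q \<le> tilt p u" if "q \<in> C" for q
        using CA that by (auto simp: A_def)
      have 1: "sublinear (\<lambda>x. INF q\<in>C. q x)"
        by (rule sublinear_Inf_chain(1)[OF False sub chain])
      have 2: "(\<lambda>x. INF q\<in>C. q x) \<le> q" if "q \<in> C" for q
        by (rule le_funI) (rule sublinear_Inf_chain(2)[OF False sub chain that])
      obtain q where q: "q \<in> C" using False by blast
      have "(\<lambda>x. INF q\<in>C. q x) \<le> tilt p u"
        by (rule order_trans[OF 2[OF q] sub(2)[OF q]])
      with 1 have "(\<lambda>x. INF q\<in>C. q x) \<in> A" unfolding A_def by blast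
      then show ?thesis using 2 by blast
    qed
  qed
  then obtain f where fA: "f \<in> A" and fmin: "\<forall>q\<in>A. q \<le> f \<longrightarrow> q = f" by blast
  from fA have f: "sublinear f" "f \<le> tilt p u" by (simp_all add: A_def)
  have min: "q = f" if "sublinear q" "q \<le> f" for q
    using fmin that order_trans[OF that(2) f(2)] by (simp add: A_def)
  have tilt: "tilt f y = f" for y
    using tilt_le[OF f(1), of 0 y] by (intro min sublinear_tilt f) (simp add: le_fun_def)
  have add: "f (x + y) = f x + f y" for x y
    using tilt_le[OF f(1), of 1 y x] sublinear_add[OF f(1), of x y] by (simp add: tilt)
  have neg: "f (- x) = - f x" for x
    using add[of x "- x"] sublinear_zero[OF f(1)] by simp
  have "f (c *\<^sub>R x) = c * f x" for c x
    using sublinear_scaleR[OF f(1), of "\<bar>c\<bar>" x] neg[of "c *\<^sub>R x"] by (cases "c \<ge> 0") auto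
  then have "linear f" by (intro linearI) (simp_all add: add)
  moreover have le: "f x \<le> p x" for x
    using le_funD[OF f(2), of x] tilt_le[OF p, of 0 u x] by simp
  moreover have "p u \<le> f u"
    using le_funD[OF f(2), of "- u"] tilt_le[OF p, of 1 u "- u"] sublinear_zero[OF p] neg[of u] by simp
  ultimately show ?thesis using order_antisym[OF le[of u]] by blast
qed

lemma sublinear_infdist:
  fixes F :: "'a::real_normed_vector set"
  assumes F: "subspace F" shows "sublinear (\<lambda>x. infdist x F)"
proof (rule sublinearI)
  have ne: "F \<noteq> {}" using subspace_0[OF F] by blast
  have great: "c \<le> infdist x F" if "\<And>z. z \<in> F \<Longrightarrow> c \<le> dist x z" for c x
    unfolding infdist_def using ne that by (auto intro: cINF_greatest)
  fix x y
  have *: "infdist (x + y) F - dist y b \<le> dist x a" if "a \<in> F" "b \<in> F" for a b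
    using infdist_le[OF subspace_add[OF F that], of "x + y"] dist_triangle_add[of x y a b] by simp
  have "infdist (x + y) F - infdist x F \<le> dist y b" if "b \<in> F" for b
    using great[of "infdist (x + y) F - dist y b" x, OF *[OF _ that]] by simp
  then show "infdist (x + y) F \<le> infdist x F + infdist y F"
    using great[of "infdist (x + y) F - infdist x F" y] by simp
  show "infdist 0 F = 0" using subspace_0[OF F] by simp
  fix c :: real assume c: "0 < c"
  have scale: "dist (c *\<^sub>R x) (c *\<^sub>R a) = c * dist x a" for a
    using c by (simp add: dist_norm flip: scaleR_diff_right)
  have "infdist (c *\<^sub>R x) F / c \<le> dist x a" if "a \<in> F" for a
    using infdist_le[OF subspace_scale[OF F that, of c], of "c *\<^sub>R x"] c
    by (simp add: scale pos_divide_le_eq mult.commute)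
  then have "infdist (c *\<^sub>R x) F / c \<le> infdist x F" by (rule great)
  then show "infdist (c *\<^sub>R x) F \<le> c * infdist x F" using c by (simp add: field_simps)
qed

text \<open>The distance to \<open>F\<close> is sublinear, vanishes on \<open>F\<close> and is at most the norm, so any linear functional
below it that agrees with it at \<open>u\<close> has these properties up to a factor.\<close>

theorem hahn_banach_separation:
  fixes F :: "'a::real_normed_vector set"
  assumes F: "subspace F" and c: "0 < c" and dist: "\<And>y. y \<in> F \<Longrightarrow> c \<le> norm (u - y)"
  shows "\<exists>h. bounded_linear h \<and> (\<forall>x\<in>F. h x = 0) \<and> h u = (1::real) \<and> (\<forall>x. \<bar>h x\<bar> \<le> norm x / c)"
proof -
  obtain f where f: "linear f" "\<And>x. f x \<le> infdist x F" "f u = infdist u F"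
    using sublinear_dominates_linear[OF sublinear_infdist[OF F]] by blast
  have ne: "F \<noteq> {}" using subspace_0[OF F] by blast
  have d: "c \<le> infdist u F"
    unfolding infdist_def using ne dist by (auto simp: dist_norm intro: cINF_greatest)
  have neg: "f (- x) = - f x" for x using linear_neg[OF f(1)] .
  have le: "\<bar>f x\<bar> \<le> norm x" for x
    using f(2)[of x] f(2)[of "- x"] infdist_le[OF subspace_0[OF F], of x]
      infdist_le[OF subspace_0[OF F], of "- x"] by (simp add: neg)
  define h where "h = (\<lambda>x. f x / infdist u F)"
  have lin: "linear h"
    using f(1) by (intro linearI) (simp_all add: h_def linear_add linear_scale add_divide_distrib)
  have bd: "\<bar>h x\<bar> \<le> norm x / c" for x
  proof -
    have "\<bar>h x\<bar> = \<bar>f x\<bar> / infdist u F" using c d by (simp add: h_def)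
    also have "\<dots> \<le> norm x / c"
      using le[of x] c d by (intro frac_le) auto
    finally show ?thesis .
  qed
  have "bounded_linear h"
    using lin bd by (intro bounded_linear_intro[of h "1 / c"]) (simp_all add: linear_add linear_scale)
  moreover have "h x = 0" if "x \<in> F" for x
    using f(2)[of x] f(2)[of "- x"] that subspace_neg[OF F that] by (simp add: h_def neg)
  moreover have "h u = 1" using f(3) c d by (simp add: h_def)
  ultimately show ?thesis using bd by blast
qed

section \<open>Banach spaces over a scalar field\<close>

text \<open>The scalars are meant to be the real or the complex numbers. The separation property is the Hahn-Banach
theorem for scalar-valued functionals, the only property here whose proof depends on the field.\<close>

locale scalar_banach = vector_space sc
  for sc :: "'k::real_normed_field \<Rightarrow> 'a::banach \<Rightarrow> 'a" +
  assumes norm_sc: "norm (sc c x) = norm c * norm x"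
    and scaleR_sc: "r *\<^sub>R x = sc (of_real r) x"
    and separation: "\<And>F c u. subspace F \<Longrightarrow> 0 < c \<Longrightarrow> (\<And>y. y \<in> F \<Longrightarrow> c \<le> norm (u - y)) \<Longrightarrow>
      \<exists>h. bounded_linear h \<and> (\<forall>a x. h (sc a x) = a * h x) \<and>
        (\<forall>x\<in>F. h x = 0) \<and> h u = 1 \<and> (\<forall>x. norm (h x) \<le> norm x / c)"
begin

definition operator :: "('a \<Rightarrow> 'a) \<Rightarrow> bool"
  where "operator A \<longleftrightarrow> bounded_linear A \<and> (\<forall>c x. A (sc c x) = sc c (A x))"

definition functional :: "('a \<Rightarrow> 'k) \<Rightarrow> bool"
  where "functional g \<longleftrightarrow> bounded_linear g \<and> (\<forall>c x. g (sc c x) = c * g x)"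

lemma bounded_bilinear_sc: "bounded_bilinear sc"
proof
  show "sc (r *\<^sub>R a) x = r *\<^sub>R sc a x" for r a x
    by (simp add: scaleR_sc scaleR_conv_of_real[of r a])
  show "sc a (r *\<^sub>R x) = r *\<^sub>R sc a x" for r a x
    by (simp add: scaleR_sc mult.commute)
  show "\<exists>K. \<forall>a b. norm (sc a b) \<le> norm a * norm b * K"
    by (rule exI[of _ 1]) (simp add: norm_sc)
qed (simp_all add: scale_left_distrib scale_right_distrib)

lemmas tendsto_sc = bounded_bilinear.tendsto[OF bounded_bilinear_sc]

lemma operator_simps:
  assumes "operator A"
  shows "A (x + y) = A x + A y" "A (x - y) = A x - A y" "A 0 = 0" "A (- x) = - A x"
    "A (sc c x) = sc c (A x)" "A (r *\<^sub>R x) = r *\<^sub>R A x" "A (\<Sum>i\<in>I. f i) = (\<Sum>i\<in>I. A (f i))"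
  using assms unfolding operator_def
  by (auto simp: linear_simps bounded_linear.linear linear_sum)

lemma functional_simps:
  assumes "functional g"
  shows "g (x + y) = g x + g y" "g (x - y) = g x - g y" "g 0 = 0" "g (- x) = - g x"
    "g (sc c x) = c * g x" "g (\<Sum>i\<in>I. f i) = (\<Sum>i\<in>I. g (f i))"
  using assms unfolding functional_def
  by (auto simp: linear_simps bounded_linear.linear linear_sum)

lemma operator_bounded_linear: "operator A \<Longrightarrow> bounded_linear A"
  and functional_bounded_linear: "functional g \<Longrightarrow> bounded_linear g"
  by (auto simp: operator_def functional_def)

lemmas operator_tendsto = bounded_linear.tendsto[OF operator_bounded_linear]
  and functional_tendsto = bounded_linear.tendsto[OF functional_bounded_linear]

lemma operator_continuous: "operator A \<Longrightarrow> continuous_on S A"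
  and functional_continuous: "functional g \<Longrightarrow> continuous_on S g"
  by (auto intro: linear_continuous_on operator_bounded_linear functional_bounded_linear)

lemma operator_id: "operator (\<lambda>x. x)"
  by (simp add: operator_def)

lemma operator_zero: "operator (\<lambda>x. 0)"
  by (simp add: operator_def)

lemma operator_compose: "operator A \<Longrightarrow> operator B \<Longrightarrow> operator (\<lambda>x. A (B x))"
  by (simp add: operator_def bounded_linear_compose)

lemma operator_add: "operator A \<Longrightarrow> operator B \<Longrightarrow> operator (\<lambda>x. A x + B x)"
  by (simp add: operator_def bounded_linear_add scale_right_distrib)

lemma operator_diff: "operator A \<Longrightarrow> operator B \<Longrightarrow> operator (\<lambda>x. A x - B x)"
  by (simp add: operator_def bounded_linear_sub scale_right_diff_distrib)

lemma operator_scaleR: "operator A \<Longrightarrow> operator (\<lambda>x. r *\<^sub>R A x)"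
  using bounded_linear_compose[OF bounded_linear_scaleR_right[of r], of A]
  by (simp add: operator_def scaleR_sc mult.commute)

lemma operator_power: "operator A \<Longrightarrow> operator (A ^^ n)"
  by (induction n) (simp_all add: operator_id operator_compose id_def comp_def)

lemma operator_rank_one: "functional g \<Longrightarrow> operator (\<lambda>x. sc (g x) v)"
  by (simp add: operator_def functional_def
      bounded_linear_compose[OF bounded_bilinear.bounded_linear_left[OF bounded_bilinear_sc]])

lemma operator_sum: "(\<And>i. i \<in> I \<Longrightarrow> operator (f i)) \<Longrightarrow> operator (\<lambda>x. \<Sum>i\<in>I. f i x)"
  by (induction I rule: infinite_finite_induct) (simp_all add: operator_zero operator_add)

lemma operator_bound: "operator A \<Longrightarrow> \<exists>K>0. \<forall>x. norm (A x) \<le> K * norm x"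
  using bounded_linear.pos_bounded[OF operator_bounded_linear] by (metis mult.commute)

lemma functional_compose: "functional g \<Longrightarrow> operator A \<Longrightarrow> functional (\<lambda>x. g (A x))"
  by (simp add: operator_def functional_def bounded_linear_compose)

lemma subspace_vimage: "operator A \<Longrightarrow> subspace W \<Longrightarrow> subspace {x. A x \<in> W}"
  by (auto simp: subspace_def operator_simps)

lemma subspace_kernel_functional: "functional g \<Longrightarrow> subspace {x. g x = 0}"
  by (auto simp: subspace_def functional_simps)

lemma closed_vimage_operator: "operator A \<Longrightarrow> closed W \<Longrightarrow> closed {x. A x \<in> W}"
  using continuous_closed_vimage[of W A] operator_continuous[of A UNIV]
  by (simp add: vimage_def continuous_on_eq_continuous_at)

lemma subspace_closure:
  assumes S: "subspace S" shows "subspace (closure S)"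
  unfolding subspace_def
proof (intro conjI ballI allI)
  show "0 \<in> closure S" using subspace_0[OF S] closure_subset by blast
  fix x assume "x \<in> closure S"
  then obtain X where X: "\<And>n. X n \<in> S" "X \<longlonglongrightarrow> x" by (auto simp: closure_sequential)
  { fix y assume "y \<in> closure S"
    then obtain Y where Y: "\<And>n. Y n \<in> S" "Y \<longlonglongrightarrow> y" by (auto simp: closure_sequential)
    show "x + y \<in> closure S"
      unfolding closure_sequential
      using subspace_add[OF S X(1) Y(1)] tendsto_add[OF X(2) Y(2)] by (intro exI[of _ "\<lambda>n. X n + Y n"]) blast }
  fix c show "sc c x \<in> closure S"
    unfolding closure_sequential
    using subspace_scale[OF S X(1)] tendsto_sc[OF tendsto_const X(2), of c]
    by (intro exI[of _ "\<lambda>n. sc c (X n)"]) blast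
qed

lemma positive_distance:
  assumes "closed F" "subspace F" "u \<notin> F"
  shows "\<exists>c>0. \<forall>y\<in>F. c \<le> norm (u - y)"
proof -
  have ne: "F \<noteq> {}" using subspace_0[OF assms(2)] by blast
  have "infdist u F > 0"
    using infdist_pos_not_in_closed[OF assms(1) ne assms(3)] .
  moreover have "infdist u F \<le> norm (u - y)" if "y \<in> F" for y
    using infdist_le[OF that, of u] by (simp add: dist_norm)
  ultimately show ?thesis by blast
qed

lemma separating_functional:
  assumes "subspace F" "0 < c" "\<And>y. y \<in> F \<Longrightarrow> c \<le> norm (u - y)"
  obtains h where "functional h" "\<And>x. x \<in> F \<Longrightarrow> h x = 0" "h u = 1" "\<And>x. norm (h x) \<le> norm x / c"
  using separation[OF assms] unfolding functional_def by blast

lemma separating_functional_closed: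
  assumes "closed F" "subspace F" "u \<notin> F"
  obtains h where "functional h" "\<And>x. x \<in> F \<Longrightarrow> h x = 0" "h u = 1"
proof -
  obtain c where c: "0 < c" "\<And>y. y \<in> F \<Longrightarrow> c \<le> norm (u - y)"
    using positive_distance[OF assms] by blast
  show ?thesis using separating_functional[OF assms(2) c] that by metis
qed

lemma norming_functional:
  assumes "u \<noteq> 0"
  obtains h where "functional h" "h u = 1" "\<And>x. norm (h x) \<le> norm x / norm u"
  by (rule separating_functional[of "{0}" "norm u" u]) (use assms subspace_single_0 that in auto)

text \<open>A functional that vanishes on \<open>Y\<close> but not at \<open>e\<close> recovers the coefficient of \<open>e\<close> continuously, so that the sum is the
preimage of \<open>Y\<close> under a continuous map.\<close>

lemma closed_add_line:
  assumes Y: "closed Y" "subspace Y"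
  shows "closed {x. \<exists>k. x - sc k e \<in> Y}" and "subspace {x. \<exists>k. x - sc k e \<in> Y}"
proof -
  show "subspace {x. \<exists>k. x - sc k e \<in> Y}"
    unfolding subspace_def mem_Collect_eq
  proof (intro conjI ballI allI)
    show "\<exists>k. 0 - sc k e \<in> Y" using subspace_0[OF Y(2)] by (intro exI[of _ 0]) simp
    fix x assume "x \<in> {x. \<exists>k. x - sc k e \<in> Y}"
    then obtain k where k: "x - sc k e \<in> Y" by blast
    { fix y assume "y \<in> {x. \<exists>k. x - sc k e \<in> Y}"
      then obtain l where l: "y - sc l e \<in> Y" by blast
      show "\<exists>k. x + y - sc k e \<in> Y"
        using subspace_add[OF Y(2) k l] by (intro exI[of _ "k + l"]) (simp add: algebra_simps) }
    fix c show "\<exists>k. sc c x - sc k e \<in> Y"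
      using subspace_scale[OF Y(2) k, of c] by (intro exI[of _ "c * k"]) (simp add: algebra_simps)
  qed
  show "closed {x. \<exists>k. x - sc k e \<in> Y}"
  proof (cases "e \<in> Y")
    case True
    have "x \<in> Y" if "x - sc k e \<in> Y" for x k
      using subspace_add[OF Y(2) that subspace_scale[OF Y(2) True, of k]] by simp
    moreover have "\<exists>k. x - sc k e \<in> Y" if "x \<in> Y" for x
      using that by (intro exI[of _ 0]) simp
    ultimately have "{x. \<exists>k. x - sc k e \<in> Y} = Y" by blast
    then show ?thesis using Y by simp
  next
    case False
    obtain h where h: "functional h" "\<And>x. x \<in> Y \<Longrightarrow> h x = 0" "h e = 1"
      using separating_functional_closed[OF Y False] by metis
    have "h x = k" if "x - sc k e \<in> Y" for x k
      using h(2)[OF that] h(1,3) by (simp add: functional_simps)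
    then have "{x. \<exists>k. x - sc k e \<in> Y} = {x. x - sc (h x) e \<in> Y}" by blast
    then show ?thesis
      using closed_vimage_operator[OF operator_diff[OF operator_id operator_rank_one[OF h(1)]] Y(1)] by simp
  qed
qed

lemma closed_add_span:
  assumes Y: "closed Y" "subspace Y" and B: "finite B"
  shows "closed {x. \<exists>n\<in>span B. x - n \<in> Y}" and "subspace {x. \<exists>n\<in>span B. x - n \<in> Y}"
proof -
  have "closed {x. \<exists>n\<in>span B. x - n \<in> Y} \<and> subspace {x. \<exists>n\<in>span B. x - n \<in> Y}" using B
  proof (induction B)
    case (insert b B)
    have "{x. \<exists>n\<in>span (insert b B). x - n \<in> Y} = {x. \<exists>k. x - sc k b \<in> {x. \<exists>n\<in>span B. x - n \<in> Y}}"
    proof (intro Collect_cong iffI)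
      fix x assume "\<exists>n\<in>span (insert b B). x - n \<in> Y"
      then obtain n k where "x - n \<in> Y" "n - sc k b \<in> span B" by (auto simp: span_breakdown_eq)
      then show "\<exists>k. x - sc k b \<in> {x. \<exists>n\<in>span B. x - n \<in> Y}"
        by (intro exI[of _ k] CollectI bexI[of _ "n - sc k b"]) (auto simp: algebra_simps)
    next
      fix x assume "\<exists>k. x - sc k b \<in> {x. \<exists>n\<in>span B. x - n \<in> Y}"
      then obtain n k where "x - sc k b - n \<in> Y" "n \<in> span B" by blast
      then show "\<exists>n\<in>span (insert b B). x - n \<in> Y"
        by (intro bexI[of _ "n + sc k b"]) (auto simp: algebra_simps span_breakdown_eq intro!: exI[of _ k])
    qed
    then show ?case using closed_add_line[of "{x. \<exists>n\<in>span B. x - n \<in> Y}" b] insert by simp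
  qed (use Y in simp)
  then show "closed {x. \<exists>n\<in>span B. x - n \<in> Y}" "subspace {x. \<exists>n\<in>span B. x - n \<in> Y}" by auto
qed

lemma closed_span_finite: "finite B \<Longrightarrow> closed (span B)"
  using closed_add_span(1)[of "{0}" B] by (simp add: subspace_single_0)

section \<open>Finite-dimensional subspaces\<close>

lemma finite_dim_basis:
  assumes "finite_dim sc V"
  obtains B where "finite B" "independent B" "span B = V"
proof -
  obtain B0 where B0: "finite B0" "span B0 = V" using assms by (auto simp: finite_dim_def)
  obtain B where B: "B \<subseteq> B0" "independent B" "B0 \<subseteq> span B"
    using maximal_independent_subset[of B0] by blast
  have "span B = V"
    using span_mono[OF B(1)] span_mono[OF B(3)] B0(2) by (simp add: span_span)
  then show ?thesis using that B finite_subset[OF B(1) B0(1)] by blast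
qed

lemma finite_dim_subset:
  assumes "finite_dim sc V" "subspace W" "W \<subseteq> V"
  shows "finite_dim sc W"
proof -
  obtain B where B: "finite B" "span B = V" using assms by (auto simp: finite_dim_def)
  obtain C where C: "C \<subseteq> W" "independent C" "W \<subseteq> span C"
    using maximal_independent_subset[of W] by blast
  have "finite C" using independent_span_bound[OF B(1) C(2)] C(1) assms(3) B(2) by blast
  moreover have "span C = W" using C span_minimal[OF C(1) assms(2)] by blast
  ultimately show ?thesis unfolding finite_dim_def by blast
qed

lemma finite_dim_zero: "finite_dim sc {0}"
  unfolding finite_dim_def by (rule exI[of _ "{}"]) simp

lemma subspace_finite_dim: "finite_dim sc V \<Longrightarrow> subspace V"
  by (auto simp: finite_dim_def)

lemma subspace_image:
  assumes A: "operator A" and S: "subspace S" shows "subspace (A ` S)"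
  unfolding subspace_def
proof (intro conjI ballI allI)
  show "0 \<in> A ` S"
    using subspace_0[OF S] by (intro image_eqI[of _ _ 0]) (simp_all add: operator_simps[OF A])
  fix x assume "x \<in> A ` S"
  then obtain a where a: "a \<in> S" "x = A a" by blast
  { fix y assume "y \<in> A ` S"
    then obtain b where b: "b \<in> S" "y = A b" by blast
    show "x + y \<in> A ` S"
      using subspace_add[OF S a(1) b(1)]
      by (intro image_eqI[of _ _ "a + b"]) (simp_all add: operator_simps[OF A] a b) }
  show "sc c x \<in> A ` S" for c
    using subspace_scale[OF S a(1)]
    by (intro image_eqI[of _ _ "sc c a"]) (simp_all add: operator_simps[OF A] a)
qed

lemma finite_dim_vimage:
  assumes A: "operator A" and ker: "finite_dim sc {x. A x = 0}" and V: "finite_dim sc V"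
  shows "finite_dim sc {x. A x \<in> V}"
proof -
  let ?W = "{x. A x \<in> V}"
  have V': "subspace V" by (rule subspace_finite_dim[OF V])
  obtain K where K: "finite K" "span K = {x. A x = 0}" using ker by (auto simp: finite_dim_def)
  have sub: "subspace (A ` ?W)" by (rule subspace_image[OF A subspace_vimage[OF A V']])
  have "finite_dim sc (A ` ?W)"
    by (rule finite_dim_subset[OF V sub]) auto
  then obtain B where B: "finite B" "span B = A ` ?W" by (auto simp: finite_dim_def)
  then have "\<forall>b\<in>B. \<exists>c. A c = b" using span_base[of _ B] by (metis imageE)
  then obtain c where c: "\<And>b. b \<in> B \<Longrightarrow> A (c b) = b" by metis
  have Wsub: "subspace ?W" by (rule subspace_vimage[OF A V'])
  have "span (c ` B \<union> K) = ?W"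
  proof
    have "b \<in> V" if "b \<in> B" for b using span_base[OF that] B(2) by auto
    then have "c ` B \<subseteq> ?W" using c by auto
    moreover have "K \<subseteq> ?W" using span_base[of _ K] K(2) subspace_0[OF V'] by auto
    ultimately show "span (c ` B \<union> K) \<subseteq> ?W" by (intro span_minimal Wsub) auto
    show "?W \<subseteq> span (c ` B \<union> K)"
    proof
      fix x assume "x \<in> ?W"
      then have "A x \<in> span B" using B(2) by blast
      then obtain r where r: "A x = (\<Sum>b\<in>B. sc (r b) b)" using span_finite[OF B(1)] by auto
      define y where "y = (\<Sum>b\<in>B. sc (r b) (c b))"
      have "A y = A x" using c unfolding y_def r by (simp add: operator_simps[OF A])
      then have "x - y \<in> span K" using K(2) operator_simps[OF A] by simp
      then have "x - y \<in> span (c ` B \<union> K)" using span_mono[of K "c ` B \<union> K"] by blast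
      moreover have "y \<in> span (c ` B \<union> K)"
        unfolding y_def by (intro span_sum span_scale span_base) auto
      ultimately show "x \<in> span (c ` B \<union> K)" using span_add by fastforce
    qed
  qed
  then show ?thesis
    unfolding finite_dim_def using B(1) K(1) by (intro exI[of _ "c ` B \<union> K"]) simp
qed

lemma span_sequence_dependent:
  fixes u :: "nat \<Rightarrow> 'a"
  assumes B: "finite B" and u: "\<And>k. u k \<in> span B"
  shows "\<exists>n a. (\<exists>k<n. a k \<noteq> 0) \<and> (\<Sum>k<n. sc (a k) (u k)) = 0"
proof (cases "inj_on u {..<Suc (card B)}")
  case True
  let ?I = "{..<Suc (card B)}"
  have "dependent (u ` ?I)"
  proof (rule ccontr)
    assume "independent (u ` ?I)"
    then have "card (u ` ?I) \<le> card B"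
      using independent_span_bound[OF B, of "u ` ?I"] u by auto
    then show False using card_image[OF True] by simp
  qed
  then obtain c v where c: "v \<in> u ` ?I" "c v \<noteq> 0" "(\<Sum>v\<in>u ` ?I. sc (c v) v) = 0"
    using dependent_finite[of "u ` ?I"] by auto
  have "(\<Sum>k<Suc (card B). sc (c (u k)) (u k)) = 0"
    using c(3) sum.reindex[OF True, of "\<lambda>v. sc (c v) v"] by (simp only: o_def)
  then show ?thesis using c(1,2) by (intro exI[of _ "Suc (card B)"] exI[of _ "c \<circ> u"]) auto
next
  case False
  then obtain i j where ij: "u i = u j" "i \<noteq> j" by (auto simp: inj_on_def)
  define a where "a = (\<lambda>k. if k = i then 1 else if k = j then - 1 else (0 :: 'k))"
  have "(\<Sum>k<Suc (max i j). sc (a k) (u k)) = (\<Sum>k\<in>{i, j}. sc (a k) (u k))"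
    by (rule sum.mono_neutral_right) (auto simp: a_def)
  also have "\<dots> = 0" using ij by (simp add: a_def)
  finally show ?thesis
    by (intro exI[of _ "Suc (max i j)"] exI[of _ a] conjI exI[of _ i]) (auto simp: a_def)
qed

text \<open>Vectors that are linearly independent modulo \<open>Y\<close> cannot all lie in \<open>Y\<close> plus a finitely spanned space.\<close>

lemma infinite_codimI:
  fixes e :: "nat \<Rightarrow> 'a"
  assumes Y: "subspace Y"
    and ind: "\<And>n a k. (\<Sum>k<n. sc (a k) (e k)) \<in> Y \<Longrightarrow> k < n \<Longrightarrow> a k = 0"
  shows "\<not> finite_codim sc Y"
proof
  assume "finite_codim sc Y"
  then obtain B where B: "finite B" "\<And>x. \<exists>u\<in>span B. x - u \<in> Y" by (auto simp: finite_codim_def)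
  have "\<exists>u. \<forall>k. u k \<in> span B \<and> e k - u k \<in> Y" by (rule choice) (use B(2) in blast)
  then obtain u where u: "\<And>k. u k \<in> span B" "\<And>k. e k - u k \<in> Y" by blast
  obtain n a k where a: "k < n" "a k \<noteq> 0" "(\<Sum>k<n. sc (a k) (u k)) = 0"
    using span_sequence_dependent[of B u, OF B(1) u(1)] by (elim exE conjE)
  have "(\<Sum>k<n. sc (a k) (e k - u k)) \<in> Y"
    by (intro subspace_sum[OF Y] subspace_scale[OF Y] u)
  then have "(\<Sum>k<n. sc (a k) (e k)) \<in> Y"
    using a(3) by (simp add: scale_right_diff_distrib sum_subtractf)
  from ind[OF this a(1)] show False using a(2) by simp
qed

lemma infinite_dimI:
  fixes e :: "nat \<Rightarrow> 'a"
  assumes Y: "\<And>k. e k \<in> Y"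
    and ind: "\<And>n a k. (\<Sum>k<n. sc (a k) (e k)) = 0 \<Longrightarrow> k < n \<Longrightarrow> a k = 0"
  shows "\<not> finite_dim sc Y"
proof
  assume "finite_dim sc Y"
  then obtain B where B: "finite B" "span B = Y" by (auto simp: finite_dim_def)
  then have "e k \<in> span B" for k using Y by simp
  from span_sequence_dependent[of B e, OF B(1) this]
  obtain n a k where a: "k < n" "a k \<noteq> 0" "(\<Sum>k<n. sc (a k) (e k)) = 0"
    by (elim exE conjE)
  from ind[OF a(3,1)] show False using a(2) by simp
qed

text \<open>The sum over \<open>B\<close> is the projection onto \<open>V\<close> given by a basis \<open>B\<close> of \<open>V\<close> and continuous dual functionals \<open>g b\<close>.\<close>

lemma finite_dim_projection:
  assumes V: "finite_dim sc V"
  shows "\<exists>B g. finite B \<and> (\<forall>b\<in>B. functional (g b)) \<and>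
    (\<forall>x. (\<Sum>b\<in>B. sc (g b x) b) \<in> V) \<and> (\<forall>x\<in>V. (\<Sum>b\<in>B. sc (g b x) b) = x)"
proof -
  obtain B where B: "finite B" "independent B" "span B = V" by (rule finite_dim_basis[OF V])
  have "\<exists>g. functional g \<and> (\<forall>x\<in>span (B - {b}). g x = 0) \<and> g b = 1" if "b \<in> B" for b
  proof -
    have "b \<notin> span (B - {b})" using B(2) that by (auto simp: dependent_def)
    then show ?thesis
      using separating_functional_closed[of "span (B - {b})" b] B(1) closed_span_finite subspace_span
      by (metis finite_Diff)
  qed
  then obtain g where g: "\<And>b. b \<in> B \<Longrightarrow> functional (g b)"
    "\<And>b x. b \<in> B \<Longrightarrow> x \<in> span (B - {b}) \<Longrightarrow> g b x = 0" "\<And>b. b \<in> B \<Longrightarrow> g b b = 1"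
    by metis
  have gB: "g b v = (if v = b then 1 else 0)" if "b \<in> B" "v \<in> B" for b v
    using g(2)[OF that(1) span_base, of v] g(3) that by auto
  show ?thesis
  proof (intro exI conjI ballI allI)
    show "(\<Sum>b\<in>B. sc (g b x) b) \<in> V" for x
      unfolding B(3)[symmetric] by (intro span_sum span_scale span_base)
    fix x assume "x \<in> V"
    then obtain r where r: "x = (\<Sum>v\<in>B. sc (r v) v)" using span_finite[OF B(1)] B(3) by auto
    have "g b x = r b" if "b \<in> B" for b
      using that B(1) unfolding r
      by (simp add: functional_simps[OF g(1)[OF that]] gB if_distrib cong: if_cong sum.cong)
    then show "(\<Sum>b\<in>B. sc (g b x) b) = x" unfolding r by (intro sum.cong) auto
  qed (use B g in auto)
qed

lemma infinite_dim_functional_kernels: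
  assumes G: "finite G" "\<And>g. g \<in> G \<Longrightarrow> functional g" and K: "subspace K" "\<not> finite_dim sc K"
  shows "\<exists>x\<in>K. x \<noteq> 0 \<and> (\<forall>g\<in>G. g x = 0)"
proof -
  have "subspace {x\<in>K. \<forall>g\<in>G. g x = 0} \<and> \<not> finite_dim sc {x\<in>K. \<forall>g\<in>G. g x = 0}" using G
  proof (induction G)
    case empty
    then show ?case using K by simp
  next
    case (insert g G)
    let ?K = "{x\<in>K. \<forall>g\<in>G. g x = 0}"
    have g: "functional g" and K': "subspace ?K" "\<not> finite_dim sc ?K" using insert by auto
    have eq: "{x\<in>K. \<forall>g\<in>insert g G. g x = 0} = ?K \<inter> {x. g x = 0}" by auto
    have sub: "subspace (?K \<inter> {x. g x = 0})"
      by (rule subspace_inter[OF K'(1) subspace_kernel_functional[OF g]])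
    have "\<not> finite_dim sc (?K \<inter> {x. g x = 0})"
    proof
      assume fd: "finite_dim sc (?K \<inter> {x. g x = 0})"
      then obtain B where B: "finite B" "span B = ?K \<inter> {x. g x = 0}" by (auto simp: finite_dim_def)
      have "\<exists>y\<in>?K. g y \<noteq> 0"
      proof (rule ccontr)
        assume "\<not> ?thesis"
        then have "?K \<inter> {x. g x = 0} = ?K" by blast
        then show False using fd K'(2) by simp
      qed
      then obtain y where y: "y \<in> ?K" "g y \<noteq> 0" by blast
      have "span (insert y B) = ?K"
      proof
        show "span (insert y B) \<subseteq> ?K"
          using y(1) span_base[of _ B] B(2) by (intro span_minimal K') auto
        show "?K \<subseteq> span (insert y B)"
        proof
          fix x assume x: "x \<in> ?K"
          have "g (x - sc (g x / g y) y) = 0" using y(2) by (simp add: functional_simps[OF g])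
          then have "x - sc (g x / g y) y \<in> span B"
            using subspace_diff[OF K'(1) x subspace_scale[OF K'(1) y(1)]] B(2) by blast
          then show "x \<in> span (insert y B)" by (auto simp: span_breakdown_eq)
        qed
      qed
      then show False using K'(2) B(1) unfolding finite_dim_def by (metis finite.insertI)
    qed
    then show ?case using sub unfolding eq by blast
  qed
  moreover have "finite_dim sc {0}" by (rule finite_dim_zero)
  moreover have "0 \<in> {x\<in>K. \<forall>g\<in>G. g x = 0}"
    using calculation(1) subspace_0 by blast
  ultimately have "{x\<in>K. \<forall>g\<in>G. g x = 0} \<noteq> {0}" by metis
  then show ?thesis using \<open>0 \<in> {x\<in>K. \<forall>g\<in>G. g x = 0}\<close> by blast
qed

section \<open>Biorthogonal sequences and halfspaces\<close>

text \<open>A unit vector \<open>u\<close> that is almost annihilated by the coordinate functionals of a projection onto \<open>F\<close> stays away from \<open>F\<close> by a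
distance that depends on \<open>F\<close> alone. Hence \<open>M\<close> is known before \<open>u\<close> is chosen, which is what
allows the errors in the next lemma to be made small relative to the norm of a functional yet to come.\<close>

lemma functional_away_from_finite_dim:
  assumes F: "finite_dim sc F"
  shows "\<exists>G \<delta> M. finite G \<and> (\<forall>g\<in>G. functional g) \<and> 0 < \<delta> \<and>
    (\<forall>u. norm u = 1 \<longrightarrow> (\<forall>g\<in>G. norm (g u) \<le> \<delta>) \<longrightarrow>
      (\<exists>h. functional h \<and> h u = 1 \<and> (\<forall>x\<in>F. h x = 0) \<and> (\<forall>x. norm (h x) \<le> M * norm x)))"
proof -
  obtain B g where B: "finite B" and g: "\<And>b. b \<in> B \<Longrightarrow> functional (g b)"
    and P: "\<And>x. (\<Sum>b\<in>B. sc (g b x) b) \<in> F" "\<And>x. x \<in> F \<Longrightarrow> (\<Sum>b\<in>B. sc (g b x) b) = x"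
    using finite_dim_projection[OF F] by blast
  define P where "P x = (\<Sum>b\<in>B. sc (g b x) b)" for x
  have opP: "operator P" unfolding P_def using g by (intro operator_sum operator_rank_one)
  obtain K where K: "0 < K" "\<And>x. norm (P x) \<le> K * norm x" using operator_bound[OF opP] by blast
  define S where "S = (\<Sum>b\<in>B. norm b)"
  have S: "0 \<le> S" unfolding S_def by (rule sum_nonneg) simp
  define \<delta> where "\<delta> = 1 / (2 * (S + 1))"
  have \<delta>: "0 < \<delta>" "\<delta> * S \<le> 1 / 2" using S by (auto simp: \<delta>_def field_simps)
  define c where "c = 1 / (2 * (1 + K))"
  have c: "0 < c" using K by (simp add: c_def)
  have "\<exists>h. functional h \<and> h u = 1 \<and> (\<forall>x\<in>F. h x = 0) \<and> (\<forall>x. norm (h x) \<le> (1 / c) * norm x)"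
    if u: "norm u = 1" "\<forall>b\<in>B. norm (g b u) \<le> \<delta>" for u
  proof -
    have "norm (P u) \<le> (\<Sum>b\<in>B. norm (sc (g b u) b))" unfolding P_def by (rule norm_sum)
    also have "\<dots> \<le> (\<Sum>b\<in>B. \<delta> * norm b)"
      using u(2) by (intro sum_mono) (simp add: norm_sc mult_right_mono)
    also have "\<dots> \<le> 1 / 2" using \<delta>(2) by (simp add: S_def sum_distrib_left)
    finally have Pu: "1 / 2 \<le> norm (u - P u)" using norm_triangle_ineq2[of u "P u"] u(1) by simp
    have "c \<le> norm (u - y)" if "y \<in> F" for y
    proof -
      have "P y = y" using P(2)[OF that] by (simp add: P_def)
      then have "norm (u - P u) = norm ((u - y) - P (u - y))" by (simp add: operator_simps[OF opP])
      also have "\<dots> \<le> norm (u - y) + K * norm (u - y)"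
        using norm_triangle_ineq4[of "u - y" "P (u - y)"] K(2)[of "u - y"] by linarith
      finally have "1 / 2 \<le> norm (u - y) + K * norm (u - y)" using Pu by linarith
      then show ?thesis using K(1) by (simp add: c_def field_simps)
    qed
    from separating_functional[OF subspace_finite_dim[OF F] c this]
    obtain h where "functional h" "\<And>x. x \<in> F \<Longrightarrow> h x = 0" "h u = 1" "\<And>x. norm (h x) \<le> norm x / c" by blast
    then show ?thesis by (intro exI[of _ h]) auto
  qed
  then have *: "\<forall>u. norm u = 1 \<longrightarrow> (\<forall>f\<in>g ` B. norm (f u) \<le> \<delta>) \<longrightarrow>
      (\<exists>h. functional h \<and> h u = 1 \<and> (\<forall>x\<in>F. h x = 0) \<and> (\<forall>x. norm (h x) \<le> (1 / c) * norm x))"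
    by blast
  have "finite (g ` B) \<and> (\<forall>f\<in>g ` B. functional f) \<and> 0 < \<delta>" using B g \<delta>(1) by blast
  then show ?thesis using * by blast
qed

text \<open>The functionals \<open>h k\<close> see the coordinates of a finite combination through a lower
triangular system whose entries above the diagonal are so small that back substitution, from the last
coordinate to the first, costs only a factor \<open>2\<close>.\<close>

lemma triangular_coordinate_bound:
  fixes v :: "nat \<Rightarrow> 'a" and h :: "nat \<Rightarrow> 'a \<Rightarrow> 'k" and M :: "nat \<Rightarrow> real"
  assumes h: "\<And>k. functional (h k)" "\<And>k x. norm (h k x) \<le> M k * norm x"
    and diag: "\<And>k. h k (v k) = 1" and lower: "\<And>j k. k < j \<Longrightarrow> h j (v k) = 0"
    and upper: "\<And>j k. j < k \<Longrightarrow> norm (h j (v k)) * M k \<le> (1 / 2) ^ (k + 2)"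
    and M: "\<And>k. 1 \<le> M k" and j: "j < n"
  shows "norm (a j) \<le> 2 * M j * norm (\<Sum>k<n. sc (a k) (v k))"
  using j
proof (induction "n - j" arbitrary: j rule: less_induct)
  case less
  define x where "x = (\<Sum>k<n. sc (a k) (v k))"
  have IH: "norm (a k) \<le> 2 * M k * norm x" if "k \<in> {j<..<n}" for k
    using less.hyps[of k] less.prems that by (auto simp: x_def)
  have split: "{..<n} = insert j ({..<j} \<union> {j<..<n})" using less.prems by auto
  have "h j x = (\<Sum>k<n. a k * h j (v k))"
    unfolding x_def by (simp add: functional_simps[OF h(1)])
  also have "\<dots> = a j + ((\<Sum>k<j. a k * h j (v k)) + (\<Sum>k\<in>{j<..<n}. a k * h j (v k)))"
    unfolding split by (subst sum.insert) (auto simp: diag intro!: sum.union_disjoint)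
  also have "(\<Sum>k<j. a k * h j (v k)) = 0" by (intro sum.neutral) (simp add: lower)
  finally have "a j = h j x - (\<Sum>k\<in>{j<..<n}. a k * h j (v k))" by simp
  then have "norm (a j) \<le> norm (h j x) + norm (\<Sum>k\<in>{j<..<n}. a k * h j (v k))"
    by (metis norm_triangle_ineq4)
  also have "norm (\<Sum>k\<in>{j<..<n}. a k * h j (v k)) \<le> (\<Sum>k\<in>{j<..<n}. (1 / 2) ^ Suc k * norm x)"
  proof (rule sum_norm_le)
    fix k assume k: "k \<in> {j<..<n}"
    have "norm (a k * h j (v k)) \<le> (2 * M k * norm x) * norm (h j (v k))"
      unfolding norm_mult by (intro mult_right_mono IH k) simp
    also have "\<dots> = 2 * norm x * (norm (h j (v k)) * M k)" by simp
    also have "\<dots> \<le> 2 * norm x * (1 / 2) ^ (k + 2)"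
      using upper[of j k] k by (intro mult_left_mono) auto
    finally show "norm (a k * h j (v k)) \<le> (1 / 2) ^ Suc k * norm x" by (simp add: mult_ac)
  qed
  also have "\<dots> = (\<Sum>k\<in>{j<..<n}. (1 / 2) ^ Suc k) * norm x" by (simp add: sum_distrib_right)
  also have "\<dots> \<le> 1 * norm x"
  proof (intro mult_right_mono norm_ge_zero)
    have "(\<Sum>k\<in>{j<..<n}. (1 / 2 :: real) ^ Suc k) \<le> (\<Sum>k. (1 / 2) ^ Suc k)"
      using power_half_series by (intro sum_le_suminf) (auto simp: sums_iff)
    then show "(\<Sum>k\<in>{j<..<n}. (1 / 2 :: real) ^ Suc k) \<le> 1"
      using power_half_series by (simp add: sums_iff)
  qed
  also have "norm (h j x) + 1 * norm x \<le> M j * norm x + M j * norm x"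
    using h(2)[of j x] mult_right_mono[OF M[of j], of "norm x"] by simp
  finally show ?case by (simp add: x_def)
qed

lemma span_range_except:
  fixes v :: "nat \<Rightarrow> 'a"
  assumes "y \<in> span (v ` (- {j}))"
  shows "\<exists>n b. j < n \<and> b j = 0 \<and> y = (\<Sum>k<n. sc (b k) (v k))"
  using assms
proof (induction rule: span_induct_alt)
  case base
  show ?case by (intro exI[of _ "Suc j"] exI[of _ "\<lambda>_. 0"]) simp
next
  case (step c x y)
  then obtain i n b where i: "x = v i" "i \<noteq> j" and b: "j < n" "b j = 0" "y = (\<Sum>k<n. sc (b k) (v k))"
    by auto
  define m where "m = max n (Suc i)"
  define b' where "b' = (\<lambda>k. (if k < n then b k else 0) + (if k = i then c else 0))"
  have "(\<Sum>k<m. sc (b' k) (v k)) = (\<Sum>k<m. sc (if k < n then b k else 0) (v k)) + (\<Sum>k<m. sc (if k = i then c else 0) (v k))"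
    by (simp add: b'_def scale_left_distrib sum.distrib)
  also have "(\<Sum>k<m. sc (if k < n then b k else 0) (v k)) = (\<Sum>k<n. sc (if k < n then b k else 0) (v k))"
    by (rule sum.mono_neutral_right) (auto simp: m_def)
  also have "\<dots> = y" unfolding b(3) by (intro sum.cong) auto
  also have "(\<Sum>k<m. sc (if k = i then c else 0) (v k)) = (\<Sum>k\<in>{i}. sc (if k = i then c else 0) (v k))"
    by (rule sum.mono_neutral_right) (auto simp: m_def)
  finally have "(\<Sum>k<m. sc (b' k) (v k)) = sc c x + y" using i by (simp add: add.commute)
  then show ?case using i b by (intro exI[of _ m] exI[of _ b']) (auto simp: m_def b'_def)
qed

text \<open>This is Mazur's selection of a basic sequence: if \<open>0\<close> is in the weak closure of the set \<open>U\<close> of unit vectors, the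
terms can be chosen one after the other so that the coordinates are bounded functionals on their span. These
extend to the whole space by separation.\<close>

lemma exists_biorthogonal_sequence:
  assumes unit: "\<And>u. u \<in> U \<Longrightarrow> norm u = 1"
    and weak: "\<And>G \<delta>. finite G \<Longrightarrow> \<forall>g\<in>G. functional g \<Longrightarrow> 0 < \<delta> \<Longrightarrow> \<exists>u\<in>U. \<forall>g\<in>G. norm (g u) \<le> \<delta>"
  shows "\<exists>v \<phi>. (\<forall>k. v k \<in> U) \<and> (\<forall>k. functional (\<phi> k)) \<and>
    (\<forall>j k :: nat. \<phi> j (v k) = (if j = k then 1 else 0))"
proof -
  \<comment> \<open>The triple \<open>r\<close> consists of the vector, its functional and a bound for the norm of the functional.\<close>
  define P where "P f k r \<longleftrightarrow> fst r \<in> U \<and> functional (fst (snd r)) \<and> 1 \<le> snd (snd r) \<and>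
      (\<forall>x. norm (fst (snd r) x) \<le> snd (snd r) * norm x) \<and> fst (snd r) (fst r) = 1 \<and>
      (\<forall>i<k. fst (snd r) (fst (f i)) = 0) \<and>
      (\<forall>j<k. norm (fst (snd (f j)) (fst r)) * snd (snd r) \<le> (1 / 2) ^ (k + 2))"
    for f :: "nat \<Rightarrow> 'a \<times> ('a \<Rightarrow> 'k) \<times> real" and k :: nat and r
  have "\<exists>f. \<forall>k. P f k (f k)"
  proof (rule dependent_wf_choice[of less_than])
    show "P f k r = P g k r" if "\<And>z. (z, k) \<in> less_than \<Longrightarrow> f z = g z" for f g k r
      using that by (simp add: P_def)
    fix k f assume prev: "\<And>y. (y, k) \<in> less_than \<Longrightarrow> P f y (f y)"
    let ?F = "span ((\<lambda>i. fst (f i)) ` {..<k})"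
    have "finite_dim sc ?F" unfolding finite_dim_def by blast
    from functional_away_from_finite_dim[OF this]
    obtain G \<delta> M0 where G: "finite G" "\<forall>g\<in>G. functional g" "0 < \<delta>"
      and M0: "\<And>u. norm u = 1 \<Longrightarrow> \<forall>g\<in>G. norm (g u) \<le> \<delta> \<Longrightarrow>
        \<exists>h. functional h \<and> h u = 1 \<and> (\<forall>x\<in>?F. h x = 0) \<and> (\<forall>x. norm (h x) \<le> M0 * norm x)"
      by blast
    define M where "M = max 1 M0"
    define G' where "G' = G \<union> (\<lambda>j. fst (snd (f j))) ` {..<k}"
    define \<epsilon> where "\<epsilon> = min \<delta> ((1 / 2) ^ (k + 2) / M)"
    have "finite G'" "\<forall>g\<in>G'. functional g" "0 < \<epsilon>"
      using G prev by (auto simp: G'_def P_def \<epsilon>_def M_def)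
    then obtain u where u: "u \<in> U" "\<forall>g\<in>G'. norm (g u) \<le> \<epsilon>" using weak by blast
    have "\<forall>g\<in>G. norm (g u) \<le> \<delta>" using u(2) by (auto simp: G'_def \<epsilon>_def)
    then obtain h where h: "functional h" "h u = 1" "\<And>x. x \<in> ?F \<Longrightarrow> h x = 0" "\<And>x. norm (h x) \<le> M0 * norm x"
      using M0[OF unit[OF u(1)]] by blast
    have M: "norm (h x) \<le> M * norm x" for x
      by (rule order_trans[OF h(4)]) (simp add: M_def mult_right_mono)
    have low: "h (fst (f i)) = 0" if "i < k" for i
      using that by (intro h(3) span_base) auto
    have up: "norm (fst (snd (f j)) u) * M \<le> (1 / 2) ^ (k + 2)" if "j < k" for j
    proof -
      have "fst (snd (f j)) \<in> G'" using that by (auto simp: G'_def)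
      then have "norm (fst (snd (f j)) u) \<le> \<epsilon>" using u(2) by blast
      also have "\<epsilon> \<le> (1 / 2) ^ (k + 2) / M" by (simp add: \<epsilon>_def)
      finally show ?thesis by (simp add: M_def field_simps)
    qed
    have "P f k (u, h, M)"
      unfolding P_def using u(1) h(1,2) M low up by (simp add: M_def)
    then show "\<exists>r. P f k r" by blast
  qed simp
  then obtain f where f: "\<And>k. P f k (f k)" by blast
  define v h M where vhM: "v = (\<lambda>k. fst (f k))" "h = (\<lambda>k. fst (snd (f k)))" "M = (\<lambda>k. snd (snd (f k)))"
  have v: "v k \<in> U" and h: "functional (h k)" and M: "1 \<le> M k"
    and bd: "\<And>x. norm (h k x) \<le> M k * norm x" and diag: "h k (v k) = 1"
    and low: "\<And>i. i < k \<Longrightarrow> h k (v i) = 0"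
    and up: "\<And>j. j < k \<Longrightarrow> norm (h j (v k)) * M k \<le> (1 / 2) ^ (k + 2)" for k
    using f[of k] by (auto simp: P_def vhM)
  have "\<exists>\<phi>. functional \<phi> \<and> (\<forall>k. \<phi> (v k) = (if j = k then 1 else 0))" for j
  proof -
    define c where "c = 1 / (2 * M j)"
    have c: "0 < c" using M[of j] by (simp add: c_def)
    have "c \<le> norm (v j - y)" if y: "y \<in> span (v ` (- {j}))" for y
    proof -
      obtain n b where b: "j < n" "b j = 0" "y = (\<Sum>k<n. sc (b k) (v k))"
        using span_range_except[OF y] by blast
      define a where "a = (\<lambda>k. (if k = j then 1 else 0) - b k)"
      have "(\<Sum>k<n. sc (if k = j then 1 else 0) (v k)) = (\<Sum>k\<in>{j}. sc (if k = j then 1 else 0) (v k))"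
        using b(1) by (intro sum.mono_neutral_right) auto
      then have "(\<Sum>k<n. sc (a k) (v k)) = v j - y"
        by (simp add: a_def b(3) scale_left_diff_distrib sum_subtractf)
      then have "norm (a j) \<le> 2 * M j * norm (v j - y)"
        using triangular_coordinate_bound[OF h bd diag low up M b(1), of a] by simp
      then show ?thesis using M[of j] b(2) by (simp add: a_def c_def field_simps)
    qed
    from separating_functional[OF subspace_span c this]
    obtain \<phi> where \<phi>: "functional \<phi>" "\<And>x. x \<in> span (v ` (- {j})) \<Longrightarrow> \<phi> x = 0" "\<phi> (v j) = 1" by blast
    then have "\<phi> (v k) = (if j = k then 1 else 0)" for k
      using \<phi>(2)[OF span_base, of "v k"] by (cases "j = k") auto
    then show ?thesis using \<phi>(1) by blast
  qed
  then have "\<exists>\<phi>. \<forall>j. functional (\<phi> j) \<and> (\<forall>k. \<phi> j (v k) = (if j = k then 1 else 0))" by (rule choice[OF allI])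
  then show ?thesis using v by blast
qed

text \<open>The even terms are independent, and the odd terms are independent modulo their closed span, because every
\<open>\<phi> j\<close> with odd \<open>j\<close> vanishes on it.\<close>

lemma biorthogonal_halfspace:
  assumes \<phi>: "\<And>j. functional (\<phi> j)" "\<And>j k :: nat. \<phi> j (v k) = (if j = k then 1 else 0)"
  shows "halfspace sc (closure (span (range (\<lambda>k. v (2 * k)))))"
proof -
  let ?Y = "closure (span (range (\<lambda>k. v (2 * k))))"
  have sub: "subspace ?Y" by (intro subspace_closure subspace_span)
  have "?Y \<subseteq> {x. \<phi> j x = 0}" if "odd j" for j
  proof (rule closure_minimal)
    show "span (range (\<lambda>k. v (2 * k))) \<subseteq> {x. \<phi> j x = 0}"
      using that by (intro span_minimal subspace_kernel_functional \<phi>(1)) (auto simp: \<phi>(2))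
    show "closed {x. \<phi> j x = 0}"
      by (intro closed_Collect_eq functional_continuous \<phi>(1) continuous_on_const)
  qed
  then have zero: "\<phi> (2 * i + 1) x = 0" if "x \<in> ?Y" for x i using that by (auto simp: subset_iff)
  have coord: "\<phi> (s i) (\<Sum>k<n. sc (a k) (v (s k))) = a i" if "i < n" "inj s" for i n s and a :: "nat \<Rightarrow> 'k"
    using that(1) by (simp add: functional_simps[OF \<phi>(1)] \<phi>(2) inj_eq[OF that(2)] if_distrib cong: if_cong)
  have "\<not> finite_dim sc ?Y"
  proof (rule infinite_dimI[of "\<lambda>k. v (2 * k)"])
    show "v (2 * k) \<in> ?Y" for k
      by (rule subsetD[OF closure_subset span_base]) auto
    fix n a k assume "(\<Sum>k<n. sc (a k) (v (2 * k))) = 0" "k < (n :: nat)"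
    then show "a k = 0"
      using coord[of k n "\<lambda>k. 2 * k" a] functional_simps(3)[OF \<phi>(1)] by (simp add: inj_def)
  qed
  moreover have "\<not> finite_codim sc ?Y"
  proof (rule infinite_codimI[OF sub, of "\<lambda>k. v (2 * k + 1)"])
    fix n a k assume *: "(\<Sum>k<n. sc (a k) (v (2 * k + 1))) \<in> ?Y" "k < (n :: nat)"
    show "a k = 0"
      using coord[of k n "\<lambda>k. 2 * k + 1" a] zero[OF *(1), of k] *(2) by (simp add: inj_def)
  qed
  ultimately show ?thesis unfolding halfspace_def using sub by simp
qed

text \<open>The halfspace is invariant up to multiples of a single vector \<open>e\<close>; the choice \<open>e = 0\<close> covers invariant halfspaces.\<close>

definition defect_one :: "('a \<Rightarrow> 'a) \<Rightarrow> 'a set \<Rightarrow> bool"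
  where "defect_one A Y \<longleftrightarrow> halfspace sc Y \<and> (\<exists>e. \<forall>x\<in>Y. \<exists>k. A x - sc k e \<in> Y)"

lemma defect_one_closed_span:
  assumes A: "operator A" and S: "\<And>x. x \<in> S \<Longrightarrow> \<exists>k. A x - sc k e \<in> closure (span S)"
    and half: "halfspace sc (closure (span S))"
  shows "defect_one A (closure (span S))"
proof -
  let ?Y = "closure (span S)" and ?W = "{x. \<exists>k. x - sc k e \<in> closure (span S)}"
  have W: "closed ?W" "subspace ?W"
    using closed_add_line[OF closed_closure subspace_closure[OF subspace_span]] by auto
  have "?Y \<subseteq> {x. A x \<in> ?W}"
  proof (rule closure_minimal)
    show "span S \<subseteq> {x. A x \<in> ?W}"
      using S by (intro span_minimal subspace_vimage[OF A W(2)]) auto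
    show "closed {x. A x \<in> ?W}" by (rule closed_vimage_operator[OF A W(1)])
  qed
  then show ?thesis unfolding defect_one_def using half by blast
qed

lemma defect_one_almost_invariant:
  assumes "defect_one A Y" shows "almost_invariant_halfspace sc A 1 Y"
proof -
  obtain e where e: "\<And>x. x \<in> Y \<Longrightarrow> \<exists>k. A x - sc k e \<in> Y" and half: "halfspace sc Y"
    using assms by (auto simp: defect_one_def)
  have "A ` Y \<subseteq> {y + e' |y e'. y \<in> Y \<and> e' \<in> span {e}}"
  proof
    fix z assume "z \<in> A ` Y"
    then obtain x where x: "x \<in> Y" "z = A x" by blast
    then obtain k where k: "A x - sc k e \<in> Y" using e by blast
    have "z = (A x - sc k e) + sc k e" "sc k e \<in> span {e}"
      using x by (simp_all add: span_scale span_base)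
    then show "z \<in> {y + e' |y e'. y \<in> Y \<and> e' \<in> span {e}}" using k by blast
  qed
  moreover have "dim (span {e}) \<le> 1" using dim_le_card[of "span {e}" "{e}"] by simp
  moreover have "finite_dim sc (span {e})" unfolding finite_dim_def by (rule exI[of _ "{e}"]) simp
  ultimately show ?thesis
    unfolding almost_invariant_halfspace_def using half by (intro conjI exI[of _ "span {e}"]) auto
qed

text \<open>Finitely many functionals have a common zero in the unit sphere of an infinite-dimensional kernel, so
the sphere has \<open>0\<close> in its weak closure.\<close>

lemma defect_one_infinite_kernel:
  assumes A: "operator A" and ker: "\<not> finite_dim sc {x. A x = 0}"
  shows "\<exists>Y. defect_one A Y"
proof -
  define U where "U = {u. A u = 0 \<and> norm u = 1}"
  have "\<exists>v \<phi>. (\<forall>k. v k \<in> U) \<and> (\<forall>k. functional (\<phi> k)) \<and>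
      (\<forall>j k :: nat. \<phi> j (v k) = (if j = k then 1 else 0))"
  proof (rule exists_biorthogonal_sequence)
    fix G :: "('a \<Rightarrow> 'k) set" and \<delta> :: real
    assume G: "finite G" "\<forall>g\<in>G. functional g" and \<delta>: "0 < \<delta>"
    have "subspace {x. A x = 0}" using subspace_vimage[OF A subspace_single_0] by simp
    then obtain x where x: "A x = 0" "x \<noteq> 0" "\<And>g. g \<in> G \<Longrightarrow> g x = 0"
      using infinite_dim_functional_kernels[OF G(1) bspec[OF G(2)] _ ker] by blast
    define u where "u = sc (of_real (1 / norm x)) x"
    have "u \<in> U" using x by (simp add: U_def u_def operator_simps[OF A] norm_sc norm_divide)
    moreover have "norm (g u) \<le> \<delta>" if "g \<in> G" for g
      using x(3)[OF that] G(2) that \<delta> by (simp add: u_def functional_simps)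
    ultimately show "\<exists>u\<in>U. \<forall>g\<in>G. norm (g u) \<le> \<delta>" by blast
  qed (simp add: U_def)
  then obtain v \<phi> where v: "\<And>k. v k \<in> U" and \<phi>: "\<And>k. functional (\<phi> k)"
    "\<And>j k :: nat. \<phi> j (v k) = (if j = k then 1 else 0)" by blast
  have "defect_one A (closure (span (range (\<lambda>k. v (2 * k)))))"
  proof (rule defect_one_closed_span[OF A _ biorthogonal_halfspace[OF \<phi>]])
    fix x assume "x \<in> range (\<lambda>k. v (2 * k))"
    then have "A x = 0" using v by (auto simp: U_def)
    moreover have "0 \<in> closure (span (range (\<lambda>k. v (2 * k))))"
      by (intro subspace_0 subspace_closure subspace_span)
    ultimately show "\<exists>k. A x - sc k 0 \<in> closure (span (range (\<lambda>k. v (2 * k))))" by simp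
  qed
  then show ?thesis by blast
qed

end

section \<open>Bounded invertibility\<close>

text \<open>For a bounded operator this says that it has a bounded inverse, without mentioning the inverse.\<close>

definition boundedly_invertible :: "('a::real_normed_vector \<Rightarrow> 'b::real_normed_vector) \<Rightarrow> bool"
  where "boundedly_invertible A \<longleftrightarrow> surj A \<and> (\<exists>c. \<forall>x. norm x \<le> c * norm (A x))"

lemma boundedly_invertibleD:
  assumes "boundedly_invertible A"
  obtains c where "0 < c" "\<And>x. norm x \<le> c * norm (A x)"
proof -
  obtain c where c: "\<And>x. norm x \<le> c * norm (A x)"
    using assms by (auto simp: boundedly_invertible_def)
  have "norm x \<le> (\<bar>c\<bar> + 1) * norm (A x)" for x
    by (rule order_trans[OF c[of x] mult_right_mono]) auto
  then show ?thesis using that[of "\<bar>c\<bar> + 1"] by auto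
qed

lemma boundedly_invertible_eq_0: "boundedly_invertible A \<Longrightarrow> A x = 0 \<Longrightarrow> x = 0"
  by (metis boundedly_invertibleD mult_zero_right norm_le_zero_iff norm_zero)

text \<open>With \<open>R\<close> the inverse of \<open>A\<close>, the equation \<open>A x - D x = y\<close> says that \<open>x\<close> is a fixed point of \<open>x \<mapsto> R (y + D x)\<close>, which
is a contraction.\<close>

lemma boundedly_invertible_perturb:
  fixes A D :: "'a::banach \<Rightarrow> 'a"
  assumes A: "bounded_linear A" and D: "bounded_linear D" and surj: "surj A" and c0: "0 < c"
    and c: "\<And>x. norm x \<le> c * norm (A x)" and small: "\<And>x. c * norm (D x) \<le> norm x / 2"
  shows "surj (\<lambda>x. A x - D x)" and "\<And>x. norm x \<le> 2 * c * norm (A x - D x)"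
proof -
  show "norm x \<le> 2 * c * norm (A x - D x)" for x
  proof -
    have "norm x \<le> c * norm (A x)" by (rule c)
    also have "\<dots> \<le> c * (norm (A x - D x) + norm (D x))"
      using norm_triangle_sub[of "A x" "D x"] c0 by (intro mult_left_mono) (auto simp: add.commute)
    also have "\<dots> \<le> c * norm (A x - D x) + norm x / 2" using small[of x] by (simp add: algebra_simps)
    finally show ?thesis by simp
  qed
  show "surj (\<lambda>x. A x - D x)"
    unfolding surj_def
  proof
    fix y
    define R where "R = inv A"
    have R: "A (R z) = z" for z using surj by (simp add: R_def surj_f_inv_f)
    have "\<exists>!x. R (y + D x) = x"
    proof (rule banach_fix_type[of "1 / 2"])
      show "\<forall>x z. dist (R (y + D x)) (R (y + D z)) \<le> 1 / 2 * dist x z"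
      proof (intro allI)
        fix x z
        have "A (R (y + D x) - R (y + D z)) = D (x - z)"
          using R linear_simps(2)[OF A] linear_simps(2)[OF D] by simp
        then have "norm (R (y + D x) - R (y + D z)) \<le> c * norm (D (x - z))"
          using c[of "R (y + D x) - R (y + D z)"] by simp
        then show "dist (R (y + D x)) (R (y + D z)) \<le> 1 / 2 * dist x z"
          using small[of "x - z"] by (simp add: dist_norm)
      qed
    qed auto
    then obtain x where "R (y + D x) = x" by blast
    then have "A x = y + D x" using R by metis
    then show "\<exists>x. y = A x - D x" by (intro exI[of _ x]) simp
  qed
qed

lemma open_boundedly_invertible:
  fixes A D :: "'a::banach \<Rightarrow> 'a"
  assumes A: "bounded_linear A" and D: "bounded_linear D" and inv: "boundedly_invertible A"
  shows "\<exists>\<delta>>0. \<exists>c>0. \<forall>t. \<bar>t\<bar> < \<delta> \<longrightarrow> surj (\<lambda>x. A x - t *\<^sub>R D x) \<and>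
    (\<forall>x. norm x \<le> c * norm (A x - t *\<^sub>R D x))"
proof -
  obtain c where c: "0 < c" "\<And>x. norm x \<le> c * norm (A x)" using boundedly_invertibleD[OF inv] by blast
  obtain K where K: "0 < K" "\<And>x. norm (D x) \<le> norm x * K" using bounded_linear.pos_bounded[OF D] by blast
  have "surj (\<lambda>x. A x - t *\<^sub>R D x) \<and> (\<forall>x. norm x \<le> 2 * c * norm (A x - t *\<^sub>R D x))"
    if t: "\<bar>t\<bar> < 1 / (2 * c * K)" for t
  proof -
    have tD: "bounded_linear (\<lambda>x. t *\<^sub>R D x)"
      by (rule bounded_linear_compose[OF bounded_linear_scaleR_right D])
    have small: "c * norm (t *\<^sub>R D x) \<le> norm x / 2" for x
    proof -
      have "c * norm (t *\<^sub>R D x) \<le> c * (\<bar>t\<bar> * (norm x * K))"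
        using K(2)[of x] c(1) by (simp add: mult_left_mono)
      also have "\<dots> = (\<bar>t\<bar> * (2 * c * K)) * (norm x / 2)" by simp
      also have "\<dots> \<le> 1 * (norm x / 2)"
        using t c(1) K(1) by (intro mult_right_mono) (auto simp: field_simps)
      finally show ?thesis by simp
    qed
    show ?thesis
      using boundedly_invertible_perturb[OF A tD _ c small] inv by (auto simp: boundedly_invertible_def)
  qed
  then show ?thesis using c(1) K(1) by (intro exI[of _ "1 / (2 * c * K)"] conjI exI[of _ "2 * c"]) auto
qed

context scalar_banach
begin

lemma bounded_inverse:
  assumes A: "operator A" and inv: "boundedly_invertible A"
  obtains R where "operator R" "\<And>x. A (R x) = x" "\<And>x. R (A x) = x"
proof -
  obtain c where c: "0 < c" "\<And>x. norm x \<le> c * norm (A x)" using boundedly_invertibleD[OF inv] by blast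
  define R where "R = Hilbert_Choice.inv A"
  have AR: "A (R x) = x" for x
    using inv by (simp add: R_def boundedly_invertible_def surj_f_inv_f)
  have inj: "x = y" if "A x = A y" for x y
    using boundedly_invertible_eq_0[OF inv, of "x - y"] that by (simp add: operator_simps[OF A])
  have "operator R"
    unfolding operator_def
  proof (intro conjI allI bounded_linear_intro[where K = c])
    show "R (x + y) = R x + R y" for x y by (rule inj) (simp add: operator_simps[OF A] AR)
    show "R (r *\<^sub>R x) = r *\<^sub>R R x" for r x by (rule inj) (simp add: operator_simps[OF A] AR)
    show "R (sc r x) = sc r (R x)" for r x by (rule inj) (simp add: operator_simps[OF A] AR)
    show "norm (R x) \<le> norm x * c" for x using c(2)[of "R x"] by (simp add: AR mult.commute)
  qed
  moreover have "R (A x) = x" for x by (rule inj) (simp add: AR)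
  ultimately show ?thesis using that AR by blast
qed

lemma boundedly_invertibleI:
  assumes A: "operator A" and R: "operator R" "\<And>x. A (R x) = x" and inj: "\<And>x. A x = 0 \<Longrightarrow> x = 0"
  shows "boundedly_invertible A"
proof -
  obtain K where K: "\<And>x. norm (R x) \<le> K * norm x" using operator_bound[OF R(1)] by blast
  have RA: "R (A x) = x" for x
    using inj[of "R (A x) - x"] by (simp add: operator_simps[OF A] R(2))
  have "norm x \<le> K * norm (A x)" for x using K[of "A x"] by (simp add: RA)
  moreover have "surj A" using R(2) by (metis surjI)
  ultimately show ?thesis unfolding boundedly_invertible_def by blast
qed

section \<open>Jordan chains of infinite length\<close>

text \<open>The vectors \<open>Z J m\<close> are obtained from \<open>e m\<close> by applying the first \<open>J\<close> factors \<open>1 - \<mu> j S\<close>, where \<open>S\<close>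
shifts the chain upwards. As \<open>A\<close> is a left inverse of \<open>S\<close>, the \<open>j\<close>-th factor maps \<open>x\<close> to
\<open>(1 - \<mu> j S) x = (A - \<mu> j) (S x)\<close>. So the resolvent \<open>R j\<close> of \<open>A\<close> at \<open>\<mu> j\<close> maps \<open>Z J m\<close>, for
\<open>J > j\<close>, into the span of the \<open>e (Suc k)\<close>, where \<open>f\<close> vanishes. On the other hand \<open>f \<circ> R j\<close> is, up to a
factor, the evaluation of polynomials at \<open>1 / \<mu> j\<close> if \<open>e k\<close> stands for the \<open>k\<close>-th monomial. As a nonzero
polynomial does not vanish at infinitely many points, the \<open>e k\<close> are independent modulo the limits of the \<open>Z J m\<close>.\<close>

lemma defect_one_infinite_chain:
  fixes e :: "nat \<Rightarrow> 'a" and \<tau> :: "nat \<Rightarrow> real"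
  assumes A: "operator A" and f: "functional f"
    and e: "e 0 \<noteq> 0" "A (e 0) = 0" "\<And>k. A (e (Suc k)) = e k"
    and fe: "f (e 0) = 1" "\<And>k. f (e (Suc k)) = 0"
    and lim: "\<tau> \<longlonglongrightarrow> 0" and inv: "\<And>n. boundedly_invertible (\<lambda>x. A x - \<tau> n *\<^sub>R x)"
  shows "\<exists>Y. defect_one A Y"
proof -
  define ok where "ok J x \<longleftrightarrow> (J = 0 \<longrightarrow> fst x = e) \<and> snd x \<in> range \<tau> \<and> \<bar>snd x\<bar> \<le> (1 / 2) ^ J \<and>
    (\<forall>m\<le>J. \<bar>snd x\<bar> * norm (fst x (Suc m)) \<le> (1 / 2) ^ J)" for J :: nat and x :: "(nat \<Rightarrow> 'a) \<times> real"
  have "\<exists>Zm. \<forall>J. ok J (Zm J) \<and> fst (Zm (Suc J)) = (\<lambda>m. fst (Zm J) m - snd (Zm J) *\<^sub>R fst (Zm J) (Suc m))"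
  proof -
    \<comment> \<open>Each \<open>\<mu>\<close> is chosen after the vectors that it multiplies, so that the products are small whatever the norms of the \<open>e k\<close>.\<close>
    have small: "\<exists>\<mu>\<in>range \<tau>. \<bar>\<mu>\<bar> \<le> (1 / 2) ^ J \<and> (\<forall>m\<le>J. \<bar>\<mu>\<bar> * norm (z (Suc m)) \<le> (1 / 2) ^ J)"
      for z :: "nat \<Rightarrow> 'a" and J
    proof -
      define K where "K = 1 + (\<Sum>m\<le>J. norm (z (Suc m)))"
      have K: "1 \<le> K" by (simp add: K_def sum_nonneg)
      have zK: "norm (z (Suc m)) \<le> K" if "m \<le> J" for m
        using member_le_sum[of m "{..J}" "\<lambda>m. norm (z (Suc m))"] that by (simp add: K_def)
      have "\<forall>\<^sub>F n in sequentially. dist (\<tau> n) 0 < (1 / 2) ^ J / K"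
        using K by (intro tendstoD[OF lim]) auto
      then obtain n where "\<bar>\<tau> n\<bar> < (1 / 2) ^ J / K"
        by (auto simp: eventually_sequentially)
      then have n: "\<bar>\<tau> n\<bar> * K \<le> (1 / 2) ^ J" using K by (simp add: field_simps)
      have "\<bar>\<tau> n\<bar> * norm (z (Suc m)) \<le> (1 / 2) ^ J" if "m \<le> J" for m
        by (rule order_trans[OF mult_left_mono[OF zK[OF that]] n]) simp
      moreover have "\<bar>\<tau> n\<bar> \<le> (1 / 2) ^ J"
        using mult_left_mono[OF K, of "\<bar>\<tau> n\<bar>"] n by simp
      ultimately show ?thesis by blast
    qed
    show ?thesis
    proof (rule dependent_nat_choice)
      show "\<exists>x. ok 0 x" using small[of 0 e] by (auto simp: ok_def)
    next
      fix x :: "(nat \<Rightarrow> 'a) \<times> real" and n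
      let ?z = "\<lambda>m. fst x m - snd x *\<^sub>R fst x (Suc m)"
      obtain \<mu> where "\<mu> \<in> range \<tau>" "\<bar>\<mu>\<bar> \<le> (1 / 2) ^ Suc n"
        "\<forall>m\<le>Suc n. \<bar>\<mu>\<bar> * norm (?z (Suc m)) \<le> (1 / 2) ^ Suc n"
        using small[of "Suc n" ?z] by blast
      then show "\<exists>y. ok (Suc n) y \<and> fst y = ?z" by (intro exI[of _ "(?z, \<mu>)"]) (simp add: ok_def)
    qed
  qed
  then obtain Zm where Zm: "\<And>J. ok J (Zm J)"
    "\<And>J. fst (Zm (Suc J)) = (\<lambda>m. fst (Zm J) m - snd (Zm J) *\<^sub>R fst (Zm J) (Suc m))" by blast
  define Z \<mu> where "Z = (\<lambda>J. fst (Zm J))" and "\<mu> = (\<lambda>J. snd (Zm J))"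
  have Z0: "Z 0 = e" and ZSuc: "Z (Suc J) m = Z J m - \<mu> J *\<^sub>R Z J (Suc m)"
    and \<mu>: "\<mu> J \<in> range \<tau>" "\<bar>\<mu> J\<bar> \<le> (1 / 2) ^ J"
    and small: "m \<le> J \<Longrightarrow> \<bar>\<mu> J\<bar> * norm (Z J (Suc m)) \<le> (1 / 2) ^ J" for J m
    using Zm(1)[of 0] Zm(1)[of J] Zm(2)[of J] by (auto simp: Z_def \<mu>_def ok_def)
  have inv\<mu>: "boundedly_invertible (\<lambda>x. A x - \<mu> j *\<^sub>R x)" for j using \<mu>(1)[of j] inv by auto
  have op\<mu>: "operator (\<lambda>x. A x - \<mu> j *\<^sub>R x)" for j
    by (intro operator_diff operator_scaleR A operator_id)
  have "\<exists>R. operator R \<and> (\<forall>x. A (R x) - \<mu> j *\<^sub>R R x = x) \<and> (\<forall>x. R (A x - \<mu> j *\<^sub>R x) = x)" for j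
    using bounded_inverse[OF op\<mu> inv\<mu>, of j] by metis
  then obtain R where R: "\<And>j. operator (R j)" "\<And>j x. A (R j x) - \<mu> j *\<^sub>R R j x = x"
    "\<And>j x. R j (A x - \<mu> j *\<^sub>R x) = x" by metis
  have \<mu>0: "\<mu> j \<noteq> 0" for j
    using boundedly_invertible_eq_0[OF inv\<mu>[of j], of "e 0"] e by auto
  note A_simps = operator_simps[OF A] and f_simps = functional_simps[OF f] and R_simps = operator_simps[OF R(1)]
  have fR: "f (r *\<^sub>R x) = of_real r * f x" for r x by (simp add: scaleR_sc f_simps)
  have AZ: "A (Z J (Suc m)) = Z J m" for J m
    by (induction J arbitrary: m) (simp_all add: Z0 e ZSuc A_simps)
  have fZ: "f (Z J (Suc m)) = 0" for J m
    by (induction J arbitrary: m) (simp_all add: Z0 fe ZSuc f_simps fR)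
  have fZ0: "f (Z J 0) = 1" for J
    by (induction J) (simp_all add: Z0 fe ZSuc f_simps fR fZ)
  have fRZ: "f (R j (Z J m)) = 0" if "j < J" for j J m
    using that
  proof (induction J arbitrary: m)
    case (Suc J)
    show ?case
    proof (cases "j = J")
      case True
      have "Z (Suc J) m = A (Z J (Suc m)) - \<mu> J *\<^sub>R Z J (Suc m)" by (simp add: ZSuc AZ)
      then show ?thesis using True by (simp add: R(3) fZ)
    next
      case False
      then show ?thesis using Suc by (simp add: ZSuc R_simps f_simps fR)
    qed
  qed simp
  have "convergent (\<lambda>J. Z J m)" for m
  proof -
    have "summable (\<lambda>J. Z (Suc J) m - Z J m)"
    proof (rule summable_comparison_test')
      show "summable (\<lambda>J. (1 / 2 :: real) ^ J)" by simp
      show "norm (Z (Suc J) m - Z J m) \<le> (1 / 2) ^ J" if "m \<le> J" for J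
        using small[OF that] by (simp add: ZSuc)
    qed
    then have "(\<lambda>n. \<Sum>J<n. Z (Suc J) m - Z J m) \<longlonglongrightarrow> (\<Sum>J. Z (Suc J) m - Z J m)"
      by (rule summable_LIMSEQ)
    then have "(\<lambda>n. Z n m - Z 0 m) \<longlonglongrightarrow> (\<Sum>J. Z (Suc J) m - Z J m)"
      by (simp add: sum_lessThan_telescope[of "\<lambda>J. Z J m"])
    from tendsto_add[OF this tendsto_const[of "Z 0 m"]] show ?thesis by (auto simp: convergent_def)
  qed
  then have "\<exists>z. \<forall>m. (\<lambda>J. Z J m) \<longlonglongrightarrow> z m" by (intro choice allI) (auto simp: convergent_def)
  then obtain z where z: "\<And>m. (\<lambda>J. Z J m) \<longlonglongrightarrow> z m" by blast
  have Az: "A (z (Suc m)) = z m" for m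
    using LIMSEQ_unique[OF operator_tendsto[OF A z[of "Suc m"]]] z[of m] by (simp add: AZ)
  have fz: "f (z m) = (if m = 0 then 1 else 0)" for m
    using LIMSEQ_unique[OF functional_tendsto[OF f z[of m]], of "if m = 0 then 1 else 0"]
    by (cases m) (simp_all add: fZ fZ0)
  have fRz: "f (R j (z m)) = 0" for j m
  proof (rule LIMSEQ_unique[OF functional_tendsto[OF f operator_tendsto[OF R(1) z]]])
    show "(\<lambda>J. f (R j (Z J m))) \<longlonglongrightarrow> 0"
      by (rule tendsto_eventually) (auto simp: eventually_sequentially fRZ intro!: exI[of _ "Suc j"])
  qed
  \<comment> \<open>Apply \<open>R j\<close> to \<open>(A - \<mu> j) (e (Suc k)) = e k - \<mu> j e (Suc k)\<close>, and then \<open>f\<close>.\<close>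
  have fRe: "f (R j (e k)) = - ((1 / of_real (\<mu> j)) ^ Suc k)" for j k
  proof (induction k)
    case 0
    have "\<mu> j *\<^sub>R R j (e 0) = - R j (A (e 0) - \<mu> j *\<^sub>R e 0)" by (simp add: e R_simps)
    then have "\<mu> j *\<^sub>R R j (e 0) = - e 0" by (simp only: R(3))
    from arg_cong[OF this, of f] show ?case using \<mu>0[of j] by (simp add: fR f_simps fe field_simps)
  next
    case (Suc k)
    have "\<mu> j *\<^sub>R R j (e (Suc k)) = R j (e k) - R j (A (e (Suc k)) - \<mu> j *\<^sub>R e (Suc k))" by (simp add: e R_simps)
    then have "\<mu> j *\<^sub>R R j (e (Suc k)) = R j (e k) - e (Suc k)" by (simp only: R(3))
    from arg_cong[OF this, of f] show ?case using \<mu>0[of j] by (simp add: fR f_simps fe Suc field_simps)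
  qed
  have "infinite (range \<mu>)"
  proof
    assume fin: "finite (range \<mu>)"
    define d where "d = Min ((\<lambda>t. \<bar>t\<bar>) ` range \<mu>)"
    have "0 < d" unfolding d_def using fin \<mu>0 by (subst Min_gr_iff) auto
    then obtain j where "(1 / 2) ^ j < d" using real_arch_pow_inv[of d "1 / 2"] by auto
    moreover have "d \<le> \<bar>\<mu> j\<bar>" unfolding d_def using fin by (intro Min_le) auto
    ultimately show False using \<mu>(2)[of j] by simp
  qed
  then have inf: "infinite ((\<lambda>t. 1 / of_real t :: 'k) ` range \<mu>)"
    by (subst finite_image_iff) (auto simp: inj_on_def)
  let ?Y = "closure (span (range z))"
  have sub: "subspace ?Y" by (intro subspace_closure subspace_span)
  have YH: "f (R j x) = 0" if "x \<in> ?Y" for x j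
  proof -
    have fnl: "functional (\<lambda>x. f (R j x))" by (rule functional_compose[OF f R(1)])
    have "?Y \<subseteq> {x. f (R j x) = 0}"
    proof (rule closure_minimal)
      show "span (range z) \<subseteq> {x. f (R j x) = 0}"
        by (intro span_minimal subspace_kernel_functional[OF fnl]) (auto simp: fRz)
      show "closed {x. f (R j x) = 0}"
        by (intro closed_Collect_eq functional_continuous[OF fnl] continuous_on_const)
    qed
    then show ?thesis using that by blast
  qed
  have "\<not> finite_dim sc ?Y"
  proof (rule infinite_dimI[of z])
    show "z k \<in> ?Y" for k by (rule subsetD[OF closure_subset span_base]) auto
    show "a k = 0" if "(\<Sum>k<n. sc (a k) (z k)) = 0" "k < n" for n a k
      using that
    proof (induction n arbitrary: a k)
      case (Suc n)
      have split: "(\<Sum>k<Suc n. sc (a k) (z k)) = sc (a 0) (z 0) + (\<Sum>k<n. sc (a (Suc k)) (z (Suc k)))"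
        by (rule sum.lessThan_Suc_shift)
      have a0: "a 0 = 0"
        using arg_cong[OF Suc.prems(1), of f] unfolding split by (simp add: f_simps fz)
      have "(\<Sum>k<n. sc (a (Suc k)) (z k)) = 0"
        using arg_cong[OF Suc.prems(1), of A] unfolding split by (simp add: A_simps a0 Az)
      from Suc.IH[OF this, of "k - 1"] show ?case using a0 Suc.prems(2) by (cases k) auto
    qed simp
  qed
  moreover have "\<not> finite_codim sc ?Y"
  proof (rule infinite_codimI[OF sub, of e])
    fix n a k assume *: "(\<Sum>k<n. sc (a k) (e k)) \<in> ?Y" "k < (n :: nat)"
    define p where "p = (\<Sum>k<n. monom (a k) k)"
    have "poly p (1 / of_real (\<mu> j)) = 0" for j
    proof -
      have "0 = (\<Sum>k<n. a k * f (R j (e k)))"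
        using YH[OF *(1), of j] by (simp add: R_simps f_simps)
      also have "\<dots> = - (1 / of_real (\<mu> j)) * poly p (1 / of_real (\<mu> j))"
        by (simp add: fRe p_def poly_sum poly_monom sum_distrib_left sum_negf mult_ac)
      finally show ?thesis using \<mu>0[of j] by simp
    qed
    then have "(\<lambda>t. 1 / of_real t :: 'k) ` range \<mu> \<subseteq> {x. poly p x = 0}" by auto
    then have "p = 0" using inf poly_roots_finite[of p] finite_subset by blast
    then have "0 = coeff p k" by simp
    also have "\<dots> = a k" using *(2) by (simp add: p_def coeff_sum)
    finally show "a k = 0" by simp
  qed
  ultimately have half: "halfspace sc ?Y" unfolding halfspace_def using sub by simp
  have zY: "z m \<in> ?Y" for m by (rule subsetD[OF closure_subset span_base]) auto
  have "defect_one A ?Y"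
  proof (rule defect_one_closed_span[OF A _ half])
    fix x assume "x \<in> range z"
    then obtain m where m: "x = z m" by blast
    show "\<exists>k. A x - sc k (A (z 0)) \<in> ?Y"
    proof (cases m)
      case 0
      then show ?thesis using m subspace_0[OF sub] by (intro exI[of _ 1]) simp
    next
      case (Suc l)
      then show ?thesis using m zY[of l] by (intro exI[of _ 0]) (simp add: Az)
    qed
  qed
  then show ?thesis by blast
qed

end

section \<open>Reflexive spaces\<close>

text \<open>Reflexivity is used only in the following form: if the images of a bounded sequence under an injective
operator converge, then the sequence converges weakly and the image of its weak limit is the limit of the images.\<close>

locale reflexive_scalar_banach = scalar_banach sc
  for sc :: "'k::real_normed_field \<Rightarrow> 'a::banach \<Rightarrow> 'a" +
  assumes weak_limit: "\<And>(A :: 'a \<Rightarrow> 'a) (h :: nat \<Rightarrow> 'a) z K. bounded_linear A \<Longrightarrow> (\<And>x. A x = 0 \<Longrightarrow> x = 0) \<Longrightarrow>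
    (\<And>n. norm (h n) \<le> K) \<Longrightarrow> (\<lambda>n. A (h n)) \<longlonglongrightarrow> z \<Longrightarrow>
    \<exists>y. A y = z \<and> (\<forall>g. bounded_linear g \<and> (\<forall>c x. g (sc c x) = c * g x) \<longrightarrow> (\<lambda>n. g (h n)) \<longlonglongrightarrow> g y)"
begin

lemma bounded_preimage_limit:
  assumes A: "operator A" and inj: "\<And>x. A x = 0 \<Longrightarrow> x = 0"
    and h: "\<And>n. norm (h n) \<le> K" "(\<lambda>n. A (h n)) \<longlonglongrightarrow> z"
  obtains y where "A y = z" "\<And>g. functional g \<Longrightarrow> (\<lambda>n. g (h n)) \<longlonglongrightarrow> g y"
  using weak_limit[OF operator_bounded_linear[OF A] inj h] unfolding functional_def by blast

lemma closed_image_cball: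
  assumes A: "operator A" and inj: "\<And>x. A x = 0 \<Longrightarrow> x = 0" and r: "0 \<le> r"
  shows "closed (A ` cball 0 r)"
  unfolding closed_sequential_limits
proof (intro allI impI, elim conjE)
  fix w z assume "\<forall>n. w n \<in> A ` cball 0 r" and lim: "w \<longlonglongrightarrow> z"
  then have "\<exists>x. norm x \<le> r \<and> w n = A x" for n by (force simp: image_iff)
  then have "\<exists>h. \<forall>n. norm (h n) \<le> r \<and> w n = A (h n)" by (intro choice allI)
  then obtain h where h: "\<And>n. norm (h n) \<le> r" "\<And>n. w n = A (h n)" by blast
  have "(\<lambda>n. A (h n)) \<longlonglongrightarrow> z" using lim by (simp add: h(2)[symmetric])
  then obtain y where y: "A y = z" "\<And>g. functional g \<Longrightarrow> (\<lambda>n. g (h n)) \<longlonglongrightarrow> g y"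
    using bounded_preimage_limit[of A h, OF A inj h(1)] by blast
  have "norm y \<le> r"
  proof (cases "y = 0")
    case False
    then obtain g where g: "functional g" "g y = 1" "\<And>x. norm (g x) \<le> norm x / norm y"
      using norming_functional[OF False] by blast
    have "norm (g (h n)) \<le> r / norm y" for n
      using order_trans[OF g(3)[of "h n"] divide_right_mono[OF h(1)]] by simp
    then have "norm (g y) \<le> r / norm y"
      by (intro LIMSEQ_le_const2[OF tendsto_norm[OF y(2)[OF g(1)]]]) auto
    then show ?thesis using False g(2) by (simp add: field_simps)
  qed (use r in simp)
  then show "z \<in> A ` cball 0 r" using y(1) by auto
qed

text \<open>The images of the balls are closed, so by Baire's theorem one of them has interior points as soon as they cover
the space.\<close>

lemma bijective_boundedly_invertible:
  assumes A: "operator A" and inj: "\<And>x. A x = 0 \<Longrightarrow> x = 0" and surj: "surj A"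
  shows "boundedly_invertible A"
proof -
  have "\<exists>n::nat. interior (A ` cball 0 (real n)) \<noteq> {}"
  proof (rule ccontr)
    assume *: "\<not> ?thesis"
    have "Met_TC.mtopology interior_of \<Union>(range (\<lambda>n::nat. A ` cball 0 (real n))) = {}"
      by (rule Met_TC.metric_Baire_category_alt)
        (use * closed_image_cball[OF A inj] in \<open>auto simp: complete_UNIV\<close>)
    moreover have "\<Union>(range (\<lambda>n::nat. A ` cball 0 (real n))) = UNIV"
    proof -
      have "y \<in> \<Union>(range (\<lambda>n::nat. A ` cball 0 (real n)))" for y
      proof -
        obtain x where "y = A x" using surj by (metis surjD)
        moreover obtain n :: nat where "norm x \<le> real n" using real_arch_simple by blast
        ultimately show ?thesis by (intro UN_I[of n] image_eqI[of _ _ x]) auto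
      qed
      then show ?thesis by blast
    qed
    ultimately show False by simp
  qed
  then obtain n :: nat and y0 where "y0 \<in> interior (A ` cball 0 (real n))" by blast
  then obtain r where r: "0 < r" "ball y0 r \<subseteq> A ` cball 0 (real n)" by (auto simp: mem_interior)
  have eq: "x = y" if "A x = A y" for x y
    using inj[of "x - y"] that by (simp add: operator_simps[OF A])
  have bd: "norm x \<le> 2 * real n" if "norm (A x) < r" for x
  proof -
    have "y0 + A x \<in> ball y0 r" "y0 \<in> ball y0 r" using that r(1) by (auto simp: dist_norm)
    then have "y0 + A x \<in> A ` cball 0 (real n)" "y0 \<in> A ` cball 0 (real n)" using r(2) by blast+
    then obtain a b where ab: "norm a \<le> real n" "norm b \<le> real n" "y0 + A x = A a" "y0 = A b"
      by (elim imageE) simp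
    then have "A x = A (a - b)" by (simp add: operator_simps[OF A] algebra_simps)
    then have "x = a - b" by (rule eq)
    then show ?thesis using norm_triangle_ineq4[of a b] ab by simp
  qed
  have "norm x \<le> (4 * real n / r) * norm (A x)" for x
  proof (cases "x = 0")
    case False
    then have Ax: "0 < norm (A x)" using inj by auto
    define t where "t = r / (2 * norm (A x))"
    have t: "0 < t" using Ax r(1) by (simp add: t_def)
    have "norm (A (t *\<^sub>R x)) < r" using Ax r(1) by (simp add: operator_simps[OF A] t_def)
    from bd[OF this] have "t * norm x \<le> 2 * real n" using t by simp
    then show ?thesis using Ax r(1) by (simp add: t_def field_simps)
  qed (use r(1) in simp)
  then show ?thesis using surj unfolding boundedly_invertible_def by blast
qed

text \<open>A bounded sequence of solutions \<open>h n\<close> of \<open>A (h n) - \<tau> n h n = e\<close> would have \<open>A (h n) \<longlonglongrightarrow> e\<close> and put \<open>e\<close> into the range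
of \<open>A\<close>. For the normalised solutions \<open>u k\<close>, on the other hand, \<open>A (u k) \<longlonglongrightarrow> 0\<close>, which makes them weakly null.\<close>

lemma defect_one_injective:
  assumes A: "operator A" and inj: "\<And>x. A x = 0 \<Longrightarrow> x = 0" and ninv: "\<not> boundedly_invertible A"
    and lim: "\<tau> \<longlonglongrightarrow> 0" and inv: "\<And>n. boundedly_invertible (\<lambda>x. A x - \<tau> n *\<^sub>R x)"
  shows "\<exists>Y. defect_one A Y"
proof -
  obtain e where e: "\<And>x. A x \<noteq> e"
    using bijective_boundedly_invertible[OF A inj] ninv by (metis surjI surj_def)
  have "\<exists>h. \<forall>n. A (h n) - \<tau> n *\<^sub>R h n = e"
    using inv unfolding boundedly_invertible_def surj_def by (intro choice allI) metis
  then obtain h where h: "\<And>n. A (h n) - \<tau> n *\<^sub>R h n = e" by blast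
  have Ah: "A (h n) = \<tau> n *\<^sub>R h n + e" for n using h[of n] by (simp add: algebra_simps)
  have "\<exists>n\<ge>k. real k + 1 \<le> norm (h n)" for k
  proof (rule ccontr)
    assume "\<not> ?thesis"
    then have bd: "norm (h (n + k)) \<le> real k + 1" for n
      by (metis le_add2 nle_le)
    have "(\<lambda>n. \<tau> (n + k) *\<^sub>R h (n + k)) \<longlonglongrightarrow> 0"
    proof (rule Lim_null_comparison)
      show "\<forall>\<^sub>F n in sequentially. norm (\<tau> (n + k) *\<^sub>R h (n + k)) \<le> \<bar>\<tau> (n + k)\<bar> * (real k + 1)"
        using bd by (intro always_eventually allI) (simp add: mult_left_mono)
      show "(\<lambda>n. \<bar>\<tau> (n + k)\<bar> * (real k + 1)) \<longlonglongrightarrow> 0"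
        using LIMSEQ_ignore_initial_segment[OF lim, of k]
        by (intro tendsto_mult_left_zero tendsto_rabs_zero)
    qed
    from tendsto_add[OF this tendsto_const[of e]] have "(\<lambda>n. A (h (n + k))) \<longlonglongrightarrow> e"
      by (simp add: Ah)
    then obtain y where "A y = e"
      using bounded_preimage_limit[of A "\<lambda>n. h (n + k)", OF A inj bd] by blast
    then show False using e by blast
  qed
  then have "\<exists>s. \<forall>k. k \<le> s k \<and> real k + 1 \<le> norm (h (s k))" by (intro choice allI) blast
  then obtain s where s: "\<And>k. k \<le> s k" "\<And>k. real k + 1 \<le> norm (h (s k))" by blast
  define u where "u k = (1 / norm (h (s k))) *\<^sub>R h (s k)" for k
  have pos: "0 < norm (h (s k))" for k using s(2)[of k] by linarith
  have nu: "norm (u k) = 1" for k using pos[of k] by (simp add: u_def)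
  have Au: "A (u k) = \<tau> (s k) *\<^sub>R u k + (1 / norm (h (s k))) *\<^sub>R e" for k
    by (simp add: u_def operator_simps[OF A] Ah scaleR_add_right)
  have \<tau>s: "(\<lambda>k. \<tau> (s k)) \<longlonglongrightarrow> 0"
    by (rule filterlim_compose[OF lim]) (use s(1) in \<open>auto intro: filterlim_at_top_mono[OF filterlim_ident]\<close>)
  have "(\<lambda>k. A (u k)) \<longlonglongrightarrow> 0"
  proof -
    have "(\<lambda>k. \<tau> (s k) *\<^sub>R u k) \<longlonglongrightarrow> 0"
      by (rule Lim_null_comparison[OF _ tendsto_rabs_zero[OF \<tau>s]]) (simp add: nu)
    moreover have "(\<lambda>k. (1 / norm (h (s k))) *\<^sub>R e) \<longlonglongrightarrow> 0"
    proof (rule Lim_null_comparison[OF always_eventually])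
      show "(\<lambda>k. inverse (real (Suc k)) * norm e) \<longlonglongrightarrow> 0"
        using tendsto_mult_left_zero[OF LIMSEQ_inverse_real_of_nat] .
      have le: "1 / norm (h (s k)) \<le> inverse (real (Suc k))" for k
        using s(2)[of k] by (simp add: inverse_eq_divide frac_le)
      have "norm ((1 / norm (h (s k))) *\<^sub>R e) \<le> inverse (real (Suc k)) * norm e" for k
        using mult_right_mono[OF le[of k] norm_ge_zero[of e]] by simp
      then show "\<forall>k. norm ((1 / norm (h (s k))) *\<^sub>R e) \<le> inverse (real (Suc k)) * norm e"
        by blast
    qed
    ultimately show ?thesis unfolding Au using tendsto_add_zero by blast
  qed
  then obtain y where y: "A y = 0" "\<And>g. functional g \<Longrightarrow> (\<lambda>n. g (u n)) \<longlonglongrightarrow> g y"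
    using bounded_preimage_limit[OF A inj, of u 1 0] nu by (metis order_refl)
  have weak: "(\<lambda>n. g (u n)) \<longlonglongrightarrow> 0" if "functional g" for g
    using y(2)[OF that] inj[OF y(1)] functional_simps(3)[OF that] by simp
  have "\<exists>v \<phi>. (\<forall>k. v k \<in> range u) \<and> (\<forall>k. functional (\<phi> k)) \<and>
      (\<forall>j k :: nat. \<phi> j (v k) = (if j = k then 1 else 0))"
  proof (rule exists_biorthogonal_sequence)
    fix G :: "('a \<Rightarrow> 'k) set" and \<delta> :: real
    assume G: "finite G" "\<forall>g\<in>G. functional g" and \<delta>: "0 < \<delta>"
    have "\<forall>\<^sub>F n in sequentially. \<forall>g\<in>G. dist (g (u n)) 0 < \<delta>"
      using tendstoD[OF weak \<delta>] G by (intro eventually_ball_finite) blast+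
    then obtain n where "\<forall>g\<in>G. dist (g (u n)) 0 < \<delta>" by (auto simp: eventually_sequentially)
    then have "\<forall>g\<in>G. norm (g (u n)) \<le> \<delta>" by (simp add: less_imp_le)
    then show "\<exists>u\<in>range u. \<forall>g\<in>G. norm (g u) \<le> \<delta>" by blast
  qed (use nu in auto)
  then obtain v \<phi> where v: "\<And>k. v k \<in> range u" and \<phi>: "\<And>k. functional (\<phi> k)"
    "\<And>j k :: nat. \<phi> j (v k) = (if j = k then 1 else 0)" by blast
  have "defect_one A (closure (span (range (\<lambda>k. v (2 * k)))))"
  proof (rule defect_one_closed_span[OF A _ biorthogonal_halfspace[OF \<phi>]])
    fix x assume x: "x \<in> range (\<lambda>k. v (2 * k))"
    then obtain k where k: "x = u k" using v by blast
    have "A x - sc (of_real (1 / norm (h (s k)))) e = sc (of_real (\<tau> (s k))) x"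
      using Au[of k] by (simp add: k scaleR_sc)
    also have "\<dots> \<in> closure (span (range (\<lambda>k. v (2 * k))))"
      using x by (intro subsetD[OF closure_subset] span_scale span_base)
    finally show "\<exists>k. A x - sc k e \<in> closure (span (range (\<lambda>k. v (2 * k))))" by blast
  qed
  then show ?thesis by blast
qed

end

context scalar_banach
begin

section \<open>Generalised kernels\<close>

lemma finite_dim_kernel_power:
  assumes A: "operator A" and ker: "finite_dim sc {x. A x = 0}"
  shows "finite_dim sc {x. (A ^^ p) x = 0}"
proof (induction p)
  case 0
  show ?case using finite_dim_zero by simp
next
  case (Suc p)
  have "{x. (A ^^ Suc p) x = 0} = {x. A x \<in> {x. (A ^^ p) x = 0}}" by (simp add: funpow_swap1)
  then show ?case using finite_dim_vimage[OF A ker Suc] by simp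
qed

text \<open>A member of minimal dimension contains no proper subspace of the same dimension.\<close>

lemma decreasing_subspaces_stabilise:
  fixes J :: "nat \<Rightarrow> 'a set"
  assumes fin: "\<And>p. finite_dim sc (J p)" and dec: "\<And>p q. p \<le> q \<Longrightarrow> J q \<subseteq> J p"
  shows "\<exists>p. \<forall>q\<ge>p. J q = J p"
proof -
  obtain p where p: "\<And>q. dim (J p) \<le> dim (J q)"
    using ex_has_least_nat[of "\<lambda>_. True" 0 "\<lambda>p. dim (J p)"] by auto
  have "J q = J p" if "p \<le> q" for q
  proof
    show "J q \<subseteq> J p" by (rule dec[OF that])
    obtain B where B: "finite B" "independent B" "span B = J q" by (rule finite_dim_basis[OF fin])
    obtain C where C: "finite C" "independent C" "span C = J p" by (rule finite_dim_basis[OF fin])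
    have card: "card C \<le> card B"
      using p[of q] dim_span_eq_card_independent[OF B(2)] dim_span_eq_card_independent[OF C(2)] B C by simp
    show "J p \<subseteq> J q"
    proof (rule ccontr)
      assume "\<not> J p \<subseteq> J q"
      then obtain x where x: "x \<in> J p" "x \<notin> span B" using B(3) by blast
      have "independent (insert x B)" by (rule independent_insertI[OF x(2) B(2)])
      moreover have "insert x B \<subseteq> span C"
        using x(1) span_base[of _ B] B(3) C(3) dec[OF that] by blast
      ultimately have "card (insert x B) \<le> card C" using independent_span_bound[OF C(1)] by blast
      moreover have "x \<notin> B" using x(2) span_base by blast
      ultimately show False using card B(1) by simp
    qed
  qed
  then show ?thesis by blast
qed

text \<open>The intersections of \<open>ker A\<close> with the ranges of the powers stabilise, say at \<open>p\<close>. Then on the vectors in the range of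
\<open>A ^^ p\<close> that are annihilated by some power of \<open>A\<close>, the operator \<open>A\<close> is surjective, and the chain can be continued upwards
forever. Subtracting multiples of \<open>e 0\<close> keeps it in the kernel of \<open>f\<close>.\<close>

lemma infinite_chain_exists:
  assumes A: "operator A" and ker: "finite_dim sc {x. A x = 0}"
    and grow: "\<And>p. \<exists>x. (A ^^ Suc p) x = 0 \<and> (A ^^ p) x \<noteq> 0"
  shows "\<exists>e f. functional f \<and> e 0 \<noteq> 0 \<and> A (e 0) = 0 \<and> (\<forall>k :: nat. A (e (Suc k)) = e k) \<and>
    f (e 0) = 1 \<and> (\<forall>k. f (e (Suc k)) = 0)"
proof -
  define J where "J p = {x. A x = 0} \<inter> range (A ^^ p)" for p
  have opow: "operator (A ^^ p)" for p by (rule operator_power[OF A])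
  note A_simps = operator_simps[OF A] and pow_simps = operator_simps[OF opow]
  have add: "(A ^^ (p + q)) x = (A ^^ p) ((A ^^ q) x)" for p q x by (simp add: funpow_add)
  have swap: "(A ^^ p) ((A ^^ q) x) = (A ^^ q) ((A ^^ p) x)" for p q x
    using add[of p q] add[of q p] by (simp add: add.commute)
  have "finite_dim sc (J p)" for p
  proof (rule finite_dim_subset[OF ker])
    have "subspace {x. A x = 0}" by (rule subspace_finite_dim[OF ker])
    moreover have "subspace (range (A ^^ p))" by (rule subspace_image[OF opow subspace_UNIV])
    ultimately show "subspace (J p)" unfolding J_def by (rule subspace_inter)
  qed (auto simp: J_def)
  moreover have "J q \<subseteq> J p" if "p \<le> q" for p q
  proof -
    have "(A ^^ q) x \<in> range (A ^^ p)" for x using add[of p "q - p" x] that by simp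
    then show ?thesis unfolding J_def by auto
  qed
  ultimately obtain p where p: "\<And>q. p \<le> q \<Longrightarrow> J q = J p"
    using decreasing_subspaces_stabilise by blast
  have lift: "x \<in> range (A ^^ Suc p)" if "x \<in> range (A ^^ p)" "(A ^^ j) x = 0" for x j
    using that
  proof (induction j arbitrary: x)
    case 0
    then have "x = (A ^^ Suc p) 0" by (simp only: pow_simps) simp
    then show ?case by blast
  next
    case (Suc j)
    obtain w where w: "x = (A ^^ p) w" using Suc.prems(1) by blast
    have "(A ^^ j) x \<in> J (p + j)"
      unfolding J_def using Suc.prems(2) w add[of p j w] swap[of j p w]
      by (auto intro: range_eqI[of _ _ w])
    then have "(A ^^ j) x \<in> J (Suc p + j)" using p[of "p + j"] p[of "Suc p + j"] by simp
    then obtain z where z: "(A ^^ j) x = (A ^^ (Suc p + j)) z" unfolding J_def by blast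
    define y where "y = x - (A ^^ Suc p) z"
    have "y = (A ^^ p) (w - A z)" by (simp add: y_def w pow_simps funpow_swap1)
    moreover have "(A ^^ j) y = 0"
      unfolding y_def pow_simps z add[of "Suc p" j] swap[of j "Suc p"] by simp
    ultimately have "y \<in> range (A ^^ Suc p)" using Suc.IH by blast
    then obtain y' where "y = (A ^^ Suc p) y'" by blast
    then have "x = (A ^^ Suc p) (y' + z)" unfolding y_def by (simp only: pow_simps) (simp add: algebra_simps)
    then show ?case by blast
  qed
  define D where "D = {x. x \<in> range (A ^^ p) \<and> (\<exists>j. (A ^^ j) x = 0)}"
  have surjD: "\<exists>y\<in>D. A y = x" if "x \<in> D" for x
  proof -
    from that obtain j where j: "(A ^^ j) x = 0" "x \<in> range (A ^^ p)" by (auto simp: D_def)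
    then obtain w where w: "x = A ((A ^^ p) w)" using lift by auto
    have "(A ^^ Suc j) ((A ^^ p) w) = 0" using j(1) w by (simp add: funpow_swap1)
    then have "(A ^^ p) w \<in> D" unfolding D_def by blast
    then show ?thesis using w by blast
  qed
  obtain x0 where x0: "(A ^^ Suc p) x0 = 0" "(A ^^ p) x0 \<noteq> 0" using grow by blast
  define e0 where "e0 = (A ^^ p) x0"
  have e0: "e0 \<noteq> 0" "A e0 = 0" using x0 by (auto simp: e0_def)
  obtain f where f: "functional f" "f e0 = 1" using norming_functional[OF e0(1)] by blast
  have "e0 \<in> D" unfolding D_def using e0(2) by (auto simp: e0_def intro!: exI[of _ 1])
  have "\<exists>e. \<forall>k. (e k \<in> D \<and> f (e k) = (if k = 0 then 1 else 0) \<and> (k = 0 \<longrightarrow> e k = e0)) \<and> A (e (Suc k)) = e k"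
  proof (rule dependent_nat_choice)
    show "\<exists>x. x \<in> D \<and> f x = (if 0 = (0::nat) then 1 else 0) \<and> (0 = (0::nat) \<longrightarrow> x = e0)"
      using \<open>e0 \<in> D\<close> f(2) by auto
    fix x and k :: nat assume "x \<in> D \<and> f x = (if k = 0 then 1 else 0) \<and> (k = 0 \<longrightarrow> x = e0)"
    then obtain y where y: "y \<in> D" "A y = x" using surjD by blast
    obtain w j where wj: "y = (A ^^ p) w" "(A ^^ j) y = 0" using y(1) by (auto simp: D_def)
    define y' where "y' = y - sc (f y) e0"
    have "y' = (A ^^ p) (w - sc (f y) x0)" by (simp add: y'_def wj(1) e0_def pow_simps)
    moreover have "(A ^^ Suc j) y' = 0"
    proof -
      have "(A ^^ Suc j) e0 = 0" using e0(2) by (simp add: funpow_swap1 pow_simps)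
      moreover have "(A ^^ Suc j) y = 0" using wj(2) by (simp add: A_simps)
      ultimately show ?thesis unfolding y'_def by (simp only: pow_simps) simp
    qed
    ultimately have "y' \<in> D" unfolding D_def by blast
    moreover have "f y' = 0" "A y' = x" using f y(2) e0(2) by (simp_all add: y'_def functional_simps A_simps)
    ultimately show "\<exists>y. (y \<in> D \<and> f y = (if Suc k = 0 then 1 else 0) \<and> (Suc k = 0 \<longrightarrow> y = e0)) \<and> A y = x"
      by (intro exI[of _ y']) simp
  qed
  then obtain e where e: "\<And>k. f (e k) = (if k = 0 then 1 else 0)" "e 0 = e0" "\<And>k. A (e (Suc k)) = e k"
    by blast
  show ?thesis using f e0 e by (intro exI[of _ e] exI[of _ f]) simp
qed

text \<open>This transfers a halfspace from the quotient by \<open>N\<close>, represented by an operator \<open>B\<close> on the same space that agrees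
with \<open>A\<close> modulo \<open>N\<close>.\<close>

lemma defect_one_finite_dim_extension:
  assumes A: "operator A" and B: "defect_one B Y" and N: "finite_dim sc N"
    and AN: "\<And>n. n \<in> N \<Longrightarrow> A n \<in> N" and AB: "\<And>x. A x - B x \<in> N"
  shows "defect_one A {x. \<exists>n\<in>N. x - n \<in> Y}"
proof -
  let ?Y = "{x. \<exists>n\<in>N. x - n \<in> Y}"
  obtain C where C: "finite C" "span C = N" using N by (auto simp: finite_dim_def)
  have subN: "subspace N" by (rule subspace_finite_dim[OF N])
  obtain e where e: "\<And>x. x \<in> Y \<Longrightarrow> \<exists>k. B x - sc k e \<in> Y" and half: "halfspace sc Y"
    using B by (auto simp: defect_one_def)
  have Y: "subspace Y" "closed Y" "\<not> finite_dim sc Y" "\<not> finite_codim sc Y"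
    using half by (auto simp: halfspace_def)
  have Y': "closed ?Y" "subspace ?Y" using closed_add_span[OF Y(2,1) C(1)] C(2) by auto
  have "Y \<subseteq> ?Y" using subspace_0[OF subN] by force
  then have "\<not> finite_dim sc ?Y" using finite_dim_subset[OF _ Y(1)] Y(3) by blast
  moreover have "\<not> finite_codim sc ?Y"
  proof
    assume "finite_codim sc ?Y"
    then obtain F where F: "finite F" "\<And>x. \<exists>u\<in>span F. x - u \<in> ?Y" by (auto simp: finite_codim_def)
    have "\<exists>u\<in>span (F \<union> C). x - u \<in> Y" for x
    proof -
      obtain u n where u: "u \<in> span F" "n \<in> N" "x - u - n \<in> Y" using F(2)[of x] by blast
      have "u + n \<in> span (F \<union> C)"
        using u(1,2) C(2) span_mono[of F "F \<union> C"] span_mono[of C "F \<union> C"] by (intro span_add) auto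
      then show ?thesis using u(3) by (intro bexI[of _ "u + n"]) (simp_all add: algebra_simps)
    qed
    then show False using Y(4) F(1) C(1) unfolding finite_codim_def by (metis finite_Un)
  qed
  moreover have "\<exists>k. A x - sc k e \<in> ?Y" if "x \<in> ?Y" for x
  proof -
    from that obtain n where n: "n \<in> N" "x - n \<in> Y" by blast
    then obtain k where k: "B (x - n) - sc k e \<in> Y" using e by blast
    have "A n + (A (x - n) - B (x - n)) \<in> N" by (intro subspace_add[OF subN] AN AB n(1))
    moreover have "A x - sc k e - (A n + (A (x - n) - B (x - n))) = B (x - n) - sc k e"
      by (simp add: operator_simps[OF A])
    ultimately show ?thesis using k by (intro exI[of _ k] CollectI bexI) auto
  qed
  ultimately show ?thesis unfolding defect_one_def halfspace_def using Y' by blast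
qed

section \<open>Isolated spectral points of finite multiplicity\<close>

text \<open>Here \<open>P\<close> projects onto a finite-dimensional subspace that is invariant under \<open>A\<close> and on which \<open>A\<close> is
nilpotent, and the operator induced by \<open>A\<close> on the quotient is invertible: with \<open>Q = id - P\<close>, the operator
\<open>Q A + P\<close> is the compression of \<open>A\<close> to the range of \<open>Q\<close>, completed by the identity on the range of \<open>P\<close>. In other
words, \<open>0\<close> is regular or an isolated spectral point with finite-dimensional spectral subspace. The projection \<open>P\<close>
need not commute with \<open>A\<close>.\<close>

definition finite_riesz_part :: "('a \<Rightarrow> 'a) \<Rightarrow> nat \<Rightarrow> ('a \<Rightarrow> 'a) \<Rightarrow> bool"
  where "finite_riesz_part A p P \<longleftrightarrow> operator P \<and> finite_dim sc {x. (A ^^ p) x = 0} \<and>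
    (\<forall>x. P (P x) = P x) \<and> (\<forall>x. (A ^^ p) (P x) = 0) \<and> (\<forall>x. P (A (P x)) = A (P x)) \<and>
    boundedly_invertible (\<lambda>x. A x - P (A x) + P x)"

lemma nilpotent_shift_surj:
  assumes A: "operator A" and \<mu>: "\<mu> \<noteq> 0"
  shows "(A ^^ p) n = 0 \<Longrightarrow> \<exists>m. A m - \<mu> *\<^sub>R m = n"
proof (induction p arbitrary: n)
  case 0
  then show ?case by (intro exI[of _ 0]) (simp add: operator_simps[OF A])
next
  case (Suc p)
  have "(A ^^ p) ((1 / \<mu>) *\<^sub>R A n) = 0"
    using Suc.prems by (simp add: operator_simps[OF operator_power[OF A]] funpow_swap1)
  then obtain m where m: "A m - \<mu> *\<^sub>R m = (1 / \<mu>) *\<^sub>R A n" using Suc.IH by blast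
  have "A (m - (1 / \<mu>) *\<^sub>R n) - \<mu> *\<^sub>R (m - (1 / \<mu>) *\<^sub>R n) = n"
    using m \<mu> by (simp add: operator_simps[OF A] scaleR_diff_right diff_eq_eq)
  then show ?case by blast
qed

lemma defect_one_shift:
  assumes "defect_one (\<lambda>x. A x - t *\<^sub>R x) Y" shows "defect_one A Y"
proof -
  obtain e where e: "\<And>x. x \<in> Y \<Longrightarrow> \<exists>k. A x - t *\<^sub>R x - sc k e \<in> Y" and half: "halfspace sc Y"
    using assms by (auto simp: defect_one_def)
  have Y: "subspace Y" using half by (simp add: halfspace_def)
  have "\<exists>k. A x - sc k e \<in> Y" if x: "x \<in> Y" for x
  proof -
    obtain k where "A x - t *\<^sub>R x - sc k e \<in> Y" using e[OF x] by blast
    from subspace_add[OF Y this subspace_scale[OF Y x, of "of_real t"]]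
    show ?thesis by (intro exI[of _ k]) (simp add: scaleR_sc)
  qed
  then show ?thesis unfolding defect_one_def using half by blast
qed

end

context reflexive_scalar_banach
begin

text \<open>The equation \<open>(A - \<mu>) x = y\<close> is solved first modulo the range of \<open>P\<close>, where \<open>A\<close> and, for small \<open>\<mu>\<close>, also \<open>A - \<mu>\<close> is
invertible, and then in the range of \<open>P\<close>, where \<open>A\<close> is nilpotent and \<open>\<mu> \<noteq> 0\<close>.\<close>

lemma finite_riesz_part_isolated:
  assumes A: "operator A" and riesz: "finite_riesz_part A p P"
  shows "\<exists>\<delta>>0. \<forall>\<mu>. \<mu> \<noteq> 0 \<longrightarrow> \<bar>\<mu>\<bar> < \<delta> \<longrightarrow> boundedly_invertible (\<lambda>x. A x - \<mu> *\<^sub>R x)"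
proof -
  have P: "operator P" and PP: "\<And>x. P (P x) = P x" and AP: "\<And>x. (A ^^ p) (P x) = 0"
    and PAP: "\<And>x. P (A (P x)) = A (P x)" and inv: "boundedly_invertible (\<lambda>x. A x - P (A x) + P x)"
    using riesz by (auto simp: finite_riesz_part_def)
  note A_simps = operator_simps[OF A] and P_simps = operator_simps[OF P]
  define Q where "Q x = x - P x" for x
  have Q: "operator Q" unfolding Q_def by (intro operator_diff operator_id P)
  note Q_simps = operator_simps[OF Q]
  have PQ: "P (Q x) = 0" and QP: "Q (P x) = 0" for x by (simp_all add: Q_def P_simps PP)
  have QAP: "Q (A (P x)) = 0" for x by (simp add: Q_def PAP)
  have xPQ: "x = Q x + P x" for x by (simp add: Q_def)
  define B where "B x = Q (A x) + P x" for x
  have B_eq: "B = (\<lambda>x. A x - P (A x) + P x)" by (simp add: B_def Q_def fun_eq_iff)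
  have B: "operator B" unfolding B_def by (rule operator_add[OF operator_compose[OF Q A] P])
  obtain \<delta> c where \<delta>: "0 < \<delta>" "0 < c" and surj: "\<And>t. \<bar>t\<bar> < \<delta> \<Longrightarrow> surj (\<lambda>x. B x - t *\<^sub>R Q x)"
    and below: "\<And>t x. \<bar>t\<bar> < \<delta> \<Longrightarrow> norm x \<le> c * norm (B x - t *\<^sub>R Q x)"
    using open_boundedly_invertible[OF operator_bounded_linear[OF B] operator_bounded_linear[OF Q]] inv
    unfolding B_eq by blast
  have "boundedly_invertible (\<lambda>x. A x - \<mu> *\<^sub>R x)" if \<mu>: "\<mu> \<noteq> 0" "\<bar>\<mu>\<bar> < \<delta>" for \<mu>
  proof -
    have QAQ: "Q (A (Q x)) = Q (A x)" for x using QAP[of x] by (simp add: Q_def[of x] A_simps Q_simps)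
    have surjA: "surj (\<lambda>x. A x - \<mu> *\<^sub>R x)"
      unfolding surj_def
    proof
      fix y
      obtain x where "Q y = B x - \<mu> *\<^sub>R Q x" using surj[OF \<mu>(2)] unfolding surj_def by blast
      then have x: "B x - \<mu> *\<^sub>R Q x = Q y" by simp
      have "P (B x - \<mu> *\<^sub>R Q x) = P x" by (simp add: B_def P_simps PP PQ)
      then have Px: "P x = 0" by (simp add: x PQ)
      then have Qx: "Q x = x" by (simp add: Q_def)
      have "Q (A x - \<mu> *\<^sub>R x) = Q y" using x Px Qx by (simp add: B_def Q_simps)
      then have "y - (A x - \<mu> *\<^sub>R x) = P (y - (A x - \<mu> *\<^sub>R x))"
        using xPQ[of "y - (A x - \<mu> *\<^sub>R x)"] by (simp add: Q_simps)
      then have "(A ^^ p) (y - (A x - \<mu> *\<^sub>R x)) = 0" using AP by metis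
      then obtain m where "A m - \<mu> *\<^sub>R m = y - (A x - \<mu> *\<^sub>R x)"
        using nilpotent_shift_surj[OF A \<mu>(1)] by blast
      then have "y = A (x + m) - \<mu> *\<^sub>R (x + m)" by (simp add: A_simps algebra_simps)
      then show "\<exists>x. y = A x - \<mu> *\<^sub>R x" by blast
    qed
    have inj: "x = 0" if x: "A x - \<mu> *\<^sub>R x = 0" for x
    proof -
      have "B (Q x) - \<mu> *\<^sub>R Q (Q x) = Q (A x - \<mu> *\<^sub>R x)"
        by (simp add: B_def QAQ PQ Q_simps) (simp add: Q_def P_simps PP)
      then have "Q x = 0" using below[OF \<mu>(2), of "Q x"] by (simp add: x Q_simps)
      then have "x = P x" by (simp add: Q_def)
      then have "(A ^^ p) x = 0" using AP by metis
      moreover have "(A ^^ k) x = \<mu> ^ k *\<^sub>R x" for k using x by (induction k) (simp_all add: A_simps mult.commute)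
      ultimately show "x = 0" using \<mu>(1) by simp
    qed
    have op: "operator (\<lambda>x. A x - \<mu> *\<^sub>R x)" by (intro operator_diff operator_scaleR A operator_id)
    show ?thesis by (rule bijective_boundedly_invertible[OF op inj surjA])
  qed
  then show ?thesis using \<delta>(1) by blast
qed

text \<open>If the kernels of the powers stabilise at \<open>N = ker (A ^^ p)\<close>, then \<open>A\<close> induces an injective operator on the quotient
by \<open>N\<close>. The operator \<open>B\<close> represents it on the original space, which avoids the quotient.\<close>

lemma defect_one_or_finite_riesz_part:
  assumes A: "operator A" and ninv: "\<not> boundedly_invertible A"
    and lim: "\<tau> \<longlonglongrightarrow> 0" and inv: "\<And>n. boundedly_invertible (\<lambda>x. A x - \<tau> n *\<^sub>R x)"
  shows "(\<exists>Y. defect_one A Y) \<or> (\<exists>p P. finite_riesz_part A p P)"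
proof (cases "finite_dim sc {x. A x = 0}")
  case False
  then show ?thesis using defect_one_infinite_kernel[OF A] by blast
next
  case ker: True
  show ?thesis
  proof (cases "\<forall>p. \<exists>x. (A ^^ Suc p) x = 0 \<and> (A ^^ p) x \<noteq> 0")
    case True
    then obtain e f where "functional f" "e 0 \<noteq> 0" "A (e 0) = 0" "\<And>k :: nat. A (e (Suc k)) = e k"
      "f (e 0) = 1" "\<And>k. f (e (Suc k)) = 0"
      using infinite_chain_exists[OF A ker] by blast
    then show ?thesis using defect_one_infinite_chain[OF A _ _ _ _ _ _ lim inv] by blast
  next
    case False
    then obtain p where stable: "\<And>x. (A ^^ Suc p) x = 0 \<Longrightarrow> (A ^^ p) x = 0" by blast
    define N where "N = {x. (A ^^ p) x = 0}"
    have N: "finite_dim sc N" unfolding N_def by (rule finite_dim_kernel_power[OF A ker])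
    have AN: "A n \<in> N" if "n \<in> N" for n
      using that operator_simps(3)[OF A] by (simp add: N_def funpow_swap1[symmetric])
    obtain C g where g: "\<And>b. b \<in> C \<Longrightarrow> functional (g b)"
      and PC: "\<And>x. (\<Sum>b\<in>C. sc (g b x) b) \<in> N" "\<And>x. x \<in> N \<Longrightarrow> (\<Sum>b\<in>C. sc (g b x) b) = x"
      using finite_dim_projection[OF N] by blast
    define P where "P x = (\<Sum>b\<in>C. sc (g b x) b)" for x
    have P: "operator P" unfolding P_def using g by (intro operator_sum operator_rank_one)
    have PN: "P x \<in> N" and PNid: "x \<in> N \<Longrightarrow> P x = x" for x using PC by (auto simp: P_def)
    have PP: "P (P x) = P x" for x by (rule PNid[OF PN])
    have AP: "(A ^^ p) (P x) = 0" for x using PN by (simp add: N_def)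
    have PAP: "P (A (P x)) = A (P x)" for x by (rule PNid[OF AN[OF PN]])
    note A_simps = operator_simps[OF A] and P_simps = operator_simps[OF P]
    define B where "B = (\<lambda>x. A x - P (A x) + P x)"
    have B: "operator B"
      unfolding B_def by (rule operator_add[OF operator_diff[OF A operator_compose[OF P A]] P])
    have PB: "P (B x) = P x" for x by (simp add: B_def P_simps PP)
    show ?thesis
    proof (cases "boundedly_invertible B")
      case True
      then have "finite_riesz_part A p P"
        unfolding finite_riesz_part_def using P N PP AP PAP by (simp add: N_def B_def)
      then show ?thesis by blast
    next
      case False
      have Binj: "x = 0" if Bx: "B x = 0" for x
      proof -
        have Px: "P x = 0" using PB[of x] by (simp add: Bx P_simps)
        then have "A x = P (A x)" using Bx by (simp add: B_def)
        then have "A x \<in> N" using PN by metis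
        then have "x \<in> N" using stable[of x] by (simp add: N_def funpow_swap1)
        then show ?thesis using PNid[of x] Px by simp
      qed
      have "\<forall>\<^sub>F n in sequentially. dist (\<tau> n) 0 < 1" by (rule tendstoD[OF lim]) simp
      then obtain n0 where n0: "\<And>n. n0 \<le> n \<Longrightarrow> \<bar>\<tau> n\<bar> < 1" by (auto simp: eventually_sequentially)
      have Binv: "boundedly_invertible (\<lambda>x. B x - \<tau> (n + n0) *\<^sub>R x)" for n
      proof -
        define t where "t = \<tau> (n + n0)"
        have t: "t \<noteq> 1" using n0[of "n + n0"] by (auto simp: t_def)
        have opt: "operator (\<lambda>x. A x - t *\<^sub>R x)" by (intro operator_diff operator_scaleR A operator_id)
        obtain R where R: "operator R" "\<And>x. A (R x) - t *\<^sub>R R x = x" "\<And>x. R (A x - t *\<^sub>R x) = x"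
          using bounded_inverse[OF opt] inv[of "n + n0"] unfolding t_def by metis
        note R_simps = operator_simps[OF R(1)]
        have RA: "R (A x) = A (R x)" for x
          using R(2)[of x] R(3)[of x] by (simp add: R_simps) (metis add_diff_cancel diff_add_cancel)
        have "(A ^^ k) (R x) = R ((A ^^ k) x)" for k x by (induction k) (simp_all add: RA)
        then have RN: "R x \<in> N" if "x \<in> N" for x using that by (simp add: N_def R_simps)
        \<comment> \<open>This inverts \<open>B - t\<close>: through \<open>A - t\<close> modulo \<open>N\<close>, and as multiplication by \<open>1 - t\<close> on \<open>N\<close>.\<close>
        define R' where "R' y = (R (y - P y) - P (R (y - P y))) + (1 / (1 - t)) *\<^sub>R P y" for y
        have RQ: "operator (\<lambda>y. R (y - P y))"
          by (rule operator_compose[OF R(1) operator_diff[OF operator_id P]])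
        have opR': "operator R'"
          unfolding R'_def
          by (rule operator_add[OF operator_diff[OF RQ operator_compose[OF P RQ]] operator_scaleR[OF P]])
        have opBt: "operator (\<lambda>x. B x - t *\<^sub>R x)" by (intro operator_diff operator_scaleR B operator_id)
        have "boundedly_invertible (\<lambda>x. B x - t *\<^sub>R x)"
        proof (rule boundedly_invertibleI[OF opBt opR'])
          fix y
          define r where "r = R (y - P y)"
          have Ar: "A r = t *\<^sub>R r + (y - P y)" using R(2)[of "y - P y"] by (simp add: r_def algebra_simps)
          have 1: "B (r - P r) - t *\<^sub>R (r - P r) = y - P y"
            by (simp add: B_def A_simps P_simps PP PAP Ar) (simp add: algebra_simps)
          have 2: "B (P y) - t *\<^sub>R P y = (1 - t) *\<^sub>R P y"
            by (simp add: B_def PAP PP algebra_simps)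
          have "B (R' y) - t *\<^sub>R R' y = (B (r - P r) - t *\<^sub>R (r - P r)) + (1 / (1 - t)) *\<^sub>R (B (P y) - t *\<^sub>R P y)"
            unfolding R'_def r_def[symmetric] by (simp add: operator_simps[OF B] algebra_simps)
          then show "B (R' y) - t *\<^sub>R R' y = y" unfolding 1 2 using t by simp
        next
          fix x assume x: "B x - t *\<^sub>R x = 0"
          have "P (B x - t *\<^sub>R x) = (1 - t) *\<^sub>R P x" by (simp add: P_simps PB algebra_simps)
          then have Px: "P x = 0" using x t by (simp add: P_simps)
          then have "A x - t *\<^sub>R x = P (A x)" using x by (simp add: B_def algebra_simps)
          then have "x = R (P (A x))" using R(3)[of x] by simp
          then have "x \<in> N" using RN[OF PN] by metis
          then show "x = 0" using PNid[of x] Px by simp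
        qed
        then show ?thesis by (simp add: t_def)
      qed
      obtain Y where Y: "defect_one B Y"
        using defect_one_injective[OF B Binj False LIMSEQ_ignore_initial_segment[OF lim, of n0] Binv] by blast
      have "A x - B x \<in> N" for x
        using subspace_diff[OF subspace_finite_dim[OF N] PN PN, of "A x" x] by (simp add: B_def)
      then show ?thesis using defect_one_finite_dim_extension[OF A Y N AN] by blast
    qed
  qed
qed

end

section \<open>The real spectrum\<close>

text \<open>Otherwise the set of limit points would coincide with the interior of \<open>S\<close>, and the real line has no bounded nonempty
clopen subset.\<close>

lemma compact_infinite_boundary_limit_point:
  fixes S :: "real set"
  assumes "compact S" "infinite S"
  obtains x where "x islimpt S" "x \<in> S" "x \<in> closure (- S)"
proof -
  let ?L = "{x. x islimpt S}"
  have closed: "closed S" using assms(1) by (rule compact_imp_closed)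
  have "\<exists>x\<in>S. x islimpt S"
    using assms Heine_Borel_imp_Bolzano_Weierstrass[of S S] by blast
  then have ne: "?L \<noteq> {}" by blast
  have LS: "?L \<subseteq> S" using closed by (auto simp: closed_limpt)
  have "\<not> ?L \<subseteq> interior S"
  proof
    assume "?L \<subseteq> interior S"
    then have "?L = interior S" using interior_limit_point by blast
    then have "open ?L" by simp
    moreover have "closed ?L" by (rule closed_limpts)
    ultimately have "?L = {} \<or> ?L = UNIV" using clopen[of ?L] by blast
    then have "?L = UNIV" using ne by blast
    then have "bounded (UNIV :: real set)"
      using bounded_subset[OF compact_imp_bounded[OF assms(1)] LS] by simp
    then show False using not_bounded_UNIV by blast
  qed
  then obtain x where "x islimpt S" "x \<notin> interior S" by blast
  then show ?thesis using LS that[of x] by (auto simp: closure_complement)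
qed

context reflexive_scalar_banach
begin

text \<open>An infinite \<open>S\<close> has an accumulation point that is a limit of regular values, and a finite Riesz part at this
point would make it isolated.\<close>

theorem defect_one_or_finite_riesz_spectrum:
  assumes T: "operator T"
  defines "S \<equiv> {t. \<not> boundedly_invertible (\<lambda>x. T x - t *\<^sub>R x)}"
  shows "(\<exists>Y. defect_one T Y) \<or>
    finite S \<and> (\<forall>t\<in>S. \<exists>p P. finite_riesz_part (\<lambda>x. T x - t *\<^sub>R x) p P)"
proof (cases "\<exists>Y. defect_one T Y")
  case False
  have opT: "operator (\<lambda>x. T x - t *\<^sub>R x)" for t by (intro operator_diff operator_scaleR T operator_id)
  have riesz: "\<exists>p P. finite_riesz_part (\<lambda>x. T x - t *\<^sub>R x) p P" if t: "t \<in> S" "t \<in> closure (- S)" for t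
  proof -
    obtain s where s: "\<And>n. s n \<notin> S" "s \<longlonglongrightarrow> t" using t(2) by (auto simp: closure_sequential)
    have lim: "(\<lambda>n. s n - t) \<longlonglongrightarrow> 0" using s(2) by (simp add: LIM_zero)
    have "boundedly_invertible (\<lambda>x. (T x - t *\<^sub>R x) - (s n - t) *\<^sub>R x)" for n
      using s(1)[of n] by (simp add: S_def algebra_simps)
    from defect_one_or_finite_riesz_part[OF opT _ lim this]
    show ?thesis using t(1) False defect_one_shift[of T t] by (auto simp: S_def)
  qed
  have near: "\<exists>\<delta>>0. \<forall>r. \<bar>r\<bar> < \<delta> \<longrightarrow> t + r \<notin> S" if "t \<notin> S" for t
  proof -
    have "boundedly_invertible (\<lambda>x. T x - t *\<^sub>R x)" using that by (simp add: S_def)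
    from open_boundedly_invertible[OF operator_bounded_linear[OF opT] bounded_linear_ident this]
    obtain \<delta> c where "0 < \<delta>" "\<And>r. \<bar>r\<bar> < \<delta> \<Longrightarrow> surj (\<lambda>x. T x - t *\<^sub>R x - r *\<^sub>R x)"
      "\<And>r x. \<bar>r\<bar> < \<delta> \<Longrightarrow> norm x \<le> c * norm (T x - t *\<^sub>R x - r *\<^sub>R x)" by blast
    then have "boundedly_invertible (\<lambda>x. T x - t *\<^sub>R x - r *\<^sub>R x)" if "\<bar>r\<bar> < \<delta>" for r
      unfolding boundedly_invertible_def using that by blast
    then have "t + r \<notin> S" if "\<bar>r\<bar> < \<delta>" for r using that by (simp add: S_def scaleR_add_left diff_diff_eq)
    then show ?thesis using \<open>0 < \<delta>\<close> by blast
  qed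
  have "closed S"
  proof -
    have "open (- S)"
      unfolding open_dist
    proof
      fix t assume "t \<in> - S"
      then obtain \<delta> where \<delta>: "0 < \<delta>" "\<And>r. \<bar>r\<bar> < \<delta> \<Longrightarrow> t + r \<notin> S" using near[of t] by auto
      have "y \<in> - S" if "dist y t < \<delta>" for y using \<delta>(2)[of "y - t"] that by (simp add: dist_real_def)
      then show "\<exists>e>0. \<forall>y. dist y t < e \<longrightarrow> y \<in> - S" using \<delta>(1) by blast
    qed
    then show ?thesis by (simp add: closed_def)
  qed
  moreover have "bounded S"
  proof -
    have id: "boundedly_invertible (\<lambda>x::'a. x)"
      unfolding boundedly_invertible_def by (auto intro: exI[of _ 1])
    obtain \<delta> c where \<delta>: "0 < \<delta>" "\<And>r. \<bar>r\<bar> < \<delta> \<Longrightarrow> surj (\<lambda>x. x - r *\<^sub>R T x)"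
      and c: "\<And>r x. \<bar>r\<bar> < \<delta> \<Longrightarrow> norm x \<le> c * norm (x - r *\<^sub>R T x)"
      using open_boundedly_invertible[OF bounded_linear_ident operator_bounded_linear[OF T] id] by blast
    have "\<bar>t\<bar> \<le> 1 / \<delta>" if "t \<in> S" for t
    proof (rule ccontr)
      assume "\<not> ?thesis"
      then have big: "1 / \<delta> < \<bar>t\<bar>" by simp
      then have t0: "t \<noteq> 0" using \<delta>(1) by auto
      have r: "\<bar>1 / t\<bar> < \<delta>" using big \<delta>(1) t0 by (simp add: field_simps)
      have eq: "T x - t *\<^sub>R x = (- t) *\<^sub>R (x - (1 / t) *\<^sub>R T x)" for x
        using t0 by (simp add: algebra_simps)
      have "\<exists>x. y = T x - t *\<^sub>R x" for y
      proof -
        obtain x where x: "(- 1 / t) *\<^sub>R y = x - (1 / t) *\<^sub>R T x"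
          using \<delta>(2)[OF r] unfolding surj_def by blast
        have "y = T x - t *\<^sub>R x" unfolding eq x[symmetric] using t0 by simp
        then show ?thesis by blast
      qed
      then have "surj (\<lambda>x. T x - t *\<^sub>R x)" by (simp add: surj_def)
      moreover have "norm x \<le> (c / \<bar>t\<bar>) * norm (T x - t *\<^sub>R x)" for x
        using c[OF r, of x] t0 unfolding eq by simp
      ultimately show False using \<open>t \<in> S\<close> unfolding S_def boundedly_invertible_def by blast
    qed
    then show ?thesis unfolding bounded_iff by auto
  qed
  ultimately have compact: "compact S" by (simp add: compact_eq_bounded_closed)
  have fin: "finite S"
  proof (rule ccontr)
    assume "infinite S"
    then obtain t where t: "t islimpt S" "t \<in> S" "t \<in> closure (- S)"
      using compact_infinite_boundary_limit_point[OF compact] by blast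
    obtain p P where "finite_riesz_part (\<lambda>x. T x - t *\<^sub>R x) p P" using riesz[OF t(2,3)] by blast
    from finite_riesz_part_isolated[OF opT this]
    obtain \<delta> where \<delta>: "0 < \<delta>"
      "\<And>\<mu>. \<mu> \<noteq> 0 \<Longrightarrow> \<bar>\<mu>\<bar> < \<delta> \<Longrightarrow> boundedly_invertible (\<lambda>x. T x - t *\<^sub>R x - \<mu> *\<^sub>R x)" by blast
    obtain s where s: "s \<in> S" "s \<noteq> t" "dist s t < \<delta>" using t(1) \<delta>(1) by (auto simp: islimpt_approachable)
    have "boundedly_invertible (\<lambda>x. T x - t *\<^sub>R x - (s - t) *\<^sub>R x)"
      using s by (intro \<delta>(2)) (auto simp: dist_real_def)
    then show False using s(1) by (simp add: S_def algebra_simps)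
  qed
  have "t \<in> closure (- S)" if "t \<in> S" for t
    using fin islimpt_finite[OF fin] that
    by (metis (no_types) Compl_iff closure_complement empty_iff interior_limit_point)
  then show ?thesis using fin riesz by blast
qed simp

end

section \<open>Real spaces as instances\<close>

lemma scalar_banach_real: "scalar_banach ((*\<^sub>R) :: real \<Rightarrow> 'a::banach \<Rightarrow> 'a)"
proof
  fix F :: "'a set" and c :: real and u
  assume F: "module.subspace (*\<^sub>R) F" and c: "0 < c" "\<And>y. y \<in> F \<Longrightarrow> c \<le> norm (u - y)"
  have "subspace F" using F by (simp add: subspace_raw_def)
  from hahn_banach_separation[OF this c]
  obtain h where h: "bounded_linear h" "\<forall>x\<in>F. h x = 0" "h u = (1::real)" "\<forall>x. \<bar>h x\<bar> \<le> norm x / c" by blast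
  then show "\<exists>h. bounded_linear h \<and> (\<forall>a x. h (a *\<^sub>R x) = a * h x) \<and> (\<forall>x\<in>F. h x = 0) \<and> h u = 1 \<and>
      (\<forall>x. norm (h x) \<le> norm x / c)"
    by (intro exI[of _ h]) (simp add: linear_simps)
qed (simp_all add: algebra_simps)

lemma functionals_separate_points:
  fixes x :: "'a::real_normed_vector"
  assumes "\<And>g :: 'a \<Rightarrow>\<^sub>L real. blinfun_apply g x = 0" shows "x = 0"
proof (rule ccontr)
  assume "x \<noteq> 0"
  then have "\<exists>h. bounded_linear h \<and> (\<forall>y\<in>{0}. h y = 0) \<and> h x = (1::real) \<and> (\<forall>y. \<bar>h y\<bar> \<le> norm y / norm x)"
    by (intro hahn_banach_separation) (auto simp: subspace_def)
  then obtain h where "bounded_linear h" "h x = (1::real)" by blast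
  then show False using assms[of "Blinfun h"] by (simp add: bounded_linear_Blinfun_apply)
qed

text \<open>A functional on the dual that vanishes on all \<open>\<psi> \<circ> A\<close> is the evaluation at some \<open>y\<close> with \<open>A y = 0\<close>, and is zero if \<open>A\<close>
is injective.\<close>

lemma reflexive_adjoint_dense:
  fixes A :: "'a::real_normed_vector \<Rightarrow> 'a" and g :: "'a \<Rightarrow>\<^sub>L real"
  assumes refl: "reflexive_space TYPE('a)" and A: "bounded_linear A" and inj: "\<And>x. A x = 0 \<Longrightarrow> x = 0"
    and \<epsilon>: "0 < \<epsilon>"
  shows "\<exists>\<psi>. norm (g - (\<psi> o\<^sub>L Blinfun A)) < \<epsilon>"
proof (rule ccontr)
  assume "\<not> ?thesis"
  then have far: "\<epsilon> \<le> norm (g - (\<psi> o\<^sub>L Blinfun A))" for \<psi> by (meson not_le_imp_less)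
  let ?W = "range (\<lambda>\<psi> :: 'a \<Rightarrow>\<^sub>L real. \<psi> o\<^sub>L Blinfun A)"
  have W: "subspace ?W"
    unfolding subspace_def
  proof (intro conjI ballI allI)
    show "0 \<in> ?W" by (rule range_eqI[of _ _ 0]) simp
    show "x + y \<in> ?W" if xy: "x \<in> ?W" "y \<in> ?W" for x y
    proof -
      obtain a b where "x = a o\<^sub>L Blinfun A" "y = b o\<^sub>L Blinfun A" using xy by blast
      then show ?thesis
        by (intro range_eqI[of _ _ "a + b"]) (auto intro: blinfun_eqI simp: blinfun.add_left)
    qed
    show "c *\<^sub>R x \<in> ?W" if x: "x \<in> ?W" for c x
    proof -
      obtain a where "x = a o\<^sub>L Blinfun A" using x by blast
      then show ?thesis
        by (intro range_eqI[of _ _ "c *\<^sub>R a"]) (auto intro: blinfun_eqI simp: blinfun.scaleR_left)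
    qed
  qed
  have "\<exists>\<Phi>. bounded_linear \<Phi> \<and> (\<forall>w\<in>?W. \<Phi> w = 0) \<and> \<Phi> g = (1 :: real) \<and> (\<forall>f. \<bar>\<Phi> f\<bar> \<le> norm f / \<epsilon>)"
    by (rule hahn_banach_separation[OF W \<epsilon>]) (use far in auto)
  then obtain \<Phi> where \<Phi>: "bounded_linear \<Phi>" "\<And>w. w \<in> ?W \<Longrightarrow> \<Phi> w = 0" "\<Phi> g = (1 :: real)" by blast
  obtain y :: 'a where y: "bidual_embedding y = Blinfun \<Phi>"
    using refl unfolding reflexive_space_def by (metis surjD)
  have y_apply: "blinfun_apply f y = \<Phi> f" for f
    using bidual_embedding_apply[of y f] by (simp add: y bounded_linear_Blinfun_apply \<Phi>(1))
  have "blinfun_apply \<psi> (A y) = 0" for \<psi> :: "'a \<Rightarrow>\<^sub>L real"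
    using y_apply[of "\<psi> o\<^sub>L Blinfun A"] \<Phi>(2)[of "\<psi> o\<^sub>L Blinfun A"]
    by (simp add: bounded_linear_Blinfun_apply A)
  then have "y = 0" using inj[OF functionals_separate_points] by blast
  then show False using y_apply[of g] \<Phi>(3) by simp
qed

text \<open>The scalar sequences converge for the functionals \<open>\<psi> \<circ> A\<close> and hence, by density and boundedness, for all functionals. Their limits
form an element of the bidual.\<close>

lemma reflexive_weak_limit:
  fixes A :: "'a::real_normed_vector \<Rightarrow> 'a" and h :: "nat \<Rightarrow> 'a"
  assumes refl: "reflexive_space TYPE('a)" and A: "bounded_linear A" and inj: "\<And>x. A x = 0 \<Longrightarrow> x = 0"
    and bd: "\<And>n. norm (h n) \<le> K" and lim: "(\<lambda>n. A (h n)) \<longlonglongrightarrow> z"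
  shows "\<exists>y. A y = z \<and> (\<forall>g. bounded_linear g \<longrightarrow> (\<lambda>n. g (h n)) \<longlonglongrightarrow> (g y :: real))"
proof -
  have K: "0 \<le> K" using order_trans[OF norm_ge_zero bd] .
  have "Cauchy (\<lambda>n. blinfun_apply g (h n))" for g :: "'a \<Rightarrow>\<^sub>L real"
  proof (rule CauchyI)
    fix \<epsilon> :: real assume \<epsilon>: "0 < \<epsilon>"
    define \<delta> where "\<delta> = \<epsilon> / (4 * (K + 1))"
    have \<delta>: "0 < \<delta>" "\<delta> * K \<le> \<epsilon> / 4" using \<epsilon> K by (auto simp: \<delta>_def field_simps)
    obtain \<psi> where \<psi>: "norm (g - (\<psi> o\<^sub>L Blinfun A)) < \<delta>"
      using reflexive_adjoint_dense[OF refl A inj \<delta>(1)] by blast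
    have close: "\<bar>blinfun_apply g (h n) - blinfun_apply \<psi> (A (h n))\<bar> \<le> \<epsilon> / 4" for n
    proof -
      have "\<bar>blinfun_apply (g - (\<psi> o\<^sub>L Blinfun A)) (h n)\<bar> \<le> norm (g - (\<psi> o\<^sub>L Blinfun A)) * norm (h n)"
        using norm_blinfun[of "g - (\<psi> o\<^sub>L Blinfun A)" "h n"] by simp
      also have "\<dots> \<le> \<delta> * K" using \<psi> bd[of n] \<delta>(1) by (intro mult_mono) auto
      finally show ?thesis
        using \<delta>(2) by (simp add: blinfun.diff_left bounded_linear_Blinfun_apply A)
    qed
    have "(\<lambda>n. blinfun_apply \<psi> (A (h n))) \<longlonglongrightarrow> blinfun_apply \<psi> z"
      by (intro tendsto_intros lim)
    then have "Cauchy (\<lambda>n. blinfun_apply \<psi> (A (h n)))" by (rule LIMSEQ_imp_Cauchy)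
    then obtain M where M: "\<And>m n. M \<le> m \<Longrightarrow> M \<le> n \<Longrightarrow>
        norm (blinfun_apply \<psi> (A (h m)) - blinfun_apply \<psi> (A (h n))) < \<epsilon> / 2"
      using CauchyD[of _ "\<epsilon> / 2"] \<epsilon> by fastforce
    have "norm (blinfun_apply g (h m) - blinfun_apply g (h n)) < \<epsilon>" if "M \<le> m" "M \<le> n" for m n
      using M[OF that] close[of m] close[of n] \<epsilon> unfolding real_norm_def by linarith
    then show "\<exists>M. \<forall>m\<ge>M. \<forall>n\<ge>M. norm (blinfun_apply g (h m) - blinfun_apply g (h n)) < \<epsilon>" by blast
  qed
  then have "\<exists>\<Phi>. \<forall>g :: 'a \<Rightarrow>\<^sub>L real. (\<lambda>n. blinfun_apply g (h n)) \<longlonglongrightarrow> \<Phi> g"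
    using Cauchy_convergent by (intro choice allI) (auto simp: convergent_def)
  then obtain \<Phi> where \<Phi>: "\<And>g :: 'a \<Rightarrow>\<^sub>L real. (\<lambda>n. blinfun_apply g (h n)) \<longlonglongrightarrow> \<Phi> g" by blast
  have "bounded_linear \<Phi>"
  proof (rule bounded_linear_intro[where K = K])
    show "\<Phi> (f + g) = \<Phi> f + \<Phi> g" for f g
      using LIMSEQ_unique[OF \<Phi>[of "f + g"]] tendsto_add[OF \<Phi>[of f] \<Phi>[of g]]
      by (simp add: blinfun.add_left)
    show "\<Phi> (r *\<^sub>R g) = r *\<^sub>R \<Phi> g" for r g
      using LIMSEQ_unique[OF \<Phi>[of "r *\<^sub>R g"]] tendsto_mult_left[OF \<Phi>[of g], of r]
      by (simp add: blinfun.scaleR_left)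
    show "norm (\<Phi> g) \<le> norm g * K" for g
    proof (rule LIMSEQ_le_const2[OF tendsto_norm[OF \<Phi>[of g]]])
      have "norm (blinfun_apply g (h n)) \<le> norm g * K" for n
        by (rule order_trans[OF norm_blinfun mult_left_mono[OF bd]]) simp
      then show "\<exists>N. \<forall>n\<ge>N. norm (blinfun_apply g (h n)) \<le> norm g * K" by blast
    qed
  qed
  moreover obtain y :: 'a where y: "bidual_embedding y = Blinfun \<Phi>"
    using refl unfolding reflexive_space_def by (metis surjD)
  ultimately have "blinfun_apply g y = \<Phi> g" for g
    using bidual_embedding_apply[of y g] by (simp add: y bounded_linear_Blinfun_apply)
  then have conv: "(\<lambda>n. blinfun_apply g (h n)) \<longlonglongrightarrow> blinfun_apply g y" for g :: "'a \<Rightarrow>\<^sub>L real"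
    using \<Phi> by simp
  have "blinfun_apply \<psi> (A y - z) = 0" for \<psi> :: "'a \<Rightarrow>\<^sub>L real"
  proof -
    have "(\<lambda>n. blinfun_apply \<psi> (A (h n))) \<longlonglongrightarrow> blinfun_apply \<psi> (A y)"
      using conv[of "\<psi> o\<^sub>L Blinfun A"] by (simp add: bounded_linear_Blinfun_apply A)
    moreover have "(\<lambda>n. blinfun_apply \<psi> (A (h n))) \<longlonglongrightarrow> blinfun_apply \<psi> z"
      by (intro tendsto_intros lim)
    ultimately show ?thesis using LIMSEQ_unique by (auto simp: blinfun.diff_right)
  qed
  then have "A y = z" using functionals_separate_points[of "A y - z"] by simp
  moreover have "(\<lambda>n. g (h n)) \<longlonglongrightarrow> g y" if "bounded_linear g" for g :: "'a \<Rightarrow> real"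
    using conv[of "Blinfun g"] by (simp add: bounded_linear_Blinfun_apply that)
  ultimately show ?thesis by blast
qed

lemma reflexive_scalar_banach_real:
  assumes "reflexive_space TYPE('a::banach)"
  shows "reflexive_scalar_banach ((*\<^sub>R) :: real \<Rightarrow> 'a \<Rightarrow> 'a)"
proof (intro reflexive_scalar_banach.intro reflexive_scalar_banach_axioms.intro scalar_banach_real)
  fix A :: "'a \<Rightarrow> 'a" and h :: "nat \<Rightarrow> 'a" and z K
  assume A: "bounded_linear A" "\<And>x. A x = 0 \<Longrightarrow> x = 0" "\<And>n. norm (h n) \<le> K" "(\<lambda>n. A (h n)) \<longlonglongrightarrow> z"
  show "\<exists>y. A y = z \<and> (\<forall>g. bounded_linear g \<and> (\<forall>c x. g (c *\<^sub>R x) = c * g x) \<longrightarrow> (\<lambda>n. g (h n)) \<longlonglongrightarrow> (g y :: real))"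
  proof -
    have "\<exists>y. A y = z \<and> (\<forall>g. bounded_linear g \<longrightarrow> (\<lambda>n. g (h n)) \<longlonglongrightarrow> (g y :: real))"
      by (rule reflexive_weak_limit[OF assms A(1) _ A(3,4)]) (rule A(2))
    then obtain y where "A y = z" "\<forall>g. bounded_linear g \<longrightarrow> (\<lambda>n. g (h n)) \<longlonglongrightarrow> (g y :: real)"
      by (elim exE conjE)
    then show ?thesis by (intro exI[of _ y]) simp
  qed
qed

section \<open>Complex spaces as instances\<close>

lemma bounded_linear_scaleC: "bounded_linear (\<lambda>x :: 'b::complex_normed_vector. c *\<^sub>C x)"
  by (rule bounded_linear_intro[where K = "cmod c"])
    (simp_all add: scaleC_add_right scaleR_scaleC scaleC_scaleC mult.commute norm_scaleC)

text \<open>A complex functional is determined by its real part \<open>f\<close> through \<open>x \<mapsto> f x - \<i> f (\<i> x)\<close>.\<close>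

lemma bounded_clinear_complexified_functional:
  fixes f :: "'b::complex_normed_vector \<Rightarrow> real"
  assumes f: "bounded_linear f"
  shows "bounded_clinear (\<lambda>x. Complex (f x) (- f (\<i> *\<^sub>C x)))" (is "bounded_clinear ?g")
proof -
  have fi: "bounded_linear (\<lambda>x. f (\<i> *\<^sub>C x))" by (rule bounded_linear_compose[OF f bounded_linear_scaleC])
  have "bounded_linear (\<lambda>x. complex_of_real (f x) - complex_of_real (f (\<i> *\<^sub>C x)) * \<i>)"
    by (rule bounded_linear_sub[OF bounded_linear_compose[OF bounded_linear_of_real f]
          bounded_linear_mult_const[OF bounded_linear_compose[OF bounded_linear_of_real fi]]])
  then have "bounded_linear ?g" by (simp add: Complex_eq mult.commute)
  moreover have "?g (c *\<^sub>C x) = c *\<^sub>C ?g x" for c x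
  proof -
    have cx: "c *\<^sub>C x = Re c *\<^sub>R x + Im c *\<^sub>R (\<i> *\<^sub>C x)"
      using complex_eq[of c] by (metis mult.commute scaleC_add_left scaleC_scaleC scaleR_scaleC)
    have icx: "\<i> *\<^sub>C c *\<^sub>C x = Re c *\<^sub>R (\<i> *\<^sub>C x) - Im c *\<^sub>R x"
    proof -
      have "\<i> * c = complex_of_real (Re c) * \<i> + complex_of_real (- Im c)"
        by (simp add: complex_eq_iff)
      then show ?thesis
        by (simp add: scaleC_scaleC complex_vector.scale_left_diff_distrib scaleR_scaleC)
    qed
    show ?thesis
      unfolding icx by (simp add: cx linear_simps[OF f] scaleC_complex_def complex_eq_iff)
  qed
  ultimately show ?thesis by (simp add: bounded_clinear_def)
qed

lemma scalar_banach_complex: "scalar_banach ((*\<^sub>C) :: complex \<Rightarrow> 'b::complex_banach \<Rightarrow> 'b)"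
proof
  show "norm (c *\<^sub>C x) = norm c * norm x" for c and x :: 'b by (rule norm_scaleC)
  show "r *\<^sub>R x = of_real r *\<^sub>C x" for r and x :: 'b by (rule scaleR_scaleC)
  fix F :: "'b set" and c :: real and u
  assume F: "complex_vector.subspace F" and c: "0 < c" "\<And>y. y \<in> F \<Longrightarrow> c \<le> norm (u - y)"
  have "subspace F"
    using F by (auto simp: subspace_def complex_vector.subspace_def scaleR_scaleC)
  from hahn_banach_separation[OF this c]
  obtain f where f: "bounded_linear f" "\<forall>x\<in>F. f x = 0" "f u = (1::real)" "\<And>x. \<bar>f x\<bar> \<le> norm x / c" by blast
  define g where "g x = Complex (f x) (- f (\<i> *\<^sub>C x))" for x
  have "bounded_clinear g" unfolding g_def by (rule bounded_clinear_complexified_functional[OF f(1)])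
  then have g: "bounded_linear g" "\<And>c x. g (c *\<^sub>C x) = c * g x"
    by (auto simp: bounded_clinear_def scaleC_complex_def)
  have bound: "cmod (g x) \<le> norm x / c" for x
  proof (cases "g x = 0")
    case False
    \<comment> \<open>The rotation by \<open>s\<close> makes the value real, so that the bound for the real part applies.\<close>
    define s where "s = cnj (g x) / cmod (g x)"
    have s: "cmod s = 1" using False by (simp add: s_def norm_divide)
    have "g (s *\<^sub>C x) = complex_of_real (cmod (g x))"
      using False complex_norm_square[of "g x"]
      by (simp add: g(2) s_def power2_eq_square divide_eq_eq mult.commute)
    then have "cmod (g x) = f (s *\<^sub>C x)" by (simp add: g_def complex_eq_iff)
    also have "\<dots> \<le> norm (s *\<^sub>C x) / c" using f(4)[of "s *\<^sub>C x"] by simp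
    finally show ?thesis using s by (simp add: norm_scaleC)
  qed (use c(1) in simp)
  have gu: "g u \<noteq> 0" "1 \<le> cmod (g u)"
    using f(3) abs_Re_le_cmod[of "g u"] by (auto simp: g_def complex_eq_iff)
  define h where "h x = g x / g u" for x
  have "bounded_linear h"
    unfolding h_def divide_inverse by (rule bounded_linear_mult_const[OF g(1)])
  moreover have "h x = 0" if "x \<in> F" for x
  proof -
    have "g x = 0"
      using f(2) that complex_vector.subspace_scale[OF F that, of \<i>] by (simp add: g_def complex_eq_iff)
    then show ?thesis by (simp add: h_def)
  qed
  moreover have "norm (h x) \<le> norm x / c" for x
  proof -
    have "norm (h x) \<le> cmod (g x) / 1"
      unfolding h_def norm_divide using gu(2) by (intro divide_left_mono) auto
    then show ?thesis using bound[of x] by simp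
  qed
  ultimately show "\<exists>h. bounded_linear h \<and> (\<forall>a x. h (a *\<^sub>C x) = a * h x) \<and> (\<forall>x\<in>F. h x = 0) \<and> h u = 1 \<and>
      (\<forall>x. norm (h x) \<le> norm x / c)"
    using gu(1) by (intro exI[of _ h]) (simp add: h_def g(2))
qed

text \<open>Passing to real parts identifies the complex dual with the real one. A real functional on the latter is the real part of a
complex functional on the former, and therefore an evaluation.\<close>

lemma creflexive_imp_reflexive:
  assumes refl: "creflexive_space TYPE('b::complex_normed_vector)"
  shows "reflexive_space TYPE('b)"
  unfolding reflexive_space_def surj_def
proof
  fix \<Phi> :: "('b \<Rightarrow>\<^sub>L real) \<Rightarrow>\<^sub>L real"
  define rp where "rp g = Blinfun (\<lambda>x. Re (cblinfun_apply g x))" for g :: "'b \<Rightarrow>\<^sub>C\<^sub>L complex"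
  have bl: "bounded_linear (cblinfun_apply g)" for g :: "'b \<Rightarrow>\<^sub>C\<^sub>L complex"
    using cblinfun_apply[of g] by (simp add: bounded_clinear_def)
  have rp: "blinfun_apply (rp g) x = Re (cblinfun_apply g x)" for g x
    unfolding rp_def
    by (rule bounded_linear_Blinfun_apply[THEN fun_cong])
      (rule bounded_linear_compose[OF bounded_linear_Re bl])
  have rp_add: "rp (f + g) = rp f + rp g" for f g
    by (rule blinfun_eqI) (simp add: rp plus_cblinfun.rep_eq blinfun.add_left)
  have rp_scale: "rp (c *\<^sub>C g) = Re c *\<^sub>R rp g + Im c *\<^sub>R rp (\<i> *\<^sub>C g)" for c g
    by (rule blinfun_eqI)
      (simp add: rp scaleC_cblinfun.rep_eq blinfun.add_left blinfun.scaleR_left scaleC_complex_def)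
  have rp_norm: "norm (rp g) \<le> norm g" for g
  proof (rule norm_blinfun_bound)
    have "norm (cblinfun_apply g x) \<le> norm g * norm x" for x
      using onorm[OF bl[of g], of x] by (simp add: norm_cblinfun.rep_eq)
    then show "norm (blinfun_apply (rp g) x) \<le> norm g * norm x" for x
      unfolding rp using abs_Re_le_cmod order_trans by (metis real_norm_def)
  qed (rule norm_ge_zero)
  define \<Psi> where "\<Psi> g = Complex (blinfun_apply \<Phi> (rp g)) (- blinfun_apply \<Phi> (rp (\<i> *\<^sub>C g)))" for g
  have \<Psi>_add: "\<Psi> (f + g) = \<Psi> f + \<Psi> g" for f g
    by (simp add: \<Psi>_def rp_add scaleC_add_right blinfun.add_right complex_eq_iff)
  have \<Psi>_scale: "\<Psi> (c *\<^sub>C g) = c * \<Psi> g" for c g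
  proof -
    have "rp (\<i> *\<^sub>C c *\<^sub>C g) = Re c *\<^sub>R rp (\<i> *\<^sub>C g) - Im c *\<^sub>R rp g"
      unfolding scaleC_scaleC rp_scale[of "\<i> * c"] by simp
    then show ?thesis
      by (simp add: \<Psi>_def rp_scale[of c g] blinfun.bilinear_simps complex_eq_iff)
  qed
  have "bounded_linear \<Psi>"
  proof (rule bounded_linear_intro[OF \<Psi>_add])
    show "\<Psi> (r *\<^sub>R g) = r *\<^sub>R \<Psi> g" for r g
      by (simp add: scaleR_scaleC \<Psi>_scale scaleC_complex_def)
    show "norm (\<Psi> g) \<le> norm g * (2 * norm \<Phi>)" for g
    proof -
      have b: "\<bar>blinfun_apply \<Phi> (rp f)\<bar> \<le> norm \<Phi> * norm f" for f
        using order_trans[OF norm_blinfun[of \<Phi> "rp f"] mult_left_mono[OF rp_norm[of f]]] by simp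
      have "norm (\<Psi> g) \<le> \<bar>blinfun_apply \<Phi> (rp g)\<bar> + \<bar>blinfun_apply \<Phi> (rp (\<i> *\<^sub>C g))\<bar>"
        using cmod_le[of "\<Psi> g"] by (simp add: \<Psi>_def)
      also have "\<dots> \<le> norm \<Phi> * norm g + norm \<Phi> * norm g"
        using b[of "\<i> *\<^sub>C g"] by (intro add_mono b) (simp add: norm_scaleC)
      finally show ?thesis by (simp add: mult_ac)
    qed
  qed
  then have "bounded_clinear \<Psi>" by (simp add: bounded_clinear_def \<Psi>_scale scaleC_complex_def)
  then have \<Psi>: "cblinfun_apply (CBlinfun \<Psi>) = \<Psi>" by (simp add: CBlinfun_inverse)
  obtain y :: 'b where "cbidual_embedding y = CBlinfun \<Psi>"
    using refl unfolding creflexive_space_def by (metis surjD)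
  then have y: "cblinfun_apply g y = \<Psi> g" for g
    using \<Psi> cbidual_embedding.rep_eq[of y] by metis
  have "bidual_embedding y = \<Phi>"
  proof (rule blinfun_eqI)
    fix f :: "'b \<Rightarrow>\<^sub>L real"
    define g where "g = CBlinfun (\<lambda>x. Complex (blinfun_apply f x) (- blinfun_apply f (\<i> *\<^sub>C x)))"
    have g: "cblinfun_apply g x = Complex (blinfun_apply f x) (- blinfun_apply f (\<i> *\<^sub>C x))" for x
      unfolding g_def using bounded_clinear_complexified_functional[OF blinfun.bounded_linear_right[of f]]
      by (simp add: CBlinfun_inverse)
    have "rp g = f" by (rule blinfun_eqI) (simp add: rp g)
    then show "blinfun_apply (bidual_embedding y) f = blinfun_apply \<Phi> f"
      using arg_cong[OF y[of g], of Re] by (simp add: bidual_embedding_apply g \<Psi>_def)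
  qed
  then show "\<exists>x. \<Phi> = bidual_embedding x" by blast
qed

lemma reflexive_scalar_banach_complex:
  assumes "creflexive_space TYPE('b::complex_banach)"
  shows "reflexive_scalar_banach ((*\<^sub>C) :: complex \<Rightarrow> 'b \<Rightarrow> 'b)"
proof (intro reflexive_scalar_banach.intro reflexive_scalar_banach_axioms.intro scalar_banach_complex)
  fix A :: "'b \<Rightarrow> 'b" and h :: "nat \<Rightarrow> 'b" and z K
  assume A: "bounded_linear A" "\<And>x. A x = 0 \<Longrightarrow> x = 0" "\<And>n. norm (h n) \<le> K" "(\<lambda>n. A (h n)) \<longlonglongrightarrow> z"
  have "\<exists>y. A y = z \<and> (\<forall>g. bounded_linear g \<longrightarrow> (\<lambda>n. g (h n)) \<longlonglongrightarrow> (g y :: real))"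
    by (rule reflexive_weak_limit[OF creflexive_imp_reflexive[OF assms] A(1) _ A(3,4)]) (rule A(2))
  then obtain y where y: "A y = z" "\<forall>g. bounded_linear g \<longrightarrow> (\<lambda>n. g (h n)) \<longlonglongrightarrow> (g y :: real)"
    by (elim exE conjE)
  have "(\<lambda>n. g (h n)) \<longlonglongrightarrow> g y" if "bounded_linear g" for g :: "'b \<Rightarrow> complex"
    unfolding tendsto_complex_iff
    using y(2)[rule_format, OF bounded_linear_compose[OF bounded_linear_Re that]]
      y(2)[rule_format, OF bounded_linear_compose[OF bounded_linear_Im that]] by simp
  then show "\<exists>y. A y = z \<and> (\<forall>g. bounded_linear g \<and> (\<forall>c x. g (c *\<^sub>C x) = c * g x) \<longrightarrow> (\<lambda>n. g (h n)) \<longlonglongrightarrow> g y)"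
    using y(1) by (intro exI[of _ y]) simp
qed

section \<open>Finite real spectrum\<close>

text \<open>The part of \<open>finite_riesz_part\<close> that carries over to the complexification; of the invertibility only the lower bound is kept.\<close>

definition riesz_projection_bound ::
  "('b::real_normed_vector \<Rightarrow> 'b) \<Rightarrow> nat \<Rightarrow> ('b \<Rightarrow> 'b) \<Rightarrow> real \<Rightarrow> bool"
  where "riesz_projection_bound A p P c \<longleftrightarrow> (\<forall>x. P (P x) = P x) \<and> (\<forall>x. (A ^^ p) (P x) = 0) \<and>
    (\<forall>x. P (A (P x)) = A (P x)) \<and> 0 < c \<and> (\<forall>x. norm x \<le> c * norm (A x - P (A x) + P x))"

primrec shifted_product :: "('a::real_vector \<Rightarrow> 'a) \<Rightarrow> (real \<Rightarrow> nat) \<Rightarrow> real list \<Rightarrow> 'a \<Rightarrow> 'a" where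
  "shifted_product T p [] x = x"
| "shifted_product T p (t # ts) x = ((\<lambda>y. T y - t *\<^sub>R y) ^^ p t) (shifted_product T p ts x)"

context scalar_banach
begin

lemma finite_dim_shifted_product_vimage:
  assumes T: "operator T" and ker: "\<And>t. t \<in> set ts \<Longrightarrow> finite_dim sc {x. ((\<lambda>y. T y - t *\<^sub>R y) ^^ p t) x = 0}"
    and V: "finite_dim sc V"
  shows "finite_dim sc {x. shifted_product T p ts x \<in> V}"
  using ker V
proof (induction ts arbitrary: V)
  case (Cons t ts)
  have op: "operator ((\<lambda>y. T y - t *\<^sub>R y) ^^ p t)"
    by (intro operator_power operator_diff operator_scaleR operator_id T)
  have "finite_dim sc {x. ((\<lambda>y. T y - t *\<^sub>R y) ^^ p t) x \<in> V}"
    by (rule finite_dim_vimage[OF op]) (use Cons.prems in auto)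
  from Cons.IH[OF _ this] show ?case using Cons.prems(1) by simp
qed simp

end

text \<open>The list \<open>ts\<close> enumerates the finite real spectrum. The product of the powers has a finite-dimensional kernel because
each factor does.\<close>

theorem (in reflexive_scalar_banach) defect_one_or_finite_dim_kernel:
  assumes T: "operator T"
  defines "S \<equiv> {t. \<not> boundedly_invertible (\<lambda>x. T x - t *\<^sub>R x)}"
  shows "(\<exists>Y. defect_one T Y) \<or> (\<exists>p ts. set ts = S \<and>
    (\<forall>t\<in>S. \<exists>P c. operator P \<and> riesz_projection_bound (\<lambda>x. T x - t *\<^sub>R x) (p t) P c) \<and>
    finite_dim sc {x. shifted_product T p ts x = 0})"
proof (cases "\<exists>Y. defect_one T Y")
  case False
  then have fin: "finite S" and riesz: "\<And>t. t \<in> S \<Longrightarrow> \<exists>p P. finite_riesz_part (\<lambda>x. T x - t *\<^sub>R x) p P"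
    using defect_one_or_finite_riesz_spectrum[OF T] unfolding S_def by blast+
  obtain ts where ts: "set ts = S" using finite_list[OF fin] by blast
  obtain p P where pP: "\<And>t. t \<in> S \<Longrightarrow> finite_riesz_part (\<lambda>x. T x - t *\<^sub>R x) (p t) (P t)"
    using riesz by metis
  have "\<exists>P c. operator P \<and> riesz_projection_bound (\<lambda>x. T x - t *\<^sub>R x) (p t) P c" if t: "t \<in> S" for t
  proof -
    obtain c where "0 < c" "\<And>x. norm x \<le> c * norm (T x - t *\<^sub>R x - P t (T x - t *\<^sub>R x) + P t x)"
      using pP[OF t] boundedly_invertibleD unfolding finite_riesz_part_def by blast
    then show ?thesis
      using pP[OF t] unfolding finite_riesz_part_def riesz_projection_bound_def
      by (intro exI[of _ "P t"] exI[of _ c]) simp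
  qed
  moreover have "finite_dim sc {x. shifted_product T p ts x \<in> {0}}"
    by (rule finite_dim_shifted_product_vimage[OF T _ finite_dim_zero])
      (use pP ts in \<open>simp add: finite_riesz_part_def\<close>)
  ultimately show ?thesis using ts by (intro disjI2 exI[of _ p] exI[of _ ts]) simp
qed simp

lemma bounded_clinear_simps:
  assumes "bounded_clinear f"
  shows "f (x + y) = f x + f y" "f (x - y) = f x - f y" "f 0 = 0" "f (c *\<^sub>C x) = c *\<^sub>C f x"
    "f (r *\<^sub>R x) = r *\<^sub>R f x"
  using assms by (auto simp: bounded_clinear_def linear_simps)

lemma bounded_clinear_bound:
  assumes "bounded_clinear f" obtains K where "0 < K" "\<And>x. norm (f x) \<le> K * norm x"
  using bounded_linear.pos_bounded[of f] assms unfolding bounded_clinear_def by (metis mult.commute)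

lemma eventually_not_in_finite:
  fixes M :: "complex set"
  assumes "finite M" shows "eventually (\<lambda>z. z \<notin> M) (at \<mu>)" and "eventually (\<lambda>z. z \<notin> M) at_infinity"
proof -
  have "open (- (M - {\<mu>}))" by (rule open_Compl[OF finite_imp_closed[OF finite_Diff[OF assms]]])
  from eventually_at_in_open[OF this, of \<mu>] show "eventually (\<lambda>z. z \<notin> M) (at \<mu>)"
    by (auto elim!: eventually_mono)
  obtain B where B: "\<And>z. z \<in> M \<Longrightarrow> norm z \<le> B"
    using finite_imp_bounded[OF assms] by (auto simp: bounded_iff)
  show "eventually (\<lambda>z. z \<notin> M) at_infinity"
    unfolding eventually_at_infinity by (rule exI[of _ "B + 1"]) (use B in force)
qed

lemma holomorphic_vanishing_at_infinity:
  assumes M: "finite M" and hol: "F holomorphic_on - M"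
    and bd: "\<And>\<mu>. \<mu> \<in> M \<Longrightarrow> \<exists>C. eventually (\<lambda>z. norm (F z) \<le> C) (at \<mu>)"
    and lim: "(F \<longlongrightarrow> 0) at_infinity" and z: "z \<notin> M"
  shows "F z = 0"
proof -
  have "\<exists>G. G holomorphic_on UNIV \<and> (\<forall>z\<in>UNIV - M. G z = F z)"
  proof (rule removable_singularities[OF M])
    show "F holomorphic_on UNIV - M" using hol by (simp add: Compl_eq_Diff_UNIV)
    fix \<mu> assume "\<mu> \<in> M"
    then obtain C where "eventually (\<lambda>z. norm (F z) \<le> C) (at \<mu>)" using bd by blast
    then show "F \<in> O[at \<mu>](\<lambda>_. 1)" by (intro bigoI[of _ C]) simp
  qed simp
  then obtain G where G: "G holomorphic_on UNIV" "\<And>z. z \<notin> M \<Longrightarrow> G z = F z" by auto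
  have "eventually (\<lambda>z. F z = G z) at_infinity"
    using eventually_not_in_finite(2)[OF M] by eventually_elim (simp add: G(2))
  then have "(G \<longlongrightarrow> 0) at_infinity" using lim by (rule Lim_transform_eventually[rotated])
  from Liouville_weak_0[OF G(1) this, of z] show ?thesis using G(2)[OF z] by simp
qed

text \<open>The vector \<open>w\<close> is the value at \<open>y\<close> of the resolvent of \<open>U\<close> at \<open>z\<close>.\<close>

definition resolvent_bounded_at ::
  "('b::complex_normed_vector \<Rightarrow> 'b) \<Rightarrow> complex set \<Rightarrow> complex \<Rightarrow> 'b \<Rightarrow> bool"
  where "resolvent_bounded_at U M \<mu> y \<longleftrightarrow>
    (\<exists>r>0. \<exists>C. \<forall>z w. cmod (z - \<mu>) < r \<longrightarrow> z \<notin> M \<longrightarrow> z *\<^sub>C w - U w = y \<longrightarrow> norm w \<le> C)"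

text \<open>The vector \<open>- v\<close> is the derivative of \<open>w\<close> at \<open>z\<close>: the error \<open>e\<close> of the first-order expansion solves
\<open>(\<zeta> - U) e = (\<zeta> - z)\<^sup>2 v\<close>, and the resolvent is bounded near \<open>z\<close>.\<close>

lemma resolvent_has_derivative:
  fixes U :: "'b::complex_banach \<Rightarrow> 'b" and g :: "'b \<Rightarrow> complex"
  assumes U: "bounded_clinear U" and g: "bounded_clinear g" and S: "open S" "z \<in> S"
    and inv: "boundedly_invertible (\<lambda>x. z *\<^sub>C x - U x)"
    and w: "\<And>\<zeta>. \<zeta> \<in> S \<Longrightarrow> \<zeta> *\<^sub>C w \<zeta> - U (w \<zeta>) = y"
  shows "\<exists>D. ((\<lambda>\<zeta>. g (w \<zeta>)) has_field_derivative D) (at z)"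
proof -
  note U_simps = bounded_clinear_simps[OF U] and g_simps = bounded_clinear_simps[OF g]
  obtain c where c: "0 < c" "\<And>x. norm x \<le> c * norm (z *\<^sub>C x - U x)"
    using boundedly_invertibleD[OF inv] by blast
  obtain v where v: "z *\<^sub>C v - U v = w z"
    using inv unfolding boundedly_invertible_def surj_def by metis
  obtain K where K: "0 < K" "\<And>x. norm (g x) \<le> K * norm x" using bounded_clinear_bound[OF g] by blast
  have est: "norm ((g (w \<zeta>) - g (w z)) / (\<zeta> - z) - - g v) \<le> K * (2 * c * norm v) * cmod (\<zeta> - z)"
    if \<zeta>: "\<zeta> \<in> S" "\<zeta> \<noteq> z" "cmod (\<zeta> - z) < 1 / (2 * c)" for \<zeta>
  proof -
    define h where "h = \<zeta> - z"
    define e where "e = w \<zeta> - w z + h *\<^sub>C v"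
    have h: "h \<noteq> 0" "c * cmod h \<le> 1 / 2" using \<zeta>(2,3) c(1) by (auto simp: h_def field_simps)
    have split: "\<zeta> *\<^sub>C x = z *\<^sub>C x + h *\<^sub>C x" for x :: 'b
      by (simp add: h_def scaleC_add_left[symmetric])
    have "\<zeta> *\<^sub>C e - U e = (\<zeta> *\<^sub>C w \<zeta> - U (w \<zeta>)) - (\<zeta> *\<^sub>C w z - U (w z)) + (\<zeta> *\<^sub>C h *\<^sub>C v - h *\<^sub>C U v)"
      by (simp add: e_def U_simps scaleC_add_right complex_vector.scale_right_diff_distrib)
    also have "\<dots> = - (h *\<^sub>C w z) + (\<zeta> *\<^sub>C h *\<^sub>C v - h *\<^sub>C U v)"
      using w[OF \<zeta>(1)] w[OF S(2)] by (simp add: split algebra_simps)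
    also have "\<zeta> *\<^sub>C h *\<^sub>C v = h *\<^sub>C \<zeta> *\<^sub>C v" by (simp add: scaleC_scaleC mult.commute)
    also have "h *\<^sub>C \<zeta> *\<^sub>C v - h *\<^sub>C U v = h *\<^sub>C (z *\<^sub>C v - U v) + h *\<^sub>C h *\<^sub>C v"
      by (simp add: split scaleC_add_right complex_vector.scale_right_diff_distrib)
    finally have e: "\<zeta> *\<^sub>C e - U e = h *\<^sub>C h *\<^sub>C v" by (simp add: v)
    have "norm e \<le> c * norm (z *\<^sub>C e - U e)" by (rule c(2))
    also have "z *\<^sub>C e - U e = h *\<^sub>C h *\<^sub>C v - h *\<^sub>C e" using e by (simp add: split algebra_simps)
    also have "c * norm (h *\<^sub>C h *\<^sub>C v - h *\<^sub>C e) \<le> c * (cmod h * (cmod h * norm v) + cmod h * norm e)"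
      using norm_triangle_ineq4[of "h *\<^sub>C h *\<^sub>C v" "h *\<^sub>C e"] c(1)
      by (intro mult_left_mono) (simp_all add: norm_scaleC norm_mult mult.assoc)
    also have "\<dots> = c * cmod h * (cmod h * norm v) + (c * cmod h) * norm e" by (simp add: algebra_simps)
    also have "\<dots> \<le> c * cmod h * (cmod h * norm v) + 1 / 2 * norm e"
      using h(2) by (intro add_left_mono mult_right_mono) auto
    finally have ne: "norm e \<le> 2 * c * norm v * cmod h * cmod h" by (simp add: mult_ac)
    have "(g (w \<zeta>) - g (w z)) / h - - g v = g e / h"
      using h(1) by (simp add: e_def g_simps scaleC_complex_def field_simps)
    also have "norm \<dots> \<le> K * (2 * c * norm v * cmod h * cmod h) / cmod h"
      unfolding norm_divide using K ne
      by (intro divide_right_mono order_trans[OF K(2)] mult_left_mono) auto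
    also have "\<dots> = K * (2 * c * norm v) * cmod h" using h(1) by simp
    finally show ?thesis by (simp add: h_def)
  qed
  have ev: "eventually (\<lambda>\<zeta>. \<zeta> \<in> (S \<inter> ball z (1 / (2 * c))) - {z}) (at z)"
    using S c(1) by (intro eventually_at_in_open) auto
  have "((\<lambda>\<zeta>. (g (w \<zeta>) - g (w z)) / (\<zeta> - z) - - g v) \<longlongrightarrow> 0) (at z)"
  proof (rule Lim_null_comparison)
    show "eventually (\<lambda>\<zeta>. norm ((g (w \<zeta>) - g (w z)) / (\<zeta> - z) - - g v) \<le> K * (2 * c * norm v) * cmod (\<zeta> - z)) (at z)"
      using ev by eventually_elim (rule est, auto simp: dist_norm norm_minus_commute)
    have "((\<lambda>\<zeta>. K * (2 * c * norm v) * cmod (\<zeta> - z)) \<longlongrightarrow> K * (2 * c * norm v) * cmod (z - z)) (at z)"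
      by (intro tendsto_intros)
    then show "((\<lambda>\<zeta>. K * (2 * c * norm v) * cmod (\<zeta> - z)) \<longlongrightarrow> 0) (at z)" by simp
  qed
  from LIM_zero_cancel[OF this] show ?thesis unfolding has_field_derivative_iff by blast
qed

text \<open>The function \<open>z \<mapsto> g ((z - U)\<^sup>-\<^sup>1 y)\<close> extends to an entire function that vanishes at infinity, hence is zero by Liouville's
theorem, for every functional \<open>g\<close>.\<close>

lemma resolvent_bounded_imp_zero:
  fixes U :: "'b::complex_banach \<Rightarrow> 'b"
  assumes U: "bounded_clinear U" and M: "finite M"
    and reg: "\<And>z. z \<notin> M \<Longrightarrow> boundedly_invertible (\<lambda>x. z *\<^sub>C x - U x)"
    and bd: "\<And>\<mu>. \<mu> \<in> M \<Longrightarrow> resolvent_bounded_at U M \<mu> y"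
  shows "y = 0"
proof (rule ccontr)
  assume y: "y \<noteq> 0"
  interpret B: scalar_banach "(*\<^sub>C) :: complex \<Rightarrow> 'b \<Rightarrow> 'b" by (rule scalar_banach_complex)
  have "\<exists>w. z *\<^sub>C w - U w = y" if "z \<notin> M" for z
    using reg[OF that] unfolding boundedly_invertible_def surj_def by metis
  then obtain w where w: "\<And>z. z \<notin> M \<Longrightarrow> z *\<^sub>C w z - U (w z) = y" by metis
  obtain z0 where z0: "z0 \<notin> M" using M ex_new_if_finite[OF infinite_UNIV_char_0] by blast
  have "w z0 \<noteq> 0" using w[OF z0] y bounded_clinear_simps(3)[OF U] by auto
  then obtain g where g: "B.functional g" "g (w z0) = 1" using B.norming_functional by metis
  have g': "bounded_clinear g"
    using g(1) by (simp add: B.functional_def bounded_clinear_def scaleC_complex_def)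
  obtain K where K: "0 < K" "\<And>x. norm (g x) \<le> K * norm x" using bounded_clinear_bound[OF g'] by blast
  obtain L where L: "0 < L" "\<And>x. norm (U x) \<le> L * norm x" using bounded_clinear_bound[OF U] by blast
  have open_M: "open (- M)" using M by (simp add: finite_imp_closed open_Compl)
  have "g (w z0) = 0"
  proof (rule holomorphic_vanishing_at_infinity[OF M, of "\<lambda>z. g (w z)"])
    show "(\<lambda>z. g (w z)) holomorphic_on - M"
      unfolding holomorphic_on_open[OF open_M]
    proof
      fix z assume z: "z \<in> - M"
      show "\<exists>f'. ((\<lambda>z. g (w z)) has_field_derivative f') (at z)"
        by (rule resolvent_has_derivative[OF U g' open_M z]) (use z reg w in auto)
    qed
    fix \<mu> assume "\<mu> \<in> M"
    then obtain r C where r: "0 < r"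
      "\<And>z w. cmod (z - \<mu>) < r \<Longrightarrow> z \<notin> M \<Longrightarrow> z *\<^sub>C w - U w = y \<Longrightarrow> norm w \<le> C"
      using bd unfolding resolvent_bounded_at_def by metis
    have "eventually (\<lambda>z. cmod (z - \<mu>) < r) (at \<mu>)"
      using r(1) by (auto simp: eventually_at dist_norm)
    then have "eventually (\<lambda>z. norm (g (w z)) \<le> K * C) (at \<mu>)"
      using eventually_not_in_finite(1)[OF M]
    proof eventually_elim
      case (elim z)
      have "norm (w z) \<le> C" using r(2)[OF elim w[OF elim(2)]] .
      then show ?case using order_trans[OF K(2) mult_left_mono] K(1) by simp
    qed
    then show "\<exists>C. eventually (\<lambda>z. norm (g (w z)) \<le> C) (at \<mu>)" by blast
  next
    show "((\<lambda>z. g (w z)) \<longlongrightarrow> 0) at_infinity"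
    proof (rule Lim_null_comparison)
      have big: "eventually (\<lambda>z. 2 * L \<le> cmod z) at_infinity"
        unfolding eventually_at_infinity by blast
      show "eventually (\<lambda>z. norm (g (w z)) \<le> K * (2 * norm y) * inverse (cmod z)) at_infinity"
        using big eventually_not_in_finite(2)[OF M]
      proof eventually_elim
        case (elim z)
        have z: "0 < cmod z" using elim(1) L(1) by linarith
        have "norm (z *\<^sub>C w z) \<le> norm y + norm (U (w z))"
          using norm_triangle_ineq[of y "U (w z)"] w[OF elim(2)] by (metis diff_add_cancel)
        also have "\<dots> \<le> norm y + (cmod z / 2) * norm (w z)"
          using elim(1) by (intro add_left_mono order_trans[OF L(2)] mult_right_mono) auto
        finally have "norm (w z) \<le> 2 * norm y * inverse (cmod z)"
          using z by (simp add: norm_scaleC field_simps)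
        then have "K * norm (w z) \<le> K * (2 * norm y * inverse (cmod z))" using K(1) by (intro mult_left_mono) auto
        then show ?case using K(2)[of "w z"] by (simp add: mult.assoc)
      qed
      show "((\<lambda>z. K * (2 * norm y) * inverse (cmod z)) \<longlongrightarrow> 0) at_infinity"
        by (intro tendsto_mult_right_zero tendsto_inverse_0_at_top filterlim_norm_at_top)
    qed
  qed (rule z0)
  then show False using g(2) by simp
qed

text \<open>Only the component \<open>r - P r\<close> of the solution \<open>r\<close> contributes to \<open>(A ^^ p) r\<close>, and modulo the range of \<open>P\<close> the resolvent
is bounded near \<open>0\<close>. So the power of \<open>A\<close> removes the pole.\<close>

lemma riesz_resolvent_bound:
  fixes A P :: "'b::complex_normed_vector \<Rightarrow> 'b"
  assumes A: "bounded_clinear A" and P: "bounded_clinear P" and PP: "\<And>x. P (P x) = P x"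
    and AP: "\<And>x. (A ^^ p) (P x) = 0" and PAP: "\<And>x. P (A (P x)) = A (P x)"
    and c: "0 < c" "\<And>x. norm x \<le> c * norm (A x - P (A x) + P x)"
  shows "\<exists>C. \<forall>s r. cmod s \<le> 1 / (2 * c) \<longrightarrow> s *\<^sub>C r - A r = x \<longrightarrow> norm ((A ^^ p) r) \<le> C"
proof -
  note A_simps = bounded_clinear_simps[OF A] and P_simps = bounded_clinear_simps[OF P]
  have Ap: "bounded_clinear (A ^^ p)"
  proof (induction p)
    case 0
    show ?case by (simp add: id_def bounded_clinear_def)
  next
    case (Suc p)
    then show ?case using A by (simp add: bounded_clinear_def bounded_linear_compose comp_def)
  qed
  obtain K where K: "0 < K" "\<And>x. norm ((A ^^ p) x) \<le> K * norm x" using bounded_clinear_bound[OF Ap] by blast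
  have "norm ((A ^^ p) r) \<le> K * (2 * c * norm (x - P x))" if s: "cmod s \<le> 1 / (2 * c)" "s *\<^sub>C r - A r = x" for s r
  proof -
    define q where "q = r - P r"
    have Pq: "P q = 0" by (simp add: q_def P_simps PP)
    have Ar: "A r = s *\<^sub>C r - x" using s(2) by (simp add: algebra_simps)
    have "A q - P (A q) + P q = s *\<^sub>C q - (x - P x)"
      by (simp add: Pq) (simp add: q_def A_simps P_simps PAP Ar complex_vector.scale_right_diff_distrib)
    then have "norm q \<le> c * norm (s *\<^sub>C q - (x - P x))" using c(2)[of q] by simp
    also have "\<dots> \<le> c * (cmod s * norm q + norm (x - P x))"
      using norm_triangle_ineq4[of "s *\<^sub>C q" "x - P x"] c(1) by (intro mult_left_mono) (auto simp: norm_scaleC)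
    also have "\<dots> = (c * cmod s) * norm q + c * norm (x - P x)" by (simp add: algebra_simps)
    also have "\<dots> \<le> 1 / 2 * norm q + c * norm (x - P x)"
      using s(1) c(1) by (intro add_right_mono mult_right_mono) (auto simp: field_simps)
    finally have q: "norm q \<le> 2 * c * norm (x - P x)" by simp
    have "(A ^^ p) r = (A ^^ p) q" by (simp add: q_def bounded_clinear_simps[OF Ap] AP)
    then show ?thesis using order_trans[OF K(2)[of q] mult_left_mono[OF q]] K(1) by simp
  qed
  then show ?thesis by blast
qed

lemma resolvent_bounded_at_power:
  fixes U P :: "'b::complex_banach \<Rightarrow> 'b"
  assumes U: "bounded_clinear U" and reg: "\<And>z. z \<notin> M \<Longrightarrow> boundedly_invertible (\<lambda>x. z *\<^sub>C x - U x)"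
    and A_def: "A = (\<lambda>x. U x - t *\<^sub>R x)"
    and P: "bounded_clinear P" and PP: "\<And>x. P (P x) = P x"
    and AP: "\<And>x. (A ^^ p) (P x) = 0" and PAP: "\<And>x. P (A (P x)) = A (P x)"
    and c: "0 < c" "\<And>x. norm x \<le> c * norm (A x - P (A x) + P x)"
  shows "resolvent_bounded_at U M (of_real t) ((A ^^ p) x)"
proof -
  note U_simps = bounded_clinear_simps[OF U]
  have A: "bounded_clinear A"
    using U unfolding A_def bounded_clinear_def
    by (auto intro!: bounded_linear_sub bounded_linear_scaleC simp: scaleR_scaleC scaleC_scaleC mult.commute complex_vector.scale_right_diff_distrib)
  obtain C where C: "\<And>s r. cmod s \<le> 1 / (2 * c) \<Longrightarrow> s *\<^sub>C r - A r = x \<Longrightarrow> norm ((A ^^ p) r) \<le> C"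
    using riesz_resolvent_bound[OF A P PP AP PAP c, of x] by blast
  have "norm w \<le> C"
    if z: "cmod (z - of_real t) < 1 / (2 * c)" "z \<notin> M" "z *\<^sub>C w - U w = (A ^^ p) x" for z w
  proof -
    obtain r where r: "z *\<^sub>C r - U r = x"
      using reg[OF z(2)] unfolding boundedly_invertible_def surj_def by metis
    have comm: "z *\<^sub>C (A ^^ k) v - U ((A ^^ k) v) = (A ^^ k) (z *\<^sub>C v - U v)" for k v
    proof (induction k)
      case (Suc k)
      have "z *\<^sub>C A u - U (A u) = A (z *\<^sub>C u - U u)" for u
        by (simp add: A_def U_simps scaleR_diff_right complex_vector.scale_right_diff_distrib
            scaleR_scaleC scaleC_scaleC mult.commute)
      then show ?case using Suc by simp
    qed simp
    have "z *\<^sub>C (w - (A ^^ p) r) - U (w - (A ^^ p) r) = 0"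
      using comm[of p r] z(3) by (simp add: r U_simps complex_vector.scale_right_diff_distrib algebra_simps)
    then have w: "w = (A ^^ p) r" using boundedly_invertible_eq_0[OF reg[OF z(2)]] by fastforce
    have "(z - of_real t) *\<^sub>C r - A r = x"
      using r by (simp add: A_def scaleR_scaleC complex_vector.scale_left_diff_distrib)
    then show ?thesis unfolding w using C[of "z - of_real t" r] z(1) by simp
  qed
  then show ?thesis
    unfolding resolvent_bounded_at_def using c(1) by (intro exI[of _ "1 / (2 * c)"]) auto
qed

lemma resolvent_bounded_at_shift:
  fixes U :: "'b::complex_banach \<Rightarrow> 'b"
  assumes U: "bounded_clinear U" and reg: "\<And>z. z \<notin> M \<Longrightarrow> boundedly_invertible (\<lambda>x. z *\<^sub>C x - U x)"
    and y: "resolvent_bounded_at U M \<mu> y"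
  shows "resolvent_bounded_at U M \<mu> (U y - t *\<^sub>R y)"
proof -
  note U_simps = bounded_clinear_simps[OF U]
  obtain r C where r: "0 < r"
    "\<And>z w. cmod (z - \<mu>) < r \<Longrightarrow> z \<notin> M \<Longrightarrow> z *\<^sub>C w - U w = y \<Longrightarrow> norm w \<le> C"
    using y unfolding resolvent_bounded_at_def by metis
  obtain L where L: "0 < L" "\<And>x. norm (U x) \<le> L * norm x" using bounded_clinear_bound[OF U] by blast
  have "norm w \<le> (L + \<bar>t\<bar>) * C"
    if z: "cmod (z - \<mu>) < r" "z \<notin> M" "z *\<^sub>C w - U w = U y - t *\<^sub>R y" for z w
  proof -
    obtain v where v: "z *\<^sub>C v - U v = y"
      using reg[OF z(2)] unfolding boundedly_invertible_def surj_def by metis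
    define u where "u = U v - t *\<^sub>R v"
    have "z *\<^sub>C u - U u = U (z *\<^sub>C v - U v) - t *\<^sub>R (z *\<^sub>C v - U v)"
      by (simp add: u_def U_simps scaleR_diff_right complex_vector.scale_right_diff_distrib
          scaleR_scaleC scaleC_scaleC mult.commute)
    then have "z *\<^sub>C u - U u = z *\<^sub>C w - U w" using z(3) by (simp add: v)
    then have "z *\<^sub>C (w - u) - U (w - u) = 0"
      by (simp add: U_simps complex_vector.scale_right_diff_distrib algebra_simps)
    then have w: "w = U v - t *\<^sub>R v"
      unfolding u_def[symmetric] using boundedly_invertible_eq_0[OF reg[OF z(2)]] by fastforce
    have "norm w \<le> (L + \<bar>t\<bar>) * norm v"
      unfolding w using norm_triangle_ineq4[of "U v" "t *\<^sub>R v"] L(2)[of v] by (simp add: algebra_simps)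
    also have "\<dots> \<le> (L + \<bar>t\<bar>) * C" using r(2)[OF z(1,2) v] L(1) by (intro mult_left_mono) auto
    finally show ?thesis .
  qed
  then show ?thesis unfolding resolvent_bounded_at_def using r(1) by blast
qed

text \<open>The factor that belongs to \<open>t\<close> makes the resolvent bounded near \<open>t\<close>, and the other factors, which commute with the
resolvent, preserve this.\<close>

lemma shifted_product_eq_0:
  fixes U :: "'b::complex_banach \<Rightarrow> 'b"
  assumes U: "bounded_clinear U"
    and reg: "\<And>z. z \<notin> of_real ` set ts \<Longrightarrow> boundedly_invertible (\<lambda>x. z *\<^sub>C x - U x)"
    and riesz: "\<And>t. t \<in> set ts \<Longrightarrow> \<exists>P c. bounded_clinear P \<and> riesz_projection_bound (\<lambda>x. U x - t *\<^sub>R x) (p t) P c"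
  shows "shifted_product U p ts x = 0"
proof (rule resolvent_bounded_imp_zero[OF U _ reg])
  fix \<mu> assume "\<mu> \<in> (of_real ` set ts :: complex set)"
  then obtain t where t: "t \<in> set ts" "\<mu> = of_real t" by blast
  let ?M = "of_real ` set ts :: complex set"
  obtain P c where P: "bounded_clinear P" and r: "riesz_projection_bound (\<lambda>x. U x - t *\<^sub>R x) (p t) P c"
    using riesz[OF t(1)] by blast
  have power: "resolvent_bounded_at U ?M (of_real t) (((\<lambda>x. U x - t *\<^sub>R x) ^^ p t) y)" for y
    by (rule resolvent_bounded_at_power[OF U reg refl P])
      (use r in \<open>auto simp: riesz_projection_bound_def\<close>)
  have shift: "resolvent_bounded_at U ?M (of_real t) (((\<lambda>x. U x - s *\<^sub>R x) ^^ k) y)"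
    if "resolvent_bounded_at U ?M (of_real t) y" for s k y
    using that by (induction k) (simp_all add: resolvent_bounded_at_shift[OF U reg])
  have "t \<in> set us \<Longrightarrow> resolvent_bounded_at U ?M (of_real t) (shifted_product U p us x)" for us
    by (induction us) (auto intro: power shift)
  then show "resolvent_bounded_at U ?M \<mu> (shifted_product U p ts x)" using t by simp
qed simp

lemma boundedly_invertible_minus:
  "boundedly_invertible (\<lambda>x. f x - g x) \<longleftrightarrow> boundedly_invertible (\<lambda>x. g x - f x)"
proof -
  have "surj (\<lambda>x. f x - g x) \<longleftrightarrow> surj (\<lambda>x. g x - f x)"
    unfolding surj_def by (metis minus_diff_eq minus_minus)
  then show ?thesis by (simp add: boundedly_invertible_def norm_minus_commute)
qed

lemma op_spectrum_iff:
  fixes U :: "'b::complex_banach \<Rightarrow>\<^sub>C\<^sub>L 'b"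
  shows "z \<in> op_spectrum U \<longleftrightarrow> \<not> boundedly_invertible (\<lambda>x. z *\<^sub>C x - cblinfun_apply U x)"
proof -
  interpret B: scalar_banach "(*\<^sub>C) :: complex \<Rightarrow> 'b \<Rightarrow> 'b" by (rule scalar_banach_complex)
  define A where "A x = z *\<^sub>C x - cblinfun_apply U x" for x
  have A: "cblinfun_apply (z *\<^sub>C id_cblinfun - U) = A"
    by (simp add: fun_eq_iff A_def minus_cblinfun.rep_eq scaleC_cblinfun.rep_eq id_cblinfun.rep_eq)
  then have bA: "bounded_clinear A" using cblinfun_apply[of "z *\<^sub>C id_cblinfun - U"] by simp
  have ext: "(S o\<^sub>C\<^sub>L T = id_cblinfun) \<longleftrightarrow> (\<forall>x. cblinfun_apply S (cblinfun_apply T x) = x)" for S T :: "'b \<Rightarrow>\<^sub>C\<^sub>L 'b"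
    by (metis cblinfun_apply_inject cblinfun_compose.rep_eq ext id_cblinfun.rep_eq)
  have "(\<exists>S. S o\<^sub>C\<^sub>L (z *\<^sub>C id_cblinfun - U) = id_cblinfun \<and> (z *\<^sub>C id_cblinfun - U) o\<^sub>C\<^sub>L S = id_cblinfun)
      \<longleftrightarrow> boundedly_invertible A"
  proof
    assume "\<exists>S. S o\<^sub>C\<^sub>L (z *\<^sub>C id_cblinfun - U) = id_cblinfun \<and> (z *\<^sub>C id_cblinfun - U) o\<^sub>C\<^sub>L S = id_cblinfun"
    then obtain S where S: "\<And>x. cblinfun_apply S (A x) = x" "\<And>x. A (cblinfun_apply S x) = x"
      unfolding ext A by blast
    have "bounded_clinear (cblinfun_apply S)" using cblinfun_apply[of S] by simp
    then obtain K where "\<And>x. norm (cblinfun_apply S x) \<le> K * norm x" using bounded_clinear_bound by blast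
    then have "norm x \<le> K * norm (A x)" for x by (metis S(1))
    then show "boundedly_invertible A" unfolding boundedly_invertible_def using S(2) by (metis surjI)
  next
    assume inv: "boundedly_invertible A"
    have "B.operator A" using bA by (simp add: B.operator_def bounded_clinear_def)
    then obtain R where R: "B.operator R" "\<And>x. A (R x) = x" "\<And>x. R (A x) = x"
      using B.bounded_inverse[OF _ inv] by metis
    have "cblinfun_apply (CBlinfun R) = R"
      using R(1) by (simp add: CBlinfun_inverse B.operator_def bounded_clinear_def)
    then show "\<exists>S. S o\<^sub>C\<^sub>L (z *\<^sub>C id_cblinfun - U) = id_cblinfun \<and> (z *\<^sub>C id_cblinfun - U) o\<^sub>C\<^sub>L S = id_cblinfun"
      unfolding ext A using R by (intro exI[of _ "CBlinfun R"]) simp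
  qed
  moreover have "A = (\<lambda>x. z *\<^sub>C x - cblinfun_apply U x)" by (simp add: fun_eq_iff A_def)
  ultimately show ?thesis by (simp only: op_spectrum_def mem_Collect_eq)
qed

theorem complex_almost_invariant_halfspace:
  fixes U :: "'b::complex_banach \<Rightarrow>\<^sub>C\<^sub>L 'b"
  assumes dim: "\<not> finite_dim ((*\<^sub>C) :: complex \<Rightarrow> 'b \<Rightarrow> 'b) UNIV" and refl: "creflexive_space TYPE('b)"
    and spec: "op_spectrum U \<subseteq> \<real> \<or> infinite (op_spectrum U \<inter> \<real>)"
  shows "\<exists>Y. almost_invariant_halfspace (*\<^sub>C) (cblinfun_apply U) 1 Y"
proof (rule ccontr)
  assume none: "\<not> ?thesis"
  interpret B: reflexive_scalar_banach "(*\<^sub>C) :: complex \<Rightarrow> 'b \<Rightarrow> 'b"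
    by (rule reflexive_scalar_banach_complex[OF refl])
  define V where "V = cblinfun_apply U"
  have bV: "bounded_clinear V" using cblinfun_apply[of U] by (simp add: V_def)
  then have V: "B.operator V" by (simp add: B.operator_def bounded_clinear_def)
  have not_defect_one: "\<not> (\<exists>Y. B.defect_one V Y)" using B.defect_one_almost_invariant none unfolding V_def by blast
  define S where "S = {t. \<not> boundedly_invertible (\<lambda>x. V x - t *\<^sub>R x)}"
  have "t \<in> S \<longleftrightarrow> of_real t \<in> op_spectrum U" for t
    unfolding S_def op_spectrum_iff V_def[symmetric]
    using boundedly_invertible_minus[of V "\<lambda>x. t *\<^sub>R x"] by (simp add: scaleR_scaleC)
  then have SR: "op_spectrum U \<inter> \<real> = of_real ` S" by (auto elim!: Reals_cases)
  obtain p ts where ts: "set ts = S" and ker: "finite_dim (*\<^sub>C) {x. shifted_product V p ts x = 0}"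
    and riesz: "\<And>t. t \<in> S \<Longrightarrow> \<exists>P c. B.operator P \<and> riesz_projection_bound (\<lambda>x. V x - t *\<^sub>R x) (p t) P c"
    using B.defect_one_or_finite_dim_kernel[OF V] not_defect_one unfolding S_def by blast
  have "finite S" using ts by (metis List.finite_set)
  then have spec: "op_spectrum U = of_real ` S" using spec SR by auto
  have "shifted_product V p ts x = 0" for x
  proof (rule shifted_product_eq_0[OF bV])
    show "boundedly_invertible (\<lambda>x. z *\<^sub>C x - V x)" if "z \<notin> of_real ` set ts" for z
      using that op_spectrum_iff[of z U] by (simp add: ts spec V_def)
    show "\<exists>P c. bounded_clinear P \<and> riesz_projection_bound (\<lambda>x. V x - t *\<^sub>R x) (p t) P c"
      if "t \<in> set ts" for t
      using riesz[of t] that ts by (simp add: B.operator_def bounded_clinear_def)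
  qed
  then show False using ker dim by simp
qed

section \<open>Complexification\<close>

definition complexified :: "('a \<Rightarrow> 'a) \<Rightarrow> 'a complexification \<Rightarrow> 'a complexification"
  where "complexified f z = Complexification (f (re_part z)) (f (im_part z))"

lemma re_part_complexified [simp]: "re_part (complexified f z) = f (re_part z)"
  and im_part_complexified [simp]: "im_part (complexified f z) = f (im_part z)"
  by (simp_all add: complexified_def)

lemma complexify_eq: "cblinfun_apply (complexify T) = complexified (blinfun_apply T)"
  by (simp add: fun_eq_iff complexify.rep_eq complexified_def)

lemma bounded_clinear_complexified:
  fixes f :: "'a::real_normed_vector \<Rightarrow> 'a"
  assumes "bounded_linear f" shows "bounded_clinear (complexified f)"
  using cblinfun_apply[of "complexify (Blinfun f)"] complexify_eq[of "Blinfun f"]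
  by (simp add: bounded_linear_Blinfun_apply[OF assms])

lemma complexified_power: "(complexified f ^^ n) z = complexified (f ^^ n) z"
  by (induction n) (simp_all add: complexified_def)

lemma complexified_shift:
  fixes f :: "'a::real_normed_vector \<Rightarrow> 'a"
  shows "complexified f z - t *\<^sub>R z = complexified (\<lambda>x. f x - t *\<^sub>R x) z"
  by (simp add: complexified_def complexification_defs)

lemma complexified_bounded_below:
  fixes f :: "'a::real_normed_vector \<Rightarrow> 'a"
  assumes c: "0 < c" "\<And>x. norm x \<le> c * norm (f x)"
  shows "norm z \<le> 2 * c * norm (complexified f z)"
proof -
  have "norm z \<le> norm (re_part z) + norm (im_part z)" by (rule norm_complexification_le)
  also have "\<dots> \<le> c * norm (f (re_part z)) + c * norm (f (im_part z))" by (intro add_mono c(2))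
  also have "\<dots> \<le> c * norm (complexified f z) + c * norm (complexified f z)"
    using norm_re_part_le[of "complexified f z"] norm_im_part_le[of "complexified f z"] c(1)
    by (intro add_mono mult_left_mono) auto
  finally show ?thesis by simp
qed

lemma boundedly_invertible_complexified:
  fixes f :: "'a::real_normed_vector \<Rightarrow> 'a"
  assumes f: "f 0 = 0"
  shows "boundedly_invertible (complexified f) \<longleftrightarrow> boundedly_invertible f"
proof
  assume "boundedly_invertible f"
  then obtain c where c: "0 < c" "\<And>x. norm x \<le> c * norm (f x)" and surj: "surj f"
    using boundedly_invertibleD by (metis boundedly_invertible_def)
  have "norm z \<le> 2 * c * norm (complexified f z)" for z by (rule complexified_bounded_below[OF c])
  moreover have "surj (complexified f)"
  proof -
    have "\<exists>z. w = complexified f z" for w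
    proof -
      obtain x y where "re_part w = f x" "im_part w = f y" using surj by (metis surjD)
      then show ?thesis
        by (intro exI[of _ "Complexification x y"]) (simp add: complexified_def complexification.expand)
    qed
    then show ?thesis by (simp add: surj_def)
  qed
  ultimately show "boundedly_invertible (complexified f)" unfolding boundedly_invertible_def by blast
next
  assume inv: "boundedly_invertible (complexified f)"
  then obtain c where c: "\<And>z. norm z \<le> c * norm (complexified f z)" "0 < c"
    using boundedly_invertibleD by metis
  have "norm x \<le> c * norm (f x)" for x
  proof -
    have "norm x \<le> norm (Complexification x 0)" using norm_re_part_le[of "Complexification x 0"] by simp
    also have "\<dots> \<le> c * norm (complexified f (Complexification x 0))" by (rule c)
    also have "norm (complexified f (Complexification x 0)) \<le> norm (f x)"
      using norm_complexification_le[of "complexified f (Complexification x 0)"] by (simp add: f)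
    finally show ?thesis using c(2) by simp
  qed
  moreover have "surj f"
  proof -
    have "\<exists>x. y = f x" for y
    proof -
      obtain z where "complexified f z = Complexification y 0"
        using inv unfolding boundedly_invertible_def surj_def by metis
      then have "f (re_part z) = y" by (simp add: complexified_def)
      then show ?thesis by blast
    qed
    then show ?thesis by (simp add: surj_def)
  qed
  ultimately show "boundedly_invertible f" unfolding boundedly_invertible_def by blast
qed

lemma riesz_projection_bound_complexified:
  fixes A P :: "'a::real_normed_vector \<Rightarrow> 'a"
  assumes "riesz_projection_bound A p P c"
  shows "riesz_projection_bound (complexified A) p (complexified P) (2 * c)"
proof -
  have r: "\<And>x. P (P x) = P x" "\<And>x. (A ^^ p) (P x) = 0" "\<And>x. P (A (P x)) = A (P x)" "0 < c"
    "\<And>x. norm x \<le> c * norm (A x - P (A x) + P x)"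
    using assms by (auto simp: riesz_projection_bound_def)
  define B where "B x = A x - P (A x) + P x" for x
  have "norm z \<le> 2 * c * norm (complexified B z)" for z
    by (rule complexified_bounded_below) (use r(4,5) in \<open>simp_all add: B_def\<close>)
  moreover have "complexified A z - complexified P (complexified A z) + complexified P z = complexified B z" for z
    by (simp add: complexified_def complexification_defs B_def)
  ultimately show ?thesis
    using r(1-4) unfolding riesz_projection_bound_def complexified_power
    by (simp add: complexified_def complexification_defs)
qed

lemma shifted_product_complexified:
  fixes f :: "'a::real_normed_vector \<Rightarrow> 'a"
  shows "shifted_product (complexified f) p ts z = complexified (shifted_product f p ts) z"
  by (induction ts) (simp_all add: complexified_shift complexified_power, simp_all add: complexified_def)

theorem real_almost_invariant_halfspace:
  fixes T :: "'a::banach \<Rightarrow>\<^sub>L 'a"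
  assumes dim: "\<not> finite_dim ((*\<^sub>R) :: real \<Rightarrow> 'a \<Rightarrow> 'a) UNIV" and refl: "reflexive_space TYPE('a)"
    and spec: "op_spectrum (complexify T) \<subseteq> \<real> \<or> infinite (op_spectrum (complexify T) \<inter> \<real>)"
  shows "\<exists>Y. almost_invariant_halfspace (*\<^sub>R) (blinfun_apply T) 1 Y"
proof (rule ccontr)
  assume none: "\<not> ?thesis"
  interpret B: reflexive_scalar_banach "(*\<^sub>R) :: real \<Rightarrow> 'a \<Rightarrow> 'a"
    by (rule reflexive_scalar_banach_real[OF refl])
  define V where "V = blinfun_apply T"
  have lV: "bounded_linear V" unfolding V_def by (rule blinfun.bounded_linear_right)
  then have V: "B.operator V" by (simp add: B.operator_def linear_simps)
  have not_defect_one: "\<not> (\<exists>Y. B.defect_one V Y)" using B.defect_one_almost_invariant none unfolding V_def by blast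
  have specV: "z \<in> op_spectrum (complexify T) \<longleftrightarrow> \<not> boundedly_invertible (\<lambda>x. z *\<^sub>C x - complexified V x)" for z
    by (simp add: op_spectrum_iff complexify_eq V_def)
  define S where "S = {t. \<not> boundedly_invertible (\<lambda>x. V x - t *\<^sub>R x)}"
  have "t \<in> S \<longleftrightarrow> of_real t \<in> op_spectrum (complexify T)" for t
  proof -
    have "boundedly_invertible (\<lambda>x. complex_of_real t *\<^sub>C x - complexified V x) \<longleftrightarrow>
        boundedly_invertible (\<lambda>x. complexified V x - t *\<^sub>R x)"
      using boundedly_invertible_minus[of "complexified V" "\<lambda>x. t *\<^sub>R x"] by (simp add: scaleR_scaleC)
    also have "(\<lambda>x. complexified V x - t *\<^sub>R x) = complexified (\<lambda>x. V x - t *\<^sub>R x)"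
      by (simp add: fun_eq_iff complexified_shift)
    also have "boundedly_invertible (complexified (\<lambda>x. V x - t *\<^sub>R x)) \<longleftrightarrow> boundedly_invertible (\<lambda>x. V x - t *\<^sub>R x)"
      by (rule boundedly_invertible_complexified) (simp add: linear_simps[OF lV])
    finally show ?thesis by (simp add: S_def specV)
  qed
  then have SR: "op_spectrum (complexify T) \<inter> \<real> = of_real ` S" by (auto elim!: Reals_cases)
  obtain p ts where ts: "set ts = S" and ker: "finite_dim (*\<^sub>R) {x. shifted_product V p ts x = 0}"
    and riesz: "\<And>t. t \<in> S \<Longrightarrow> \<exists>P c. B.operator P \<and> riesz_projection_bound (\<lambda>x. V x - t *\<^sub>R x) (p t) P c"
    using B.defect_one_or_finite_dim_kernel[OF V] not_defect_one unfolding S_def by blast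
  have "finite S" using ts by (metis List.finite_set)
  then have spec: "op_spectrum (complexify T) = of_real ` S" using spec SR by auto
  have "shifted_product (complexified V) p ts z = 0" for z
  proof (rule shifted_product_eq_0[OF bounded_clinear_complexified[OF lV]])
    show "boundedly_invertible (\<lambda>x. z *\<^sub>C x - complexified V x)" if "z \<notin> of_real ` set ts" for z
      using that specV[of z] by (simp add: ts spec)
    fix t assume "t \<in> set ts"
    then obtain P c where P: "B.operator P" "riesz_projection_bound (\<lambda>x. V x - t *\<^sub>R x) (p t) P c"
      using riesz ts by blast
    have "riesz_projection_bound (\<lambda>x. complexified V x - t *\<^sub>R x) (p t) (complexified P) (2 * c)"
      unfolding complexified_shift by (rule riesz_projection_bound_complexified[OF P(2)])
    then show "\<exists>P c. bounded_clinear P \<and> riesz_projection_bound (\<lambda>x. complexified V x - t *\<^sub>R x) (p t) P c"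
      using bounded_clinear_complexified[OF B.operator_bounded_linear[OF P(1)]] by blast
  qed
  then have "shifted_product V p ts x = 0" for x
    using arg_cong[OF shifted_product_complexified[of V p ts "Complexification x x"], of re_part]
    by (simp add: zero_complexification_def)
  then show False using ker dim by simp
qed

theorem corollary3p17:
  fixes T :: "'a::banach \<Rightarrow>\<^sub>L 'a"
    and U :: "'b::complex_banach \<Rightarrow>\<^sub>C\<^sub>L 'b"
  shows "(\<not> finite_dim ((*\<^sub>R) :: real \<Rightarrow> 'a \<Rightarrow> 'a) UNIV \<and> reflexive_space TYPE('a) \<and>
          (op_spectrum (complexify T) \<subseteq> \<real> \<or> infinite (op_spectrum (complexify T) \<inter> \<real>)) \<longrightarrow>
            (\<exists>Y. almost_invariant_halfspace (*\<^sub>R) (blinfun_apply T) 1 Y)) \<and>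
         (\<not> finite_dim ((*\<^sub>C) :: complex \<Rightarrow> 'b \<Rightarrow> 'b) UNIV \<and> creflexive_space TYPE('b) \<and>
          (op_spectrum U \<subseteq> \<real> \<or> infinite (op_spectrum U \<inter> \<real>)) \<longrightarrow>
            (\<exists>Y. almost_invariant_halfspace (*\<^sub>C) (cblinfun_apply U) 1 Y))"
  using real_almost_invariant_halfspace[of T] complex_almost_invariant_halfspace[of U] by blast

end
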